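(* Fix an integer $t\ge1$ and let $\mathcal{G}_M^t$ be the class of map graphs that are $K_t$-free. Then $\mathcal{G}_M^t$ has truly sublinear treewidth with parameter $\lambda=\frac12$; that is, for every $\eta>0$ there exists $\beta>0$ such that for every $G\in\mathcal{G}_M^t$ and every $X\subseteq V(G)$ with $\mathbf{tw}(G\setminus X)\le\eta$ we have $\mathbf{tw}(G)\le\eta+\beta|X|^{1/2}$.
   Context: A map $\mathcal{M}$ is a pair $(\mathscr{E},\omega)$ where $\mathscr{E}$ is a plane graph (a planar graph drawn in $\mathbb{R}^2$ without crossings) each of whose connected components is biconnected, and $\omega$ maps each face of $\mathscr{E}$ to $0$ or $1$ such that whenever $\omega(f)=1$, $f$ is a closed face (its boundary forms a cycle). Faces with $\omega(f)=1$ are nations, the others lakes. The graph associated with $\mathcal{M}$ has the nations as vertices, two nations adjacent iff they share at least one vertex of $\mathscr{E}$; a map graph is any graph associated with some map. A graph is $K_t$-free if it has no complete graph on $t$ vertices as an induced subgraph. $\mathbf{tw}$ denotes treewidth; $G\setminus X$ is the subgraph induced by $V(G)\setminus X$. A graph class $\mathcal{G}$ has truly sublinear treewidth with parameter $\lambda\in(0,1)$ if for every $\eta>0$ there is $\beta>0$ such that for all $G\in\mathcal{G}$ and $X\subseteq V(G)$, $\mathbf{tw}(G\setminus X)\le\eta$ implies $\mathbf{tw}(G)\le\eta+\beta|X|^\lambda$. *)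

theory Defs
  imports "HOL-Analysis.Analysis" "Graph_Theory.Graph_Theory"
begin

text \<open>
  Finite simple undirected graphs are the symmetric digraphs satisfying the locale predicate
  \<^const>\<open>graph\<close>.  In such a digraph every edge \<open>uv\<close> gives a directed cycle \<open>u, v, u\<close>, so the
  constants \<^const>\<open>forest\<close> and \<^const>\<open>tree\<close> do not describe undirected forests and trees; the cycles
  of the undirected graph are the directed cycles of length at least 3.
\<close>

definition undirected_cycle :: "('a, 'b) pre_digraph \<Rightarrow> 'b list \<Rightarrow> bool" where
  "undirected_cycle G p \<longleftrightarrow> pre_digraph.cycle G p \<and> length p \<ge> 3"

definition undirected_tree :: "('a, 'b) pre_digraph \<Rightarrow> bool" where
  "undirected_tree T \<longleftrightarrow>
     graph T \<and> Digraph_Component.connected T \<and> \<not> (\<exists>p. undirected_cycle T p)"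

definition remove_verts :: "('a, 'b) pre_digraph \<Rightarrow> 'a set \<Rightarrow> ('a, 'b) pre_digraph" where
  "remove_verts G X = G \<restriction> (verts G - X)"

definition connected_component_of_graph ::
    "('a, 'b) pre_digraph \<Rightarrow> ('a, 'b) pre_digraph \<Rightarrow> bool" where
  "connected_component_of_graph G H \<longleftrightarrow>
     pre_digraph.max_subgraph G Digraph_Component.connected H"

text \<open>
  Connected and without cut vertex.  The exception for \<open>verts G = {v}\<close> is needed because
  \<^const>\<open>Digraph_Component.connected\<close> is false for the null graph.
\<close>

definition biconnected :: "('a, 'b) pre_digraph \<Rightarrow> bool" where
  "biconnected G \<longleftrightarrow> Digraph_Component.connected G \<and>
     (\<forall>v \<in> verts G. verts G \<noteq> {v} \<longrightarrow> Digraph_Component.connected (remove_verts G {v}))"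

definition complete_free :: "nat \<Rightarrow> ('a, 'b) pre_digraph \<Rightarrow> bool" where
  "complete_free t G \<longleftrightarrow> \<not> (\<exists>H. induced_subgraph H G \<and> complete_digraph t H)"


section \<open>Treewidth\<close>

definition tree_decomposition ::
    "('a, 'b) pre_digraph \<Rightarrow> ('c, 'd) pre_digraph \<Rightarrow> ('c \<Rightarrow> 'a set) \<Rightarrow> bool" where
  "tree_decomposition G T B \<longleftrightarrow>
     undirected_tree T \<and>
     (\<Union>x \<in> verts T. B x) = verts G \<and>
     (\<forall>(u, v) \<in> arcs_ends G. \<exists>x \<in> verts T. u \<in> B x \<and> v \<in> B x) \<and>
     (\<forall>v \<in> verts G. Digraph_Component.connected (T \<restriction> {x \<in> verts T. v \<in> B x}))"

definition decomposition_width :: "('c, 'd) pre_digraph \<Rightarrow> ('c \<Rightarrow> 'a set) \<Rightarrow> int" where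
  "decomposition_width T B = int (Max ((\<lambda>x. card (B x)) ` verts T)) - 1"

text \<open>
  Trees are finite, so natural numbers suffice as their nodes.  The null graph has treewidth \<open>-1\<close>.
\<close>

definition treewidth :: "('a, 'b) pre_digraph \<Rightarrow> int" where
  "treewidth G = Inf {decomposition_width T B | (T :: (nat, nat \<times> nat) pre_digraph) B.
     tree_decomposition G T B}"

definition truly_sublinear_treewidth :: "('a, 'b) pre_digraph set \<Rightarrow> real \<Rightarrow> bool" where
  "truly_sublinear_treewidth \<G> l \<longleftrightarrow> 0 < l \<and> l < 1 \<and>
     (\<forall>\<eta>::real. \<eta> > 0 \<longrightarrow> (\<exists>\<beta>::real. \<beta> > 0 \<and>
        (\<forall>G \<in> \<G>. \<forall>X \<subseteq> verts G.
           real_of_int (treewidth (remove_verts G X)) \<le> \<eta> \<longrightarrow>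
           real_of_int (treewidth G) \<le> \<eta> + \<beta> * real (card X) powr l)))"


section \<open>Plane graphs\<close>

text \<open>
  The plane is \<^typ>\<open>complex\<close>.  A plane graph consists of a finite set \<open>V\<close> of points and a set \<open>E\<close> of
  arcs (as point sets) joining two distinct points of \<open>V\<close>.  An arc contains no further point of \<open>V\<close>,
  so \<open>e \<inter> V\<close> is the set of its end points; two arcs meet at most in common end points, and no two
  arcs have the same end points.
\<close>

definition plane_graph :: "complex set \<Rightarrow> complex set set \<Rightarrow> bool" where
  "plane_graph V E \<longleftrightarrow> finite V \<and>
     (\<forall>e \<in> E. \<exists>\<gamma>. Path_Connected.arc \<gamma> \<and> path_image \<gamma> = e \<and> e \<inter> V = {pathstart \<gamma>, pathfinish \<gamma>}) \<and>
     (\<forall>e \<in> E. \<forall>e' \<in> E. e \<noteq> e' \<longrightarrow> e \<inter> e' \<subseteq> V \<and> e \<inter> V \<noteq> e' \<inter> V)"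

definition plane_skeleton ::
    "complex set \<Rightarrow> complex set set \<Rightarrow> (complex, complex \<times> complex) pre_digraph" where
  "plane_skeleton V E =
     with_proj \<lparr>pverts = V, parcs = {(u, v). u \<noteq> v \<and> (\<exists>e \<in> E. e \<inter> V = {u, v})}\<rparr>"

definition faces :: "complex set \<Rightarrow> complex set set \<Rightarrow> complex set set" where
  "faces V E = components (- (V \<union> \<Union>E))"

definition closed_face :: "complex set \<Rightarrow> complex set set \<Rightarrow> complex set \<Rightarrow> bool" where
  "closed_face V E f \<longleftrightarrow> f \<in> faces V E \<and>
     (\<exists>p. undirected_cycle (plane_skeleton V E) p \<and>
          frontier f = \<Union>{e \<in> E. \<exists>(u, v) \<in> set p. e \<inter> V = {u, v}})"


section \<open>Map graphs\<close>

definition is_map :: "complex set \<Rightarrow> complex set set \<Rightarrow> (complex set \<Rightarrow> nat) \<Rightarrow> bool" where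
  "is_map V E \<omega> \<longleftrightarrow> plane_graph V E \<and>
     (\<forall>H. connected_component_of_graph (plane_skeleton V E) H \<longrightarrow> biconnected H) \<and>
     (\<forall>f \<in> faces V E. \<omega> f \<in> {0, 1} \<and> (\<omega> f = 1 \<longrightarrow> closed_face V E f))"

definition nations :: "complex set \<Rightarrow> complex set set \<Rightarrow> (complex set \<Rightarrow> nat) \<Rightarrow> complex set set" where
  "nations V E \<omega> = {f \<in> faces V E. \<omega> f = 1}"

definition graph_of_map :: "complex set \<Rightarrow> complex set set \<Rightarrow> (complex set \<Rightarrow> nat) \<Rightarrow>
    (complex set, complex set \<times> complex set) pre_digraph" where
  "graph_of_map V E \<omega> = with_proj
     \<lparr>pverts = nations V E \<omega>,
      parcs = {(f, g). f \<in> nations V E \<omega> \<and> g \<in> nations V E \<omega> \<and> f \<noteq> g \<and>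
                       (\<exists>v \<in> V. v \<in> frontier f \<and> v \<in> frontier g)}\<rparr>"

definition map_graph :: "('a, 'b) pre_digraph \<Rightarrow> bool" where
  "map_graph G \<longleftrightarrow> (\<exists>V E \<omega>. is_map V E \<omega> \<and> digraph_iso (graph_of_map V E \<omega>) G)"

definition complete_free_map_graphs :: "nat \<Rightarrow> ('a, 'b) pre_digraph set" where
  "complete_free_map_graphs t = {G. map_graph G \<and> complete_free t G}"

end

theory Submission
  imports Defs
begin

text \<open>
  Let \<open>R\<close> be the bipartite incidence graph between the nations and the vertices of the map. Nations at a
  common vertex form a clique, so in the \<open>K\<^sub>t\<close>-free case every vertex has degree less than \<open>t\<close> in
  \<open>R\<close>, and decompositions of \<open>G\<close> and \<open>R\<close> can be turned into each other at the cost of a factor \<open>t\<close>.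
  Since \<open>R\<close> is drawn in the plane it has no \<open>K\<^sub>6\<close> minor: a \<open>K\<^sub>3\<^sub>,\<^sub>3\<close> would contradict the Jordan curve
  theorem and Janiszewski's theorem.

  The bound holds for every graph without a \<open>K\<^sub>h\<close> minor. Such graphs have linearly many edges, so there are
  only \<open>O(|X|)\<close> disjoint connected sets with \<open>h\<close> neighbours in \<open>X\<close>. As the treewidth outside \<open>X\<close> is bounded, a set
  \<open>Y\<close> of \<open>O(|X|)\<close> vertices can be chosen such that every component of the rest has boundedly many neighbours
  in \<open>X \<union> Y\<close>. Contracting those components gives a minor with \<open>O(|X|)\<close> vertices, whose treewidth is
  \<open>O(|X|\<^sup>1\<^sup>/\<^sup>2)\<close> by the separator theorem of Alon, Seymour and Thomas, and the components can be added back
  to a decomposition of this minor.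
\<close>

section \<open>Connected vertex sets\<close>

text \<open>The map graph itself cannot be treated as a minor-free graph: the unit squares of a
  large grid form a \<open>K\<^sub>5\<close>-free map graph, the grid with both diagonals in each
  cell, and its clique minors are unbounded. Only the incidence graph excludes a fixed minor, so the
  deletion argument runs there, with the deleted nations as \<open>X\<close>. The obstacle is that a
  component left after deleting X may have many neighbours in X. Bounded treewidth gives an
  Erdos-Posa property for connected sets with at least h such neighbours: they are hit by at most 2w
  vertices per packed set, and edge density bounds the packing. Contracting all remaining components
  could still give too many vertices; only those are contracted that can be charged to a pair of
  neighbours of their own, and the neighbours of the others then have all their pairs covered
  already. The additive term must be exactly \<eta>. For nonempty X the root of |X| is at least 1,
  so all constants, also those depending on \<eta>, go into \<beta>; only empty X requires \<eta>
  itself, and there nothing is deleted.\<close>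

definition touch :: "('v \<Rightarrow> 'v \<Rightarrow> bool) \<Rightarrow> 'v set \<Rightarrow> 'v set \<Rightarrow> bool" where
  "touch E A B \<longleftrightarrow> (\<exists>x\<in>A. \<exists>y\<in>B. E x y)"

text \<open>Cuts instead of walks: unions, contractions and leaf removal then only ask for one
  crossing edge. As the edge relation is never restricted, an induced subgraph is just its vertex
  set.\<close>

definition conn :: "('v \<Rightarrow> 'v \<Rightarrow> bool) \<Rightarrow> 'v set \<Rightarrow> bool" where
  "conn E S \<longleftrightarrow> S \<noteq> {} \<and> (\<forall>P. P \<subseteq> S \<and> P \<noteq> {} \<and> P \<noteq> S \<longrightarrow> touch E P (S - P))"

definition component :: "('v \<Rightarrow> 'v \<Rightarrow> bool) \<Rightarrow> 'v set \<Rightarrow> 'v set \<Rightarrow> bool" where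
  "component E A C \<longleftrightarrow> C \<subseteq> A \<and> conn E C \<and> \<not> touch E C (A - C)"

definition clique_minor :: "('v \<Rightarrow> 'v \<Rightarrow> bool) \<Rightarrow> 'v set \<Rightarrow> nat \<Rightarrow> bool" where
  "clique_minor E V h \<longleftrightarrow> (\<exists>\<M>. finite \<M> \<and> card \<M> = h \<and> (\<forall>M\<in>\<M>. M \<subseteq> V \<and> conn E M) \<and>
     (\<forall>M\<in>\<M>. \<forall>N\<in>\<M>. M \<noteq> N \<longrightarrow> M \<inter> N = {} \<and> touch E M N))"

lemma touch_sym: "symp E \<Longrightarrow> touch E A B \<Longrightarrow> touch E B A"
  unfolding touch_def by (meson sympE)

lemma touch_mono: "touch E A B \<Longrightarrow> A \<subseteq> A' \<Longrightarrow> B \<subseteq> B' \<Longrightarrow> touch E A' B'"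
  unfolding touch_def by blast

lemma conn_nonempty: "conn E S \<Longrightarrow> S \<noteq> {}"
  unfolding conn_def by blast

lemma connD: "conn E S \<Longrightarrow> x \<in> S \<Longrightarrow> x \<in> P \<Longrightarrow> \<not> S \<subseteq> P \<Longrightarrow> \<exists>a\<in>S \<inter> P. \<exists>b\<in>S - P. E a b"
proof -
  assume a: "conn E S" "x \<in> S" "x \<in> P" "\<not> S \<subseteq> P"
  then have "touch E (S \<inter> P) (S - (S \<inter> P))"
    unfolding conn_def by (metis (no_types, lifting) Int_iff empty_iff inf.absorb_iff1 inf.cobounded1)
  then show ?thesis unfolding touch_def by blast
qed

lemma conn_singleton: "conn E {x}"
  unfolding conn_def by blast

lemma connI:
  assumes "x \<in> S" "\<And>P y. x \<in> P \<Longrightarrow> P \<subseteq> S \<Longrightarrow> y \<in> S - P \<Longrightarrow> touch E P (S - P)" "symp E"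
  shows "conn E S"
  unfolding conn_def
proof (intro conjI allI impI)
  show "S \<noteq> {}" using assms(1) by blast
  fix P assume P: "P \<subseteq> S \<and> P \<noteq> {} \<and> P \<noteq> S"
  show "touch E P (S - P)"
  proof (cases "x \<in> P")
    case True
    then show ?thesis using P assms(2) by blast
  next
    case False
    then have "touch E (S - P) (S - (S - P))" using P assms(1,2) by blast
    moreover have "S - (S - P) = P" using P by blast
    ultimately show ?thesis using touch_sym[OF assms(3)] by metis
  qed
qed

lemma conn_Un:
  assumes "symp E" "conn E A" "conn E B" "A \<inter> B \<noteq> {} \<or> touch E A B"
  shows "conn E (A \<union> B)"
proof -
  obtain x where x: "x \<in> A" using assms(2) conn_nonempty by blast
  have ab: "\<exists>b\<in>B. b \<in> A \<or> (\<exists>a\<in>A. E a b)" using assms(4) unfolding touch_def by blast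
  show ?thesis
  proof (rule connI)
    show "x \<in> A \<union> B" using x by blast
    fix P y assume P: "x \<in> P" "P \<subseteq> A \<union> B" "y \<in> (A \<union> B) - P"
    show "touch E P (A \<union> B - P)"
    proof (cases "A \<subseteq> P")
      case False
      then show ?thesis using connD[OF assms(2) x P(1)] unfolding touch_def by blast
    next
      case True
      obtain b where b: "b \<in> B" "b \<in> A \<or> (\<exists>a\<in>A. E a b)" using ab by blast
      show ?thesis
      proof (cases "b \<in> P")
        case True
        have "\<not> B \<subseteq> P" using P(3) \<open>A \<subseteq> P\<close> by blast
        then show ?thesis using connD[OF assms(3) b(1) True] unfolding touch_def by blast
      next
        case False
        then show ?thesis using b True unfolding touch_def by blast
      qed
    qed
  qed (rule assms(1))
qed

lemma conn_insert: "symp E \<Longrightarrow> conn E A \<Longrightarrow> a \<in> A \<Longrightarrow> E a b \<Longrightarrow> conn E (insert b A)"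
  using conn_Un[of E A "{b}"] conn_singleton[of E b] unfolding touch_def by auto

text \<open>A largest good set containing \<open>x\<close> has no edge of \<open>S\<close> leaving
  it, so it is \<open>S\<close>. This replaces induction along walks or spanning trees.\<close>

lemma conn_induct [consumes 3, case_names base step]:
  assumes "conn E S" "finite S" "x \<in> S" "P {x}"
    "\<And>T y z. x \<in> T \<Longrightarrow> T \<subseteq> S \<Longrightarrow> P T \<Longrightarrow> y \<in> T \<Longrightarrow> z \<in> S - T \<Longrightarrow> E y z \<Longrightarrow> P (insert z T)"
  shows "P S"
proof -
  let ?Q = "\<lambda>T. x \<in> T \<and> T \<subseteq> S \<and> P T"
  have "\<exists>T. ?Q T \<and> (\<forall>T'. ?Q T' \<longrightarrow> card T' \<le> card T)"
  proof (rule ex_has_greatest_nat[of ?Q "{x}"])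
    show "?Q {x}" using assms(3,4) by blast
    show "\<forall>T. ?Q T \<longrightarrow> card T < Suc (card S)" using assms(2) by (auto simp: less_Suc_eq_le intro: card_mono)
  qed
  then obtain T where T: "?Q T" "\<And>T'. ?Q T' \<Longrightarrow> card T' \<le> card T" by blast
  have "S \<subseteq> T"
  proof (rule ccontr)
    assume "\<not> S \<subseteq> T"
    then obtain a b where ab: "a \<in> S \<inter> T" "b \<in> S - T" "E a b"
      using connD[OF assms(1,3)] T(1) by meson
    then have "?Q (insert b T)" using assms(5)[of T a b] T(1) by blast
    then have "card (insert b T) \<le> card T" by (rule T(2))
    then show False using ab assms(2) T(1) by (auto simp: finite_subset card_insert_if)
  qed
  then have "T = S" using T(1) by (simp add: subset_antisym)
  then show ?thesis using T(1) by simp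
qed

lemma conn_UN:
  assumes E: "symp E" and M: "conn F M" and bl: "\<And>x. x \<in> M \<Longrightarrow> conn E (bl x)"
    and t: "\<And>x y. x \<in> M \<Longrightarrow> y \<in> M \<Longrightarrow> F x y \<Longrightarrow> touch E (bl x) (bl y)"
  shows "conn E (\<Union>x\<in>M. bl x)"
proof -
  obtain x0 where x0: "x0 \<in> M" using M conn_nonempty by blast
  obtain z where z: "z \<in> bl x0" using bl[OF x0] conn_nonempty by blast
  show ?thesis
  proof (rule connI)
    show "z \<in> (\<Union>x\<in>M. bl x)" using x0 z by blast
    fix P y assume P: "z \<in> P" "P \<subseteq> (\<Union>x\<in>M. bl x)" "y \<in> (\<Union>x\<in>M. bl x) - P"
    show "touch E P ((\<Union>x\<in>M. bl x) - P)"
    proof (cases "\<exists>x\<in>M. bl x \<inter> P \<noteq> {} \<and> \<not> bl x \<subseteq> P")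
      case True
      then obtain x u where x: "x \<in> M" "u \<in> bl x" "u \<in> P" "\<not> bl x \<subseteq> P" by blast
      then show ?thesis using connD[OF bl[OF x(1)] x(2,3,4)] unfolding touch_def by blast
    next
      case False
      let ?Q = "{x\<in>M. bl x \<subseteq> P}"
      have "x0 \<in> ?Q" using False x0 z P(1) by blast
      moreover have "\<not> M \<subseteq> ?Q" using P(3) by blast
      ultimately obtain a b where ab: "a \<in> M \<inter> ?Q" "b \<in> M - ?Q" "F a b"
        using connD[OF M x0, of ?Q] by blast
      have "touch E (bl a) (bl b)" using t ab by blast
      moreover have "bl b \<inter> P = {}" using ab(2) False by blast
      ultimately show ?thesis using ab unfolding touch_def by blast
    qed
  qed (rule E)
qed

lemma component_exists:
  assumes "symp E" "finite A" "conn E K" "K \<subseteq> A"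
  obtains C where "component E A C" "K \<subseteq> C"
proof -
  let ?Q = "\<lambda>C. K \<subseteq> C \<and> C \<subseteq> A \<and> conn E C"
  have "\<exists>C. ?Q C \<and> (\<forall>T. ?Q T \<longrightarrow> card T \<le> card C)"
  proof (rule ex_has_greatest_nat[of ?Q K])
    show "?Q K" using assms by blast
    show "\<forall>T. ?Q T \<longrightarrow> card T < Suc (card A)" using assms(2) by (auto simp: less_Suc_eq_le intro: card_mono)
  qed
  then obtain C where C: "?Q C" "\<And>T. ?Q T \<Longrightarrow> card T \<le> card C" by blast
  have "\<not> touch E C (A - C)"
  proof
    assume "touch E C (A - C)"
    then obtain a b where ab: "a \<in> C" "b \<in> A - C" "E a b" unfolding touch_def by blast
    then have "?Q (insert b C)" using conn_insert[OF assms(1)] C(1) by blast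
    then have "card (insert b C) \<le> card C" by (rule C(2))
    then show False using ab assms(2) C(1) by (auto simp: finite_subset card_insert_if)
  qed
  then show ?thesis using that C(1) unfolding component_def by blast
qed

lemma component_absorb:
  assumes "component E A C" "conn E K" "K \<subseteq> A" "K \<inter> C \<noteq> {}"
  shows "K \<subseteq> C"
proof (rule ccontr)
  assume n: "\<not> K \<subseteq> C"
  obtain x where "x \<in> K" "x \<in> C" using assms(4) by blast
  then have "\<exists>a\<in>K \<inter> C. \<exists>b\<in>K - C. E a b" using connD[OF assms(2)] n by blast
  then show False using assms(1,3) unfolding component_def touch_def by blast
qed

lemma component_conn: "component E A C \<Longrightarrow> conn E C"
  unfolding component_def by blast

lemma component_sub: "component E A C \<Longrightarrow> C \<subseteq> A"
  unfolding component_def by blast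

lemma component_eq:
  "component E A C \<Longrightarrow> component E A D \<Longrightarrow> C \<inter> D \<noteq> {} \<Longrightarrow> C = D"
  using component_absorb[of E A C D] component_absorb[of E A D C] component_conn[of E A] component_sub[of E A]
  by (metis inf_commute subset_antisym)

lemma component_of_point:
  assumes "symp E" "finite A" "x \<in> A"
  obtains C where "component E A C" "x \<in> C"
  using component_exists[OF assms(1,2) conn_singleton, of x] assms(3) by blast

lemma conn_mono_rel:
  "conn E S \<Longrightarrow> (\<And>x y. x \<in> S \<Longrightarrow> y \<in> S \<Longrightarrow> E x y \<Longrightarrow> F x y) \<Longrightarrow> conn F S"
  unfolding conn_def touch_def by (meson DiffE in_mono)

section \<open>Clique minors\<close>

lemma clique_minorE:
  assumes "clique_minor E V h"
  obtains \<M> where "finite \<M>" "card \<M> = h" "\<And>M. M \<in> \<M> \<Longrightarrow> M \<subseteq> V \<and> conn E M"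
    "\<And>M N. M \<in> \<M> \<Longrightarrow> N \<in> \<M> \<Longrightarrow> M \<noteq> N \<Longrightarrow> M \<inter> N = {} \<and> touch E M N"
proof -
  obtain \<M> where M: "finite \<M> \<and> card \<M> = h \<and> (\<forall>M\<in>\<M>. M \<subseteq> V \<and> conn E M) \<and>
     (\<forall>M\<in>\<M>. \<forall>N\<in>\<M>. M \<noteq> N \<longrightarrow> M \<inter> N = {} \<and> touch E M N)"
    using assms unfolding clique_minor_def by (rule exE)
  show ?thesis by (rule that[of \<M>]) (use M in simp_all)
qed

lemma clique_minorI:
  assumes "finite \<M>" "card \<M> = h" "\<And>M. M \<in> \<M> \<Longrightarrow> M \<subseteq> V \<and> conn E M"
    "\<And>M N. M \<in> \<M> \<Longrightarrow> N \<in> \<M> \<Longrightarrow> M \<noteq> N \<Longrightarrow> M \<inter> N = {} \<and> touch E M N"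
  shows "clique_minor E V h"
  unfolding clique_minor_def by (rule exI[of _ \<M>]) (use assms in simp)

text \<open>Minors compose: \<open>bl\<close> models \<open>F\<close> as a minor of
  \<open>E\<close>, and uniting \<open>bl x\<close> over a branch set for \<open>F\<close> gives a
  branch set for \<open>E\<close>. It serves the contraction of an edge, of assigned sets and of
  components.\<close>

lemma clique_minor_lift:
  assumes "clique_minor F U h" "symp E"
    and bl: "\<And>x. x \<in> U \<Longrightarrow> conn E (bl x) \<and> bl x \<subseteq> V"
    and dis: "\<And>x y. x \<in> U \<Longrightarrow> y \<in> U \<Longrightarrow> x \<noteq> y \<Longrightarrow> bl x \<inter> bl y = {}"
    and t: "\<And>x y. x \<in> U \<Longrightarrow> y \<in> U \<Longrightarrow> x \<noteq> y \<Longrightarrow> F x y \<Longrightarrow> touch E (bl x) (bl y)"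
  shows "clique_minor E V h"
proof -
  obtain \<M> where M: "finite \<M>" "card \<M> = h" "\<And>M. M \<in> \<M> \<Longrightarrow> M \<subseteq> U \<and> conn F M"
    "\<And>M N. M \<in> \<M> \<Longrightarrow> N \<in> \<M> \<Longrightarrow> M \<noteq> N \<Longrightarrow> M \<inter> N = {} \<and> touch F M N"
    using clique_minorE[OF assms(1)] by metis
  let ?g = "\<lambda>M. \<Union>x\<in>M. bl x"
  have c: "conn E (?g M)" if "M \<in> \<M>" for M
  \<comment> \<open>Loops of \<open>F\<close> are removed, because touching is assumed for distinct
    vertices only; connectedness never uses them.\<close>
  proof (rule conn_UN[of E "\<lambda>x y. F x y \<and> x \<noteq> y"])
    show "conn (\<lambda>x y. F x y \<and> x \<noteq> y) M"
      using conjunct2[OF M(3)[OF that]] unfolding conn_def touch_def by blast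
    have sub: "M \<subseteq> U" using M(3)[OF that] by simp
    show "symp E" by (rule assms(2))
    show "conn E (bl x)" if "x \<in> M" for x using bl sub that by (simp add: subsetD)
    show "touch E (bl x) (bl y)" if "x \<in> M" "y \<in> M" "F x y \<and> x \<noteq> y" for x y
      using t sub that by (simp add: subsetD)
  qed
  have d: "?g M \<inter> ?g N = {} \<and> touch E (?g M) (?g N)" if MN: "M \<in> \<M>" "N \<in> \<M>" "M \<noteq> N" for M N
  proof
    have sub: "M \<subseteq> U" "N \<subseteq> U" using M(3) that by simp_all
    have disj: "M \<inter> N = {}" using M(4)[OF that] by simp
    have "bl x \<inter> bl y = {}" if "x \<in> M" "y \<in> N" for x y
      using dis[of x y] that sub disj by (metis disjoint_iff subsetD)
    then show "?g M \<inter> ?g N = {}" by blast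
    obtain x y where xy: "x \<in> M" "y \<in> N" "F x y" using M(4)[OF MN] unfolding touch_def by blast
    moreover have "x \<noteq> y" using disj xy by blast
    ultimately have "touch E (bl x) (bl y)" using t[of x y] sub by (simp add: subsetD)
    then show "touch E (?g M) (?g N)" using xy unfolding touch_def by blast
  qed
  have inj: "inj_on ?g \<M>"
    by (rule inj_onI) (metis c d conn_nonempty inf.idem)
  show ?thesis
  proof (rule clique_minorI)
    show "finite (?g ` \<M>)" using M(1) by blast
    show "card (?g ` \<M>) = h" using card_image[OF inj] M(2) by simp
    show "K \<subseteq> V \<and> conn E K" if K: "K \<in> ?g ` \<M>" for K
    proof -
      obtain M where m: "M \<in> \<M>" "K = ?g M" using K by blast
      have "M \<subseteq> U" using M(3)[OF m(1)] by simp
      then show ?thesis using c[OF m(1)] bl m(2) by (auto dest: subsetD)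
    qed
    show "K \<inter> L = {} \<and> touch E K L" if K: "K \<in> ?g ` \<M>" "L \<in> ?g ` \<M>" "K \<noteq> L" for K L
    proof -
      obtain M N where m: "M \<in> \<M>" "K = ?g M" "N \<in> \<M>" "L = ?g N" using K(1,2) by blast
      then have "M \<noteq> N" using K(3) by blast
      then show ?thesis using d[OF m(1,3)] m by simp
    qed
  qed
qed

lemma clique_minor_mono: "clique_minor E U h \<Longrightarrow> U \<subseteq> V \<Longrightarrow> clique_minor E V h"
  by (erule clique_minorE, rule clique_minorI, assumption, assumption, blast, metis)

lemma clique_minor_clique:
  assumes "finite K" "card K \<ge> h" "K \<subseteq> V" "\<And>x y. x \<in> K \<Longrightarrow> y \<in> K \<Longrightarrow> x \<noteq> y \<Longrightarrow> E x y"
  shows "clique_minor E V h"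
proof -
  obtain L where L: "L \<subseteq> K" "card L = h" "finite L"
    using obtain_subset_with_card_n[OF assms(2)] by auto
  show ?thesis
  proof (rule clique_minorI)
    show "finite ((\<lambda>x. {x}) ` L)" using L by blast
    show "card ((\<lambda>x. {x}) ` L) = h" using L by (simp add: card_image)
    show "M \<subseteq> V \<and> conn E M" if "M \<in> (\<lambda>x. {x}) ` L" for M
      using that L(1) assms(3) by (auto simp: conn_singleton)
    show "M \<inter> N = {} \<and> touch E M N" if "M \<in> (\<lambda>x. {x}) ` L" "N \<in> (\<lambda>x. {x}) ` L" "M \<noteq> N" for M N
      using that assms(4) subsetD[OF L(1)] by (auto simp: touch_def)
  qed
qed

lemma clique_minor_insert:
  assumes "clique_minor E N h" "v \<in> V" "v \<notin> N" "N \<subseteq> V" "\<And>x. x \<in> N \<Longrightarrow> E v x \<and> E x v"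
  shows "clique_minor E V (Suc h)"
proof -
  obtain \<M> where M: "finite \<M>" "card \<M> = h" "\<And>M. M\<in>\<M> \<Longrightarrow> M \<subseteq> N \<and> conn E M"
     "\<And>M K. M\<in>\<M> \<Longrightarrow> K\<in>\<M> \<Longrightarrow> M \<noteq> K \<Longrightarrow> M \<inter> K = {} \<and> touch E M K"
    using clique_minorE[OF assms(1)] by metis
  have nv: "M \<in> \<M> \<Longrightarrow> v \<notin> M" for M using M(3) assms(3) by blast
  have t: "M \<in> \<M> \<Longrightarrow> touch E M {v} \<and> touch E {v} M" for M
    using M(3)[of M] assms(5) conn_nonempty[of E M] unfolding touch_def by blast
  show ?thesis
  proof (rule clique_minorI)
    show "finite (insert {v} \<M>)" using M by blast
    show "card (insert {v} \<M>) = Suc h" using M nv by (metis card_insert_disjoint insertI1)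
    show "M \<subseteq> V \<and> conn E M" if "M \<in> insert {v} \<M>" for M
      using that M(3)[of M] assms(2,4) by (auto simp: conn_singleton)
    show "M \<inter> K = {} \<and> touch E M K" if "M \<in> insert {v} \<M>" "K \<in> insert {v} \<M>" "M \<noteq> K" for M K
      using that M(4)[of M K] nv t by auto
  qed
qed

section \<open>Edge density forces clique minors\<close>

definition edge_pairs :: "('v \<Rightarrow> 'v \<Rightarrow> bool) \<Rightarrow> 'v set \<Rightarrow> ('v \<times> 'v) set" where
  "edge_pairs E V = {(x, y). x \<in> V \<and> y \<in> V \<and> x \<noteq> y \<and> E x y}"

lemma finite_edge_pairs: "finite V \<Longrightarrow> finite (edge_pairs E V)"
  by (rule finite_subset[of _ "V \<times> V"]) (auto simp: edge_pairs_def)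

text \<open>\<open>F\<close> is \<open>E\<close> with \<open>v\<close> contracted into
  \<open>u\<close>. In ordered pairs the edge \<open>uv\<close> costs 2 and each common neighbour
  another 2, as its two edges merge; the other neighbours \<open>?W\<close> of \<open>v\<close> move
  to \<open>u\<close> without loss.\<close>

lemma contract_edge_pairs:
  assumes "finite V" "symp E" "u \<in> V" "v \<in> V" "u \<noteq> v" "E u v"
    and F: "F = (\<lambda>x y. E x y \<or> (x = u \<and> E v y) \<or> (y = u \<and> E v x))"
  shows "card (edge_pairs E V) \<le> card (edge_pairs F (V - {v})) + 2 + 2 * card {x\<in>V. x \<noteq> u \<and> x \<noteq> v \<and> E u x \<and> E v x}"
proof -
  let ?C = "{x\<in>V. x \<noteq> u \<and> x \<noteq> v \<and> E u x \<and> E v x}"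
  let ?N = "{x\<in>V. x \<noteq> u \<and> x \<noteq> v \<and> E v x}"
  let ?W = "?N - ?C"
  let ?P = "edge_pairs E (V - {v})"
  have sE: "E x y \<longleftrightarrow> E y x" for x y using assms(2) by (meson sympE)
  have fin: "finite ?N" "finite ?C" "finite ?W" using assms(1) by auto
  have "edge_pairs E V \<subseteq> ?P \<union> {(u,v),(v,u)} \<union> {v} \<times> ?N \<union> ?N \<times> {v}"
    unfolding edge_pairs_def using sE by auto
  then have "card (edge_pairs E V) \<le> card (?P \<union> {(u,v),(v,u)} \<union> {v} \<times> ?N \<union> ?N \<times> {v})"
    using fin finite_edge_pairs[of "V - {v}" E] assms(1) by (intro card_mono) auto
  also have "\<dots> \<le> card ?P + 2 + card ?N + card ?N"
    using card_Un_le[of "?P \<union> {(u,v),(v,u)} \<union> {v} \<times> ?N" "?N \<times> {v}"]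
      card_Un_le[of "?P \<union> {(u,v),(v,u)}" "{v} \<times> ?N"] card_Un_le[of ?P "{(u,v),(v,u)}"] assms(5)
    by (simp add: card_cartesian_product)
  also have "card ?N = card ?W + card ?C"
    using card_Diff_subset[of ?C ?N] card_mono[of ?N ?C] fin by fastforce
  finally have 1: "card (edge_pairs E V) \<le> card ?P + 2 + 2 * card ?W + 2 * card ?C" by simp
  have "?P \<union> {u} \<times> ?W \<union> ?W \<times> {u} \<subseteq> edge_pairs F (V - {v})"
    unfolding edge_pairs_def F using assms by auto
  then have "card (?P \<union> {u} \<times> ?W \<union> ?W \<times> {u}) \<le> card (edge_pairs F (V - {v}))"
    using assms(1) by (intro card_mono finite_edge_pairs) auto
  moreover have "card (?P \<union> {u} \<times> ?W \<union> ?W \<times> {u}) = card ?P + card ?W + card ?W"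
  proof -
    have d: "?P \<inter> {u} \<times> ?W = {}" "(?P \<union> {u} \<times> ?W) \<inter> ?W \<times> {u} = {}"
      unfolding edge_pairs_def using sE by auto
    have f: "finite ?P" using finite_edge_pairs[of "V - {v}" E] assms(1) by auto
    have f2: "finite ({u} \<times> ?W)" "finite (?W \<times> {u})" using fin(3) by blast+
    have "card (?P \<union> {u} \<times> ?W \<union> ?W \<times> {u}) = card (?P \<union> {u} \<times> ?W) + card (?W \<times> {u})"
      using card_Un_disjoint[OF _ f2(2) d(2)] f f2 by blast
    also have "card (?P \<union> {u} \<times> ?W) = card ?P + card ({u} \<times> ?W)"
      using card_Un_disjoint[OF f f2(1) d(1)] .
    finally show ?thesis by (simp add: card_cartesian_product)
  qed
  ultimately show ?thesis using 1 by linarith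
qed

text \<open>Contracting an edge with fewer than \<open>2 ^ h\<close> common neighbours keeps the
  density. If there is no such edge, the neighbourhood of a non-isolated vertex \<open>v\<close>
  induces minimum degree at least \<open>2 ^ h\<close>, so it has a clique minor of order
  \<open>h\<close> by induction, and \<open>{v}\<close> is one more branch set. Pairs are ordered,
  so each edge counts twice.\<close>

lemma dense_clique_minor:
  assumes "finite V" "V \<noteq> {}" "symp E" "2 ^ h * card V \<le> card (edge_pairs E V)"
  shows "clique_minor E V h"
  using assms
proof (induction h arbitrary: V E)
  case 0
  show ?case unfolding clique_minor_def by (intro exI[of _ "{}"]) auto
next
  case (Suc h)
  note IHh = Suc.IH
  show ?case using Suc.prems
  proof (induction "card V" arbitrary: V E rule: less_induct)
    case less
    have sE: "E x y \<longleftrightarrow> E y x" for x y using less.prems(3) by (meson sympE)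
    have "card V > 0" using less.prems(1,2) by (simp add: card_gt_0_iff)
    then have "card (edge_pairs E V) > 0" using less.prems(4)
      by (metis mult_is_0 neq0_conv not_gr0 not_less power_not_zero zero_neq_numeral le_zero_eq)
    then obtain u v where uv: "u \<in> V" "v \<in> V" "u \<noteq> v" "E u v"
      unfolding edge_pairs_def by (auto simp: card_gt_0_iff)
    show ?case
    proof (cases "\<exists>u\<in>V. \<exists>v\<in>V. u \<noteq> v \<and> E u v \<and> card {x\<in>V. x \<noteq> u \<and> x \<noteq> v \<and> E u x \<and> E v x} < 2 ^ h")
      case True
      then obtain u v where uv: "u \<in> V" "v \<in> V" "u \<noteq> v" "E u v"
        "card {x\<in>V. x \<noteq> u \<and> x \<noteq> v \<and> E u x \<and> E v x} < 2 ^ h" by blast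
      define F where "F = (\<lambda>x y. E x y \<or> (x = u \<and> E v y) \<or> (y = u \<and> E v x))"
      \<comment> \<open>The loss is at most \<open>2 + 2 * (2 ^ h - 1) = 2 ^ Suc h\<close>, exactly
        what one vertex less allows.\<close>
      have "card (edge_pairs E V) \<le> card (edge_pairs F (V - {v})) + 2 ^ Suc h"
        using contract_edge_pairs[OF less.prems(1,3) uv(1-4) F_def] uv(5) by simp
      moreover have "card V = Suc (card (V - {v}))" using uv(2) less.prems(1)
        by (metis card.remove)
      ultimately have "2 ^ Suc h * card (V - {v}) \<le> card (edge_pairs F (V - {v}))"
        using less.prems(4) by simp
      moreover have "symp F" unfolding F_def by (rule sympI) (use sE in blast)
      moreover have "V - {v} \<noteq> {}" using uv by blast
      moreover have "card (V - {v}) < card V" using uv(2) less.prems(1) by (meson card_Diff1_less)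
      ultimately have "clique_minor F (V - {v}) (Suc h)"
        using less.hyps[of "V - {v}" F] less.prems(1) by blast
      then show ?thesis
      proof (rule clique_minor_lift[where bl = "\<lambda>x. if x = u then {u, v} else {x}"])
        have c: "conn E {u, v}" using conn_insert[OF less.prems(3) conn_singleton[of E u], of u v] uv(4)
          by (simp add: insert_commute)
        show "conn E (if x = u then {u, v} else {x}) \<and> (if x = u then {u, v} else {x}) \<subseteq> V"
          if "x \<in> V - {v}" for x using that c uv conn_singleton[of E x] by auto
      qed (use less.prems(3) uv sE in \<open>auto simp: F_def touch_def split: if_splits\<close>)
    next
      case False
      let ?N = "{x\<in>V. x \<noteq> v \<and> E v x}"
      have fN: "finite ?N" using less.prems(1) by auto
      have dg: "2 ^ h \<le> card {y\<in>?N. y \<noteq> x \<and> E x y}" if "x \<in> ?N" for x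
      proof -
        have "\<not> card {y\<in>V. y \<noteq> v \<and> y \<noteq> x \<and> E v y \<and> E x y} < 2 ^ h"
          using False[simplified, rule_format, OF uv(2), of x] that by auto
        then have "2 ^ h \<le> card {y\<in>V. y \<noteq> v \<and> y \<noteq> x \<and> E v y \<and> E x y}" by simp
        moreover have "{y\<in>V. y \<noteq> v \<and> y \<noteq> x \<and> E v y \<and> E x y} = {y\<in>?N. y \<noteq> x \<and> E x y}" by blast
        ultimately show ?thesis by simp
      qed
      have "edge_pairs E ?N = Sigma ?N (\<lambda>x. {y\<in>?N. y \<noteq> x \<and> E x y})"
        unfolding edge_pairs_def by auto
      then have "card (edge_pairs E ?N) = (\<Sum>x\<in>?N. card {y\<in>?N. y \<noteq> x \<and> E x y})"
        using fN less.prems(1) by (simp add: card_SigmaI)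
      also have "\<dots> \<ge> (\<Sum>x\<in>?N. 2 ^ h)" by (rule sum_mono) (rule dg)
      finally have "2 ^ h * card ?N \<le> card (edge_pairs E ?N)" by (simp add: mult.commute)
      moreover have "?N \<noteq> {}" using uv sE by blast
      ultimately have "clique_minor E ?N h" using IHh[OF fN _ less.prems(3)] by blast
      then show ?thesis
        by (rule clique_minor_insert[of E ?N h v]) (use uv sE in auto)
    qed
  qed
qed

section \<open>Charging disjoint connected sets to pairs of their neighbours\<close>

definition nbs :: "('v \<Rightarrow> 'v \<Rightarrow> bool) \<Rightarrow> 'v set \<Rightarrow> 'v set \<Rightarrow> 'v set" where
  "nbs E X C = {x\<in>X. \<exists>y\<in>C. E y x}"

text \<open>As many members as possible receive distinct pairs of their neighbours in
  \<open>X\<close>. Contracting each of them into the first vertex of its pair exhibits the pairs as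
  edges of a minor \<open>H\<close> on \<open>X\<close>, so \<open>H\<close> is sparse and few
  members are served. By maximality a member left out sees only pairs that are edges of
  \<open>H\<close>.\<close>

lemma assign_pairs:
  assumes "finite X" "finite \<C>" "symp E" "\<not> clique_minor E V h" "X \<subseteq> V"
    and C: "\<And>C. C \<in> \<C> \<Longrightarrow> conn E C \<and> C \<subseteq> V - X"
    and dis: "\<And>C D. C \<in> \<C> \<Longrightarrow> D \<in> \<C> \<Longrightarrow> C \<noteq> D \<Longrightarrow> C \<inter> D = {}"
  obtains \<A> H where "\<A> \<subseteq> \<C>" "card \<A> \<le> 2 ^ h * card X" "\<not> clique_minor H X h"
    "\<And>x y. H x y \<Longrightarrow> \<exists>A\<in>\<A>. x \<in> nbs E X A \<and> y \<in> nbs E X A"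
    "\<And>C x y. C \<in> \<C> - \<A> \<Longrightarrow> x \<in> nbs E X C \<Longrightarrow> y \<in> nbs E X C \<Longrightarrow> x \<noteq> y \<Longrightarrow> H x y"
proof -
  let ?Q = "\<lambda>\<A>. \<A> \<subseteq> \<C> \<and> (\<exists>\<sigma> \<tau>. inj_on (\<lambda>A. {\<sigma> A, \<tau> A}) \<A> \<and>
     (\<forall>A\<in>\<A>. \<sigma> A \<in> nbs E X A \<and> \<tau> A \<in> nbs E X A \<and> \<sigma> A \<noteq> \<tau> A))"
  have "\<exists>\<A>. ?Q \<A> \<and> (\<forall>\<B>. ?Q \<B> \<longrightarrow> card \<B> \<le> card \<A>)"
  proof (rule ex_has_greatest_nat[of ?Q "{}"])
    show "?Q {}" by auto
    show "\<forall>\<A>. ?Q \<A> \<longrightarrow> card \<A> < Suc (card \<C>)" using assms(2) by (auto simp: less_Suc_eq_le intro: card_mono)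
  qed
  then obtain \<A> where A: "?Q \<A>" "\<And>\<B>. ?Q \<B> \<Longrightarrow> card \<B> \<le> card \<A>" by blast
  then obtain \<sigma> \<tau> where st: "inj_on (\<lambda>A. {\<sigma> A, \<tau> A}) \<A>"
    "\<And>A. A\<in>\<A> \<Longrightarrow> \<sigma> A \<in> nbs E X A \<and> \<tau> A \<in> nbs E X A \<and> \<sigma> A \<noteq> \<tau> A" and sub: "\<A> \<subseteq> \<C>" by blast
  define H where "H = (\<lambda>x y. \<exists>A\<in>\<A>. {x, y} = {\<sigma> A, \<tau> A})"
  have fA: "finite \<A>" using sub assms(2) finite_subset by blast
  have sH: "symp H" unfolding H_def by (rule sympI) (auto simp: insert_commute)
  have sE: "E x y \<Longrightarrow> E y x" for x y using assms(3) by (meson sympE)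
  \<comment> \<open>\<open>x\<close> absorbs the members whose pair starts at \<open>x\<close>;
    through such an \<open>A\<close> it reaches the second vertex \<open>\<tau> A\<close>.\<close>
  let ?bl = "\<lambda>x. {x} \<union> (\<Union>A\<in>{A\<in>\<A>. \<sigma> A = x}. A)"
  have bc: "conn E (?bl x)" if "x \<in> X" for x
  proof (rule connI[of x])
    fix P y assume P: "x \<in> P" "P \<subseteq> ?bl x" "y \<in> ?bl x - P"
    then obtain A where a: "A \<in> \<A>" "\<sigma> A = x" "y \<in> A" by blast
    obtain z where z: "z \<in> A" "E z x" using st(2)[OF a(1)] a(2) unfolding nbs_def by blast
    show "touch E P (?bl x - P)"
    proof (cases "z \<in> P")
      case True
      have "conn E A" using C a(1) sub by blast
      then have "\<exists>u\<in>A \<inter> P. \<exists>w\<in>A - P. E u w" using connD[of E A z P] z True P(3) a(3) by blast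
      then show ?thesis using a unfolding touch_def by blast
    next
      case False
      then show ?thesis using P(1) z sE a unfolding touch_def by blast
    qed
  qed (use assms(3) in auto)
  have nH: "\<not> clique_minor H X h"
  proof
    assume "clique_minor H X h"
    then have "clique_minor E V h"
    proof (rule clique_minor_lift[where bl = ?bl])
      show "conn E (?bl x) \<and> ?bl x \<subseteq> V" if "x \<in> X" for x
        using bc[OF that] that assms(5) C sub by blast
      show "?bl x \<inter> ?bl y = {}" if xy: "x \<in> X" "y \<in> X" "x \<noteq> y" for x y
      proof -
        have "A \<inter> B = {}" if "A \<in> \<A>" "B \<in> \<A>" "\<sigma> A = x" "\<sigma> B = y" for A B
          using dis[of A B] that xy sub by blast
        moreover have "A \<inter> X = {}" if "A \<in> \<A>" for A using C sub that by blast
        ultimately show ?thesis using xy by blast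
      qed
      show "touch E (?bl x) (?bl y)" if xy: "x \<in> X" "y \<in> X" "H x y" for x y
      proof -
        obtain A where a: "A \<in> \<A>" "{x, y} = {\<sigma> A, \<tau> A}" using xy(3) unfolding H_def by blast
        then have nb: "\<exists>z\<in>A. E z x" "\<exists>z\<in>A. E z y" using st(2)[OF a(1)] unfolding nbs_def
          by (auto simp: doubleton_eq_iff)
        have "\<sigma> A = x \<or> \<sigma> A = y" using a(2) by (auto simp: doubleton_eq_iff)
        then show ?thesis
        proof
          assume "\<sigma> A = x" then show ?thesis using a(1) nb(2) unfolding touch_def by blast
        next
          assume "\<sigma> A = y" then show ?thesis using a(1) nb(1) sE unfolding touch_def by blast
        qed
      qed
    qed (use assms(3) in auto)
    then show False using assms(4) by blast
  qed
  have "(\<lambda>A. (\<sigma> A, \<tau> A)) ` \<A> \<subseteq> edge_pairs H X"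
    using st(2) unfolding edge_pairs_def H_def nbs_def by fastforce
  moreover have "inj_on (\<lambda>A. (\<sigma> A, \<tau> A)) \<A>" using st(1) by (auto simp: inj_on_def)
  ultimately have cA: "card \<A> \<le> card (edge_pairs H X)"
    by (metis card_image card_mono finite_edge_pairs assms(1))
  have "card (edge_pairs H X) \<le> 2 ^ h * card X"
  proof (cases "X = {}")
    case True
    then show ?thesis by (simp add: edge_pairs_def)
  next
    case False
    then show ?thesis using dense_clique_minor[OF assms(1) False sH, of h] nH by linarith
  qed
  then have 1: "card \<A> \<le> 2 ^ h * card X" using cA by simp
  have 2: "\<exists>A\<in>\<A>. x \<in> nbs E X A \<and> y \<in> nbs E X A" if "H x y" for x y
    using that st(2) unfolding H_def by (metis doubleton_eq_iff)
  have 3: "H x y" if h: "C \<in> \<C> - \<A>" "x \<in> nbs E X C" "y \<in> nbs E X C" "x \<noteq> y" for C x y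
  proof (rule ccontr)
    assume n: "\<not> H x y"
    \<comment> \<open>\<open>C\<close> could take the free pair \<open>{x, y}\<close>, against the
      maximality of \<open>\<A>\<close>.\<close>
    have "?Q (insert C \<A>)"
    proof (intro conjI exI)
      show "insert C \<A> \<subseteq> \<C>" using h sub by blast
      have ne: "{x, y} \<noteq> {\<sigma> A, \<tau> A}" if "A \<in> \<A>" for A using n that unfolding H_def by blast
      show "inj_on (\<lambda>A. {(\<sigma>(C := x)) A, (\<tau>(C := y)) A}) (insert C \<A>)"
        unfolding inj_on_def
      proof (intro ballI impI)
        fix A B assume ab: "A \<in> insert C \<A>" "B \<in> insert C \<A>"
          "{(\<sigma>(C := x)) A, (\<tau>(C := y)) A} = {(\<sigma>(C := x)) B, (\<tau>(C := y)) B}"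
        have inj: "A \<in> \<A> \<Longrightarrow> B \<in> \<A> \<Longrightarrow> {\<sigma> A, \<tau> A} = {\<sigma> B, \<tau> B} \<Longrightarrow> A = B"
          using st(1) unfolding inj_on_def by blast
        show "A = B"
        proof (cases "A = C")
          case True
          show ?thesis
          proof (rule ccontr)
            assume "A \<noteq> B"
            then have "B \<in> \<A>" "{x, y} = {\<sigma> B, \<tau> B}" using ab True by auto
            then show False using ne by blast
          qed
        next
          case F: False
          show ?thesis
          proof (cases "B = C")
            case True
            then have "A \<in> \<A>" "{x, y} = {\<sigma> A, \<tau> A}" using ab F by auto
            then show ?thesis using ne by blast
          next
            case False
            then show ?thesis using ab F inj by auto
          qed
        qed
      qed
      show "\<forall>A\<in>insert C \<A>. (\<sigma>(C := x)) A \<in> nbs E X A \<and> (\<tau>(C := y)) A \<in> nbs E X A \<and> (\<sigma>(C := x)) A \<noteq> (\<tau>(C := y)) A"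
        using h st(2) by auto
    qed
    then have "card (insert C \<A>) \<le> card \<A>" by (rule A(2))
    then show False using h(1) fA by simp
  qed
  show ?thesis using that[OF sub 1 nH] 2 3 by blast
qed

text \<open>The neighbours of a member left without a pair would be pairwise adjacent in
  \<open>H\<close> and at least \<open>h\<close> in number, too large a clique for \<open>H\<close>.
  So every member is counted in \<open>\<A>\<close>.\<close>

lemma packing_bound:
  assumes "finite X" "finite \<C>" "symp E" "\<not> clique_minor E V h" "X \<subseteq> V"
    and C: "\<And>C. C \<in> \<C> \<Longrightarrow> conn E C \<and> C \<subseteq> V - X"
    and dis: "\<And>C D. C \<in> \<C> \<Longrightarrow> D \<in> \<C> \<Longrightarrow> C \<noteq> D \<Longrightarrow> C \<inter> D = {}"
    and nb: "\<And>C. C \<in> \<C> \<Longrightarrow> h \<le> card (nbs E X C)"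
  shows "card \<C> \<le> 2 ^ h * card X"
proof (rule assign_pairs[OF assms(1-5)])
  fix \<A> H
  assume A: "\<A> \<subseteq> \<C>" "card \<A> \<le> 2 ^ h * card X" "\<not> clique_minor H X h"
    "\<And>C x y. C \<in> \<C> - \<A> \<Longrightarrow> x \<in> nbs E X C \<Longrightarrow> y \<in> nbs E X C \<Longrightarrow> x \<noteq> y \<Longrightarrow> H x y"
  have "\<C> = \<A>"
  proof (rule ccontr)
    assume "\<C> \<noteq> \<A>"
    then obtain D where D: "D \<in> \<C> - \<A>" using A(1) by blast
    have "clique_minor H X h"
    proof (rule clique_minor_clique[of "nbs E X D"])
      show "finite (nbs E X D)" "nbs E X D \<subseteq> X" using assms(1) unfolding nbs_def by auto
    qed (use nb D A(4) in blast)+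
    then show False using A(3) by blast
  qed
  then show ?thesis using A(2) by simp
qed (use C dis in blast)+

section \<open>Rooted tree decompositions\<close>

definition no_cross :: "('v \<Rightarrow> 'v \<Rightarrow> bool) \<Rightarrow> 'v set \<Rightarrow> 'v set \<Rightarrow> bool" where
  "no_cross E A B \<longleftrightarrow> (\<forall>x\<in>A - B. \<forall>y\<in>B - A. \<not> E x y \<and> \<not> E y x)"

text \<open>\<open>td E w A S\<close>: the subgraph induced by \<open>A\<close> has a tree decomposition with root bag \<open>S\<close> and all bags of
  size at most \<open>w\<close>, so \<open>w\<close> is the width plus one.\<close>

inductive td :: "('v \<Rightarrow> 'v \<Rightarrow> bool) \<Rightarrow> nat \<Rightarrow> 'v set \<Rightarrow> 'v set \<Rightarrow> bool" for E w where
  leaf: "finite S \<Longrightarrow> card S \<le> w \<Longrightarrow> td E w S S"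
| attach: "td E w A S \<Longrightarrow> td E w B S' \<Longrightarrow> A \<inter> B \<subseteq> S \<inter> S' \<Longrightarrow> no_cross E A B \<Longrightarrow> td E w (A \<union> B) S'"

lemma no_cross_sym: "no_cross E A B \<Longrightarrow> no_cross E B A"
  unfolding no_cross_def by blast

lemma td_root: "td E w A S \<Longrightarrow> S \<subseteq> A \<and> finite A \<and> card S \<le> w"
  by (induction rule: td.induct) auto

text \<open>The two roles of \<open>attach\<close> are separated: a new root bag on top, and two
  decompositions glued along the same root bag. An attachment is an extension by \<open>S'\<close>
  followed by a join.\<close>

lemma td_induct [consumes 1, case_names leaf extend join]:
  assumes "td E w A S"
    and leaf: "\<And>S. finite S \<Longrightarrow> card S \<le> w \<Longrightarrow> P S S"
    and extend: "\<And>A S S'. td E w A S \<Longrightarrow> P A S \<Longrightarrow> finite S' \<Longrightarrow> card S' \<le> w \<Longrightarrow> A \<inter> S' \<subseteq> S \<Longrightarrow>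
       no_cross E A S' \<Longrightarrow> P (A \<union> S') S'"
    and join: "\<And>A B S. td E w A S \<Longrightarrow> td E w B S \<Longrightarrow> P A S \<Longrightarrow> P B S \<Longrightarrow> A \<inter> B = S \<Longrightarrow> no_cross E A B \<Longrightarrow> P (A \<union> B) S"
  shows "P A S"
  using assms(1)
proof (induction rule: td.induct)
  case (leaf S)
  then show ?case by (rule assms(2))
next
  case (attach A S B S')
  have r: "S \<subseteq> A" "S' \<subseteq> B" "finite B" "card S' \<le> w" using attach td_root by blast+
  then have f: "finite S'" using finite_subset by blast
  have i: "A \<inter> S' \<subseteq> S" using attach.hyps(3) r by blast
  have n: "no_cross E A S'" using attach.hyps r unfolding no_cross_def by blast
  have "td E w (A \<union> S') S'" by (rule td.attach[OF attach.hyps(1) td.leaf[OF f r(4)] _ n]) (use i in blast)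
  moreover have "P (A \<union> S') S'" by (rule extend[OF attach.hyps(1) attach.IH(1) f r(4) i n])
  moreover have "(A \<union> S') \<inter> B = S'" using attach.hyps(3) r by blast
  moreover have "no_cross E (A \<union> S') B" using attach.hyps(4) r unfolding no_cross_def by blast
  ultimately have "P ((A \<union> S') \<union> B) S'" using join attach.hyps(2) attach.IH(2) by blast
  moreover have "(A \<union> S') \<union> B = A \<union> B" using r by blast
  ultimately show ?case by simp
qed

lemma td_mono:
  assumes "td E w A S" "w \<le> w'" "\<And>x y. x \<in> A \<Longrightarrow> y \<in> A \<Longrightarrow> F x y \<Longrightarrow> E x y"
  shows "td F w' A S"
  using assms(1,3)
proof (induction rule: td.induct)
  case (leaf S)
  then show ?case using assms(2) by (intro td.leaf) auto
next
  case (attach A S B S')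
  show ?case
  proof (rule td.attach[OF attach.IH(1) attach.IH(2)])
    show "no_cross F A B" using attach.hyps(4) attach.prems unfolding no_cross_def by (metis DiffD1 UnI1 UnI2)
  qed (use attach in auto)
qed

lemma td_Int:
  assumes "td E w A S"
  shows "td E w (A \<inter> B) (S \<inter> B)"
  using assms
proof (induction rule: td.induct)
  case (leaf S)
  then show ?case by (intro td.leaf) (auto intro: le_trans[OF card_mono[of S]])
next
  case (attach A S C S')
  have "td E w ((A \<inter> B) \<union> (C \<inter> B)) (S' \<inter> B)"
    by (rule td.attach[OF attach.IH]) (use attach.hyps(3,4) in \<open>auto simp: no_cross_def\<close>)
  then show ?case by (simp add: Int_Un_distrib2)
qed

lemma td_image:
  assumes "td E w A S" "inj_on f A" "\<And>x y. x \<in> A \<Longrightarrow> y \<in> A \<Longrightarrow> F (f x) (f y) \<Longrightarrow> E x y"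
  shows "td F w (f ` A) (f ` S)"
  using assms
proof (induction rule: td.induct)
  case (leaf S)
  then show ?case by (intro td.leaf) (auto intro: le_trans[OF card_image_le])
next
  case (attach A S B S')
  have r: "S \<subseteq> A" "S' \<subseteq> B" using attach td_root by blast+
  have i: "inj_on f A" "inj_on f B" using attach.prems(1) by (auto simp: inj_on_Un)
  have fi: "f ` A \<inter> f ` B = f ` (A \<inter> B)" using attach.prems(1) by (simp add: inj_on_image_Int)
  have "td F w (f ` A \<union> f ` B) (f ` S')"
  proof (rule td.attach)
    show "td F w (f ` A) (f ` S)" using attach.IH(1)[OF i(1)] attach.prems(2) by blast
    show "td F w (f ` B) (f ` S')" using attach.IH(2)[OF i(2)] attach.prems(2) by blast
    show "f ` A \<inter> f ` B \<subseteq> f ` S \<inter> f ` S'" unfolding fi using attach.hyps(3) by blast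
    show "no_cross F (f ` A) (f ` B)" unfolding no_cross_def
    proof (intro ballI)
      fix x y assume "x \<in> f ` A - f ` B" "y \<in> f ` B - f ` A"
      then obtain a b where "x = f a" "y = f b" "a \<in> A - B" "b \<in> B - A" by blast
      then show "\<not> F x y \<and> \<not> F y x" using attach.hyps(4) attach.prems(2) unfolding no_cross_def by blast
    qed
  qed
  then show ?case by (simp add: image_Un)
qed

lemma td_add:
  assumes "td E w A S" "finite K"
  shows "td E (w + card K) (A \<union> K) (S \<union> K)"
  using assms(1)
proof (induction rule: td.induct)
  case (leaf S)
  then show ?case using assms(2) by (intro td.leaf) (auto intro: le_trans[OF card_Un_le])
next
  case (attach A S B S')
  have "td E (w + card K) ((A \<union> K) \<union> (B \<union> K)) (S' \<union> K)"
    by (rule td.attach[OF attach.IH]) (use attach.hyps(3,4) in \<open>auto simp: no_cross_def\<close>)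
  then show ?case by (simp add: Un_assoc Un_left_commute)
qed

text \<open>A clique lies inside some bag, since \<open>no_cross\<close> forbids edges between the
  private parts of two sides. The induction descends to the side containing \<open>K\<close> and
  hangs \<open>B\<close> there, so the root \<open>S\<close> survives.\<close>

lemma td_attach_clique:
  assumes "td E w A S" "td E w B R" "A \<inter> B \<subseteq> K" "K \<subseteq> R" "K \<subseteq> A" "no_cross E A B"
    and "\<And>x y. x \<in> K \<Longrightarrow> y \<in> K \<Longrightarrow> x \<noteq> y \<Longrightarrow> E x y"
  shows "td E w (A \<union> B) S"
  using assms
proof (induction rule: td.induct)
  case (leaf S)
  have "td E w (B \<union> S) S"
    by (rule td.attach[OF leaf(3) td.leaf[OF leaf(1,2)]]) (use leaf in \<open>auto simp: no_cross_def\<close>)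
  then show ?case by (simp add: Un_commute)
next
  case (attach C P D Q)
  have r: "P \<subseteq> C" "Q \<subseteq> D" "R \<subseteq> B"
    using td_root[OF attach.hyps(1)] td_root[OF attach.hyps(2)] td_root[OF attach.prems(1)] by simp_all
  have "K \<subseteq> C \<or> K \<subseteq> D"
  proof (rule ccontr)
    assume "\<not> (K \<subseteq> C \<or> K \<subseteq> D)"
    then obtain x y where "x \<in> K" "x \<notin> C" "y \<in> K" "y \<notin> D" by blast
    moreover from this have "x \<in> D" "y \<in> C" using attach.prems(4) by blast+
    ultimately show False using attach.hyps(4) attach.prems(6)[of x y] unfolding no_cross_def by blast
  qed
  then show ?case
  proof
    assume K: "K \<subseteq> C"
    have ns: "no_cross E C B" using attach.prems(2,5) K unfolding no_cross_def by blast
    have i: "C \<inter> B \<subseteq> K" using attach.prems(2) by blast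
    have t: "td E w (C \<union> B) P"
      by (rule attach.IH(1)[OF attach.prems(1) i attach.prems(3) K ns attach.prems(6)])
    have "no_cross E (C \<union> B) D" using attach.hyps(4) attach.prems(2,5) K unfolding no_cross_def by blast
    then have "td E w ((C \<union> B) \<union> D) Q"
      by (rule td.attach[OF t attach.hyps(2), rotated]) (use attach.hyps(3) attach.prems(2) K in blast)
    then show ?case by (simp add: Un_assoc Un_left_commute Un_commute)
  next
    assume K: "K \<subseteq> D"
    have ns: "no_cross E D B" using attach.prems(2,5) K unfolding no_cross_def by blast
    have i: "D \<inter> B \<subseteq> K" using attach.prems(2) by blast
    have t: "td E w (D \<union> B) Q"
      by (rule attach.IH(2)[OF attach.prems(1) i attach.prems(3) K ns attach.prems(6)])
    have "no_cross E C (D \<union> B)" using attach.hyps(4) attach.prems(2,5) K unfolding no_cross_def by blast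
    then have "td E w (C \<union> (D \<union> B)) Q"
      by (rule td.attach[OF attach.hyps(1) t, rotated]) (use attach.hyps(3) attach.prems(2) K in blast)
    then show ?case by (simp add: Un_assoc)
  qed
qed

lemma td_attach_cliques:
  assumes "finite I" "td E w A S"
    and B: "\<And>i. i \<in> I \<Longrightarrow> \<exists>R. K i \<subseteq> R \<and> td E w (C i \<union> K i) R"
    and K: "\<And>i. i \<in> I \<Longrightarrow> K i \<subseteq> A" "\<And>i. i \<in> I \<Longrightarrow> C i \<inter> A = {}"
      "\<And>i x y. i \<in> I \<Longrightarrow> x \<in> K i \<Longrightarrow> y \<in> K i \<Longrightarrow> x \<noteq> y \<Longrightarrow> E x y"
    and dis: "\<And>i j. i \<in> I \<Longrightarrow> j \<in> I \<Longrightarrow> i \<noteq> j \<Longrightarrow> C i \<inter> C j = {}"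
    and edg: "\<And>i x y. i \<in> I \<Longrightarrow> x \<in> C i \<Longrightarrow> y \<in> A \<union> (\<Union>j\<in>I. C j) \<Longrightarrow> E x y \<or> E y x \<Longrightarrow> y \<in> C i \<union> K i"
  shows "td E w (A \<union> (\<Union>i\<in>I. C i)) S"
proof -
  have "td E w (A \<union> (\<Union>i\<in>J. C i)) S" if "J \<subseteq> I" "finite J" for J
    using that(2,1)
  proof (induction J rule: finite_induct)
    case empty
    then show ?case using assms(2) by simp
  next
    case (insert j J)
    let ?A = "A \<union> (\<Union>i\<in>J. C i)"
    have j: "j \<in> I" and JI: "J \<subseteq> I" using insert by auto
    obtain R where R: "K j \<subseteq> R" "td E w (C j \<union> K j) R" using B[OF j] by blast
    have d: "C i \<inter> C j = {}" if "i \<in> J" for i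
      using dis[of i j] that insert.hyps(2) j JI by blast
    have "td E w (?A \<union> (C j \<union> K j)) S"
    proof (rule td_attach_clique[OF insert.IH[OF JI] R(2) _ R(1)])
      show "?A \<inter> (C j \<union> K j) \<subseteq> K j" using d K(2)[OF j] by blast
      show "K j \<subseteq> ?A" using K(1)[OF j] by blast
      show "E x y" if "x \<in> K j" "y \<in> K j" "x \<noteq> y" for x y using K(3)[OF j] that by blast
      show "no_cross E ?A (C j \<union> K j)" unfolding no_cross_def
      proof (intro ballI)
        fix x y assume xy: "x \<in> ?A - (C j \<union> K j)" "y \<in> C j \<union> K j - ?A"
        then have "y \<in> C j" using K(1)[OF j] by blast
        moreover have "x \<in> A \<union> (\<Union>j\<in>I. C j)" using xy(1) JI by blast
        ultimately show "\<not> E x y \<and> \<not> E y x" using edg[OF j, of y x] xy(1) by blast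
      qed
    qed
    moreover have "?A \<union> (C j \<union> K j) = A \<union> (\<Union>i\<in>insert j J. C i)" using K(1)[OF j] by blast
    ultimately show ?case by simp
  qed
  then show ?thesis using assms(1) by blast
qed

text \<open>Replacing \<open>x\<close> by \<open>\<phi> x\<close> in all bags keeps a decomposition:
  the bags that now contain \<open>u\<close> are those of \<open>u\<close> and of some neighbours of
  \<open>u\<close>, and adjacent vertices share a bag. The condition \<open>cl\<close> makes the
  claim inductive; it is void for \<open>A = V\<close>.\<close>

lemma td_subst:
  assumes "td E w A S" "symp E" "finite V" "A \<subseteq> V"
    and cl: "\<And>x y. x \<in> A - S \<Longrightarrow> y \<in> V - A \<Longrightarrow> \<not> E x y"
    and phi: "\<And>x. x \<in> V \<Longrightarrow> x \<in> \<phi> x \<and> \<phi> x \<subseteq> insert x {y\<in>V. E x y} \<and> card (\<phi> x) \<le> q"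
    and F: "\<And>x y. F x y \<Longrightarrow> E x y \<or> (\<exists>z\<in>V. x \<in> \<phi> z \<and> y \<in> \<phi> z)"
  shows "td F (w * q) (\<Union>x\<in>A. \<phi> x) (\<Union>x\<in>S. \<phi> x)"
  using assms(1,4) cl
proof (induction rule: td.induct)
  case (leaf S)
  have fin: "finite (\<phi> x)" if "x \<in> V" for x
    using phi[OF that] assms(3) by (auto intro: finite_subset[of _ "insert x V"])
  show ?case
  proof (rule td.leaf)
    show "finite (\<Union>x\<in>S. \<phi> x)" using leaf fin by blast
    have "card (\<Union>x\<in>S. \<phi> x) \<le> (\<Sum>x\<in>S. card (\<phi> x))" by (rule card_UN_le[OF leaf(1)])
    also have "\<dots> \<le> (\<Sum>x\<in>S. q)" by (rule sum_mono) (use phi leaf in blast)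
    also have "\<dots> \<le> w * q" using leaf(2) by simp
    finally show "card (\<Union>x\<in>S. \<phi> x) \<le> w * q" .
  qed
next
  case (attach A S B S')
  have r: "S \<subseteq> A" "S' \<subseteq> B" using attach td_root by blast+
  have AB: "A \<subseteq> V" "B \<subseteq> V" using attach.prems by blast+
  have sE: "E x y \<longleftrightarrow> E y x" for x y using assms(2) by (meson sympE)
  have clAB: "\<not> E x y" if "x \<in> (A \<union> B) - S'" "y \<in> V - (A \<union> B)" for x y
    using attach.prems(2) that by blast
  have ns: "\<not> E x y" if "x \<in> A - B" "y \<in> B - A" for x y
    using attach.hyps(4) that unfolding no_cross_def by blast
  have clA: "\<not> E x y" if "x \<in> A - S" "y \<in> V - A" for x y
    using clAB[of x y] ns[of x y] that attach.hyps(3) r by blast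
  have clB: "\<not> E x y" if "x \<in> B - S'" "y \<in> V - B" for x y
    using clAB[of x y] ns[of y x] that attach.hyps(3) sE by blast
  have p1: "y = x \<or> (y \<in> V \<and> E x y)" if "x \<in> V" "y \<in> \<phi> x" for x y using phi[OF that(1)] that by blast
  have p0: "x \<in> \<phi> x" if "x \<in> V" for x using phi[OF that] by blast
  \<comment> \<open>If \<open>a\<close> is not in \<open>S\<close>, its neighbours in
    \<open>V\<close> all lie in \<open>A\<close>, so \<open>u\<close> does; then \<open>u\<close> or
    its neighbour \<open>b\<close> belongs to \<open>A \<inter> B\<close>, hence to both roots. The
    other root is symmetric.\<close>
  have main: "u \<in> (\<Union>x\<in>S. \<phi> x) \<inter> (\<Union>x\<in>S'. \<phi> x)" if ab: "a \<in> A" "b \<in> B" "u \<in> \<phi> a" "u \<in> \<phi> b" for a b u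
  proof -
    have uV: "u \<in> V" using p1[of a u] ab AB by blast
    have ua: "u = a \<or> E a u" "u = b \<or> E b u" using p1 ab AB by blast+
    have "u \<in> (\<Union>x\<in>S. \<phi> x)"
    proof (cases "a \<in> S")
      case False
      then have uA: "u \<in> A" using ua(1) clA[of a u] ab(1) uV by blast
      show ?thesis
      proof (cases "u \<in> B")
        case True
        then show ?thesis using uA attach.hyps(3) p0[OF uV] by blast
      next
        case False
        then have "E u b" "b \<noteq> u" using ua(2) sE ab by auto
        then have "b \<in> A" using ns[of u b] uA False ab(2) by blast
        then show ?thesis using ab attach.hyps(3) by blast
      qed
    qed (use ab in blast)
    moreover have "u \<in> (\<Union>x\<in>S'. \<phi> x)"
    proof (cases "b \<in> S'")
      case False
      then have uB: "u \<in> B" using ua(2) clB[of b u] ab(2) uV by blast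
      show ?thesis
      proof (cases "u \<in> A")
        case True
        then show ?thesis using uB attach.hyps(3) p0[OF uV] by blast
      next
        case False
        then have "E a u" using ua(1) ab by auto
        then have "a \<in> B" using ns[of a u] uB False ab(1) by blast
        then show ?thesis using ab attach.hyps(3) by blast
      qed
    qed (use ab in blast)
    ultimately show ?thesis by blast
  qed
  have "td F (w * q) ((\<Union>x\<in>A. \<phi> x) \<union> (\<Union>x\<in>B. \<phi> x)) (\<Union>x\<in>S'. \<phi> x)"
  proof (rule td.attach)
    show "td F (w * q) (\<Union>x\<in>A. \<phi> x) (\<Union>x\<in>S. \<phi> x)" using attach.IH(1)[OF AB(1)] clA by blast
    show "td F (w * q) (\<Union>x\<in>B. \<phi> x) (\<Union>x\<in>S'. \<phi> x)" using attach.IH(2)[OF AB(2)] clB by blast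
    show "(\<Union>x\<in>A. \<phi> x) \<inter> (\<Union>x\<in>B. \<phi> x) \<subseteq> (\<Union>x\<in>S. \<phi> x) \<inter> (\<Union>x\<in>S'. \<phi> x)" using main by blast
    have key: False if h: "u \<in> (\<Union>x\<in>A. \<phi> x)" "u \<notin> (\<Union>x\<in>B. \<phi> x)" "v \<in> (\<Union>x\<in>B. \<phi> x)" "v \<notin> (\<Union>x\<in>A. \<phi> x)"
      "E u v \<or> (\<exists>z\<in>V. u \<in> \<phi> z \<and> v \<in> \<phi> z)" for u v
    proof -
      obtain a where a: "a \<in> A" "u \<in> \<phi> a" using h by blast
      obtain b where b: "b \<in> B" "v \<in> \<phi> b" using h by blast
      have uV: "u \<in> V" "v \<in> V" using p1 a b AB by blast+
      have uB: "u \<notin> B" using h(2) p0[OF uV(1)] by blast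
      have vA: "v \<notin> A" using h(4) p0[OF uV(2)] by blast
      have uA: "u \<in> A"
      proof (rule ccontr)
        assume n: "u \<notin> A"
        then have "E a u" using a p1 AB by blast
        then have "a \<in> S" using clA n a uV by blast
        moreover have "a \<notin> B" using h(2) a by blast
        ultimately have "a \<in> (A \<union> B) - S'" using a r by blast
        then show False using clAB[of a u] n uB uV \<open>E a u\<close> by blast
      qed
      show False using h(5)
      proof
        assume "E u v" then show False using ns[of u v] clAB[of u v] uA uB vA uV r by blast
      next
        assume "\<exists>z\<in>V. u \<in> \<phi> z \<and> v \<in> \<phi> z"
        then obtain z where z: "z \<in> V" "u \<in> \<phi> z" "v \<in> \<phi> z" by blast
        have "z \<notin> A" "z \<notin> B" using z h by blast+
        moreover have "E z u" using p1[OF z(1,2)] uA calculation by blast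
        ultimately show False using clAB[of u z] uA uB r z(1) sE by blast
      qed
    qed
    show "no_cross F (\<Union>x\<in>A. \<phi> x) (\<Union>x\<in>B. \<phi> x)" unfolding no_cross_def
    proof (intro ballI conjI notI)
      fix u v assume uv: "u \<in> (\<Union>x\<in>A. \<phi> x) - (\<Union>x\<in>B. \<phi> x)" "v \<in> (\<Union>x\<in>B. \<phi> x) - (\<Union>x\<in>A. \<phi> x)"
      show False if "F u v" using key[of u v] F[OF that] uv by blast
      show False if "F v u" using key[of u v] F[OF that] uv sE by blast
    qed
  qed
  then show ?case by (simp add: UN_Un)
qed

section \<open>Separators in graphs without a large clique minor\<close>

text \<open>A vertex \<open>v\<close> is measured, for each \<open>i\<close>, by the least size of a
  connected set through \<open>v\<close> that meets the first \<open>i\<close> sets. If no separator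
  made of vertices of one common measure \<open>m\<close> works, some connected set stays below
  \<open>m\<close> for every \<open>i\<close>, which yields a small set meeting all of
  \<open>As\<close>.\<close>

lemma small_tree_or_separator:
  assumes "finite D" "D \<noteq> {}" "symp E" "r \<ge> 1"
  shows "(\<exists>T\<subseteq>D. conn E T \<and> card T \<le> r \<and> (\<forall>A\<in>set As. T \<inter> A \<noteq> {})) \<or>
    (\<exists>Z\<subseteq>D. r * card Z \<le> length As * card D \<and> (\<forall>K. conn E K \<and> K \<subseteq> D - Z \<longrightarrow> (\<exists>A\<in>set As. K \<inter> A = {})))"
proof (cases "As = []")
  case True
  obtain x where "x \<in> D" using assms(2) by blast
  then show ?thesis using True conn_singleton[of E x] assms(4) by (intro disjI1 exI[of _ "{x}"]) auto
next
  case ne: False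
  let ?l = "length As"
  \<comment> \<open>For fixed \<open>i\<close>, the least \<open>m\<close> with \<open>Q i m v\<close> changes by at most one along an edge, so its level sets separate.\<close>
  define Q where "Q = (\<lambda>i m v. \<exists>T\<subseteq>D. conn E T \<and> v \<in> T \<and> card T \<le> m \<and> (\<forall>j<i. T \<inter> As ! j \<noteq> {}))"
  define L where "L = (\<lambda>i m. {v\<in>D. Q i m v \<and> \<not> Q i (m - 1) v})"
  define Z where "Z = (\<lambda>m. \<Union>i\<in>{1..?l}. L i m)"
  have Qmono: "Q i m v \<Longrightarrow> m \<le> m' \<Longrightarrow> Q i m' v" for i m m' v
    unfolding Q_def using le_trans by blast
  have fL: "finite (L i m)" for i m unfolding L_def using assms(1) by simp
  have disj: "L i m \<inter> L i m' = {}" if "m < m'" for i m m'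
  proof -
    have "m \<le> m' - 1" using that by simp
    then show ?thesis unfolding L_def using Qmono by blast
  qed
  have sumL: "(\<Sum>m\<in>{1..r}. card (L i m)) \<le> card D" for i
  proof -
    have "(\<Sum>m\<in>{1..r}. card (L i m)) = card (\<Union>m\<in>{1..r}. L i m)"
    proof (rule card_UN_disjoint[symmetric])
      show "\<forall>m\<in>{1..r}. \<forall>m'\<in>{1..r}. m \<noteq> m' \<longrightarrow> L i m \<inter> L i m' = {}"
        using disj by (metis Int_commute linorder_neqE_nat)
    qed (use fL in auto)
    also have "\<dots> \<le> card D" using assms(1) by (intro card_mono) (auto simp: L_def)
    finally show ?thesis .
  qed
  have "(\<Sum>m\<in>{1..r}. card (Z m)) \<le> (\<Sum>m\<in>{1..r}. \<Sum>i\<in>{1..?l}. card (L i m))"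
    unfolding Z_def by (intro sum_mono card_UN_le) simp
  also have "\<dots> = (\<Sum>i\<in>{1..?l}. \<Sum>m\<in>{1..r}. card (L i m))" by (rule sum.swap)
  also have "\<dots> \<le> (\<Sum>i\<in>{1..?l}. card D)" by (intro sum_mono sumL)
  also have "\<dots> = ?l * card D" by simp
  finally have tot: "(\<Sum>m\<in>{1..r}. card (Z m)) \<le> ?l * card D" .
  \<comment> \<open>For fixed \<open>i\<close> the levels are disjoint, so the \<open>r\<close>
    candidates \<open>Z m\<close> have total size at most \<open>?l * card D\<close> and one of them
    is at most average.\<close>
  have "\<exists>m\<in>{1..r}. r * card (Z m) \<le> ?l * card D"
  proof (rule ccontr)
    assume "\<not> ?thesis"
    then have *: "?l * card D < r * card (Z m)" if "m \<in> {1..r}" for m using that by (simp add: not_le)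
    have "(\<Sum>m\<in>{1..r}. ?l * card D) < (\<Sum>m\<in>{1..r}. r * card (Z m))"
      by (rule sum_strict_mono) (use * assms(4) in auto)
    then have "r * (?l * card D) < r * (\<Sum>m\<in>{1..r}. card (Z m))" by (simp add: sum_distrib_left)
    then show False using tot assms(4) by simp
  qed
  then obtain m where m: "m \<in> {1..r}" "r * card (Z m) \<le> ?l * card D" by blast
  show ?thesis
  proof (cases "\<exists>K. conn E K \<and> K \<subseteq> D - Z m \<and> (\<forall>A\<in>set As. K \<inter> A \<noteq> {})")
    case False
    have "Z m \<subseteq> D" unfolding Z_def L_def by blast
    moreover have "\<forall>K. conn E K \<and> K \<subseteq> D - Z m \<longrightarrow> (\<exists>A\<in>set As. K \<inter> A = {})" using False by metis
    ultimately show ?thesis using m(2) by (intro disjI2 exI[of _ "Z m"]) simp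
  next
    case True
    then obtain K where K: "conn E K" "K \<subseteq> D - Z m" "\<And>i. i < ?l \<Longrightarrow> K \<inter> As ! i \<noteq> {}" by auto
    have down: "Q i (m - 1) v" if "v \<in> K" "Q i m v" "1 \<le> i" "i \<le> ?l" for i v
    proof (rule ccontr)
      assume "\<not> Q i (m - 1) v"
      then have "v \<in> L i m" using that K(2) unfolding L_def by blast
      then have "v \<in> Z m" using that(3,4) unfolding Z_def by auto
      then show False using K(2) that(1) by blast
    qed
    have spread: "\<forall>v\<in>K. Q i (m - 1) v" if x: "x \<in> K" "Q i (m - 1) x" "1 \<le> i" "i \<le> ?l" for i x
    proof (rule ccontr)
      assume "\<not> (\<forall>v\<in>K. Q i (m - 1) v)"
      then have "\<not> K \<subseteq> {v. Q i (m - 1) v}" by blast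
      then obtain a b where ab: "a \<in> K" "Q i (m - 1) a" "b \<in> K" "\<not> Q i (m - 1) b" "E a b"
        using connD[OF K(1) x(1), of "{v. Q i (m - 1) v}"] x(2) by blast
      then obtain T where T: "T \<subseteq> D" "conn E T" "a \<in> T" "card T \<le> m - 1" "\<forall>j<i. T \<inter> As ! j \<noteq> {}"
        unfolding Q_def by blast
      have "card (insert b T) \<le> m" using T(4) m(1) finite_subset[OF T(1) assms(1)] card_insert_if[of T b] by auto
      moreover have "insert b T \<subseteq> D" using T(1) ab(3) K(2) by blast
      moreover have "conn E (insert b T)" using conn_insert[OF assms(3) T(2,3) ab(5)] .
      ultimately have "Q i m b" unfolding Q_def using T(5) by (intro exI[of _ "insert b T"]) auto
      then show False using down[OF ab(3) _ x(3,4)] ab(4) by blast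
    qed
    \<comment> \<open>\<open>K\<close> avoids level \<open>m\<close> for every \<open>i\<close>, so
      all its vertices stay on the small side. A vertex of \<open>K\<close> in \<open>As ! i\<close>
      carries this from \<open>i\<close> sets to \<open>Suc i\<close>.\<close>
    have main: "i \<le> ?l \<Longrightarrow> i \<ge> 1 \<Longrightarrow> \<forall>v\<in>K. Q i (m - 1) v" for i
    proof (induction i)
      case (Suc i)
      obtain x where x: "x \<in> K" "x \<in> As ! i" using K(3)[of i] Suc.prems(1) by auto
      have "Q (Suc i) (m - 1) x"
      proof (cases "i = 0")
        case True
        have "x \<in> D" using x K(2) by blast
        then have "Q (Suc i) m x" unfolding Q_def using True x m(1) conn_singleton[of E x]
          by (intro exI[of _ "{x}"]) auto
        then show ?thesis using down x Suc.prems by blast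
      next
        case False
        then have "Q i (m - 1) x" using Suc x by simp
        then obtain T where T: "T \<subseteq> D" "conn E T" "x \<in> T" "card T \<le> m - 1" "\<forall>j<i. T \<inter> As ! j \<noteq> {}"
          unfolding Q_def by blast
        then show ?thesis unfolding Q_def using x
          by (intro exI[of _ T]) (auto simp: less_Suc_eq)
      qed
      then show ?case using spread x Suc.prems by blast
    qed simp
    obtain v where "v \<in> K" using K(1) conn_nonempty by blast
    then have "Q ?l (m - 1) v" using main[of ?l] ne by (simp add: Suc_leI)
    then obtain T where T: "T \<subseteq> D" "conn E T" "card T \<le> m - 1" "\<forall>j<?l. T \<inter> As ! j \<noteq> {}"
      unfolding Q_def by blast
    have "\<forall>A\<in>set As. T \<inter> A \<noteq> {}" using T(4) by (metis in_set_conv_nth)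
    moreover have "card T \<le> r" using T(3) m(1) by auto
    ultimately show ?thesis using T by blast
  qed
qed

lemma small_tree_or_separator_set:
  assumes "finite D" "D \<noteq> {}" "symp E" "r \<ge> 1" "finite \<A>"
  shows "(\<exists>T\<subseteq>D. conn E T \<and> card T \<le> r \<and> (\<forall>A\<in>\<A>. T \<inter> A \<noteq> {})) \<or>
    (\<exists>Z\<subseteq>D. r * card Z \<le> card \<A> * card D \<and> (\<forall>K. conn E K \<and> K \<subseteq> D - Z \<longrightarrow> (\<exists>A\<in>\<A>. K \<inter> A = {})))"
proof -
  obtain As where As: "set As = \<A>" "distinct As" using finite_distinct_list[OF assms(5)] by blast
  then have "length As = card \<A>" using distinct_card by fastforce
  then show ?thesis using small_tree_or_separator[OF assms(1-4), of As] As(1) by simp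
qed

section \<open>Coveys (clique minor models of unspecified order) and balanced separators\<close>

definition covey :: "('v \<Rightarrow> 'v \<Rightarrow> bool) \<Rightarrow> 'v set \<Rightarrow> 'v set set \<Rightarrow> bool" where
  "covey E V \<C> \<longleftrightarrow> finite \<C> \<and> (\<forall>C\<in>\<C>. C \<subseteq> V \<and> conn E C) \<and>
     (\<forall>C\<in>\<C>. \<forall>D\<in>\<C>. C \<noteq> D \<longrightarrow> C \<inter> D = {} \<and> touch E C D)"

lemma covey_card_less:
  assumes "covey E V \<C>" "\<not> clique_minor E V h"
  shows "card \<C> < h"
proof (rule ccontr)
  assume "\<not> card \<C> < h"
  then obtain \<N> where N: "\<N> \<subseteq> \<C>" "card \<N> = h" "finite \<N>"
    using obtain_subset_with_card_n[of h \<C>] assms(1) by (auto simp: covey_def)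
  have "clique_minor E V h"
    by (rule clique_minorI[OF N(3,2)]) (use assms(1) subsetD[OF N(1)] in \<open>simp_all add: covey_def\<close>)
  then show False using assms(2) by blast
qed

text \<open>Otherwise every \<open>Z\<close> with at most \<open>h * r\<close> vertices leaves a
  component with more than half of \<open>W\<close>. A state uses at most \<open>r\<close> vertices
  from each of fewer than \<open>h\<close> covey members, so \<open>r\<close> more may always be
  deleted. The condition \<open>h * card V \<le> r * r\<close> brings the separators of the
  preceding dichotomy down to \<open>r\<close> vertices.\<close>

lemma balanced_separator:
  assumes fin: "finite V" and sym: "symp E" and nm: "\<not> clique_minor E V h"
    and r: "h * card V \<le> r * r" "r \<ge> 1" and W: "W \<subseteq> V"
  shows "\<exists>Z\<subseteq>V. card Z \<le> h * r \<and> (\<forall>K. conn E K \<and> K \<subseteq> V - Z \<longrightarrow> 2 * card (K \<inter> W) \<le> card W)"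
proof (rule ccontr)
  assume contra: "\<not> ?thesis"
  have sE: "E x y \<longleftrightarrow> E y x" for x y using sym by (meson sympE)
  define big where "big = (\<lambda>D. card W < 2 * card (D \<inter> W))"
  have fW: "finite W" using fin W finite_subset by blast
  have bigmono: "big D'" if "big D" "D \<subseteq> D'" for D D'
  proof -
    have "card (D \<inter> W) \<le> card (D' \<inter> W)" using that fW by (intro card_mono) auto
    then show ?thesis using that unfolding big_def by simp
  qed
  have bigint: "D \<inter> D' \<noteq> {}" if "big D" "big D'" for D D'
  proof
    assume "D \<inter> D' = {}"
    then have "card (D \<inter> W) + card (D' \<inter> W) = card ((D \<inter> W) \<union> (D' \<inter> W))"
      using fW by (intro card_Un_disjoint[symmetric]) auto
    also have "\<dots> \<le> card W" using fW by (intro card_mono) auto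
    finally show False using that unfolding big_def by simp
  qed
  have bigcomp: "\<exists>D. component E (V - Z) D \<and> big D" if Z: "Z \<subseteq> V" "card Z \<le> h * r" for Z
  proof -
    obtain K where K: "conn E K" "K \<subseteq> V - Z" "big K"
      using contra Z unfolding big_def by (meson not_le)
    have "finite (V - Z)" using fin by simp
    then obtain D where "component E (V - Z) D" "K \<subseteq> D" using component_exists[OF sym _ K(1,2)] by blast
    then show ?thesis using bigmono K(3) by blast
  qed
  \<comment> \<open>A state with the smallest big component \<open>D\<close> can be improved, either by a new member of the covey inside
    \<open>D\<close> or by enlarging a member that the separator cuts off from the new big component.\<close>
  define ok where "ok = (\<lambda>(\<C>, X, D). covey E V \<C> \<and> X \<subseteq> \<Union>\<C> \<and> (\<forall>C\<in>\<C>. card (X \<inter> C) \<le> r) \<and>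
     component E (V - X) D \<and> big D \<and> (\<forall>C\<in>\<C>. D \<inter> C = {}))"
  \<comment> \<open>Lexicographic order by the size of \<open>D\<close>, then of
    \<open>\<C>\<close>: a covey has fewer than \<open>h\<close> members, so the factor
    \<open>h + 2\<close> dominates.\<close>
  define meas where "meas = (\<lambda>(\<C> :: 'a set set, X :: 'a set, D :: 'a set). card D * (h + 2) + card \<C>)"
  obtain D0 where D0: "component E (V - {}) D0" "big D0" using bigcomp[of "{}"] by auto
  have "ok ({}, {}, D0)" using D0 unfolding ok_def covey_def by simp
  then obtain st where st: "ok st" "\<And>st'. ok st' \<Longrightarrow> meas st \<le> meas st'"
    using ex_has_least_nat[of ok _ meas] by blast
  obtain \<C> X D where eq: "st = (\<C>, X, D)" by (cases st) auto
  have cov: "covey E V \<C>" and XC: "X \<subseteq> \<Union>\<C>" and Xr: "\<And>C. C \<in> \<C> \<Longrightarrow> card (X \<inter> C) \<le> r"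
    and comp: "component E (V - X) D" and bD: "big D" and dis: "\<And>C. C \<in> \<C> \<Longrightarrow> D \<inter> C = {}"
    using st(1) unfolding ok_def eq by auto
  have minimal: "False" if "ok (\<C>', X', D')" "card D' < card D" for \<C>' X' D'
  proof -
    have "card \<C>' < h" using that(1) covey_card_less[OF _ nm] unfolding ok_def by auto
    moreover have "Suc (card D') * (h + 2) \<le> card D * (h + 2)" using that(2) by (intro mult_le_mono1) simp
    ultimately have "meas (\<C>', X', D') < meas st" unfolding meas_def eq by simp
    then show False using st(2)[OF that(1)] by simp
  qed
  have fC: "finite \<C>" and CV: "\<And>C. C \<in> \<C> \<Longrightarrow> C \<subseteq> V" and Cc: "\<And>C. C \<in> \<C> \<Longrightarrow> conn E C"
    and CC: "\<And>C C'. C \<in> \<C> \<Longrightarrow> C' \<in> \<C> \<Longrightarrow> C \<noteq> C' \<Longrightarrow> C \<inter> C' = {} \<and> touch E C C'"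
    using cov unfolding covey_def by simp_all
  have DV: "D \<subseteq> V - X" and Dc: "conn E D" and Dn: "\<And>x y. x \<in> D \<Longrightarrow> y \<in> V \<Longrightarrow> y \<notin> X \<Longrightarrow> y \<notin> D \<Longrightarrow> \<not> E x y"
    using comp unfolding component_def touch_def by blast+
  have XV: "X \<subseteq> V"
  proof
    fix x assume "x \<in> X"
    then obtain C where "C \<in> \<C>" "x \<in> C" using XC by blast
    then show "x \<in> V" using CV by (meson subsetD)
  qed
  have fD: "finite D" using DV fin finite_subset by blast
  have fX: "finite X" using XV fin finite_subset by blast
  have qh: "card \<C> < h" using covey_card_less[OF cov nm] .
  have cX: "card X \<le> card \<C> * r"
  proof -
    have "X = (\<Union>C\<in>\<C>. X \<inter> C)" using XC by blast
    then have "card X \<le> (\<Sum>C\<in>\<C>. card (X \<inter> C))" using card_UN_le[OF fC, of "\<lambda>C. X \<inter> C"] by simp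
    also have "\<dots> \<le> (\<Sum>C\<in>\<C>. r)" by (intro sum_mono Xr)
    finally show ?thesis by simp
  qed
  have cXr: "card X + r \<le> h * r"
  proof -
    have "Suc (card \<C>) * r \<le> h * r" using qh by (intro mult_le_mono1) simp
    then show ?thesis using cX by simp
  qed
  define Nb where "Nb = (\<lambda>C. {v\<in>D. \<exists>c\<in>C. E c v})"
  have NbD: "Nb C \<subseteq> D" for C unfolding Nb_def by blast
  \<comment> \<open>A member without neighbours in \<open>D\<close> could be dropped together with
    its part of \<open>X\<close>: \<open>D\<close> would remain a component, with a smaller
    covey.\<close>
  have Nbne: "Nb C \<noteq> {}" if C: "C \<in> \<C>" for C
  proof
    assume n: "Nb C = {}"
    have "ok (\<C> - {C}, X - C, D)" unfolding ok_def prod.case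
    proof (intro conjI ballI)
      show "covey E V (\<C> - {C})" using cov unfolding covey_def by simp
      show "X - C \<subseteq> \<Union>(\<C> - {C})" using XC by blast
      show "card ((X - C) \<inter> C') \<le> r" if "C' \<in> \<C> - {C}" for C'
      proof -
        have "card ((X - C) \<inter> C') \<le> card (X \<inter> C')" using fX by (intro card_mono) auto
        then show ?thesis using Xr[of C'] that by simp
      qed
      have "\<not> E x y" if "x \<in> D" "y \<in> V - (X - C) - D" for x y
        using that Dn[of x y] n sE unfolding Nb_def by blast
      then show "component E (V - (X - C)) D" using DV Dc unfolding component_def touch_def by blast
    qed (use bD dis in auto)
    then have "meas st \<le> meas (\<C> - {C}, X - C, D)" by (rule st(2))
    moreover have "card (\<C> - {C}) < card \<C>" using fC C by (meson card_Diff1_less)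
    ultimately show False unfolding meas_def eq by simp
  qed
  have "D \<noteq> {}" using Dc conn_nonempty by blast
  from small_tree_or_separator_set[OF fD this sym r(2), of "Nb ` \<C>"] fC
  consider (tree) T where "T \<subseteq> D" "conn E T" "card T \<le> r" "\<And>C. C \<in> \<C> \<Longrightarrow> T \<inter> Nb C \<noteq> {}"
    | (sep) Z where "Z \<subseteq> D" "r * card Z \<le> card (Nb ` \<C>) * card D"
       "\<And>K. conn E K \<Longrightarrow> K \<subseteq> D - Z \<Longrightarrow> \<exists>C\<in>\<C>. K \<inter> Nb C = {}"
    by (auto simp del: UN_simps)
  then show False
  proof cases
    \<comment> \<open>\<open>T\<close> touches every member, so it joins the covey; the big
      component beyond \<open>X \<union> T\<close> loses the vertices of \<open>T\<close>.\<close>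
    case tree
    have fT: "finite T" using tree(1) fD finite_subset by blast
    have "card (X \<union> T) \<le> h * r" using card_Un_le[of X T] tree(3) cXr by linarith
    moreover have XTV: "X \<union> T \<subseteq> V" using XV DV tree(1) by blast
    ultimately obtain D' where D': "component E (V - (X \<union> T)) D'" "big D'" using bigcomp by blast
    have D's: "D' \<subseteq> V - (X \<union> T)" using component_sub[OF D'(1)] .
    have D'D: "D' \<subseteq> D"
      by (rule component_absorb[OF comp component_conn[OF D'(1)]]) (use D's bigint[OF D'(2) bD] in auto)
    obtain t where t: "t \<in> T" using tree(2) conn_nonempty by blast
    have "D' \<subset> D" using D'D D's t tree(1) by blast
    then have less: "card D' < card D" using fD psubset_card_mono by blast
    have TC: "T \<inter> C = {}" if "C \<in> \<C>" for C using tree(1) dis[OF that] by blast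
    have TT: "touch E C T \<and> touch E T C" if "C \<in> \<C>" for C
      using tree(4)[OF that] sE unfolding touch_def Nb_def by blast
    have "ok (insert T \<C>, X \<union> T, D')" unfolding ok_def prod.case
    proof (intro conjI ballI)
      show "covey E V (insert T \<C>)" unfolding covey_def
      proof (intro conjI ballI impI)
        show "C \<subseteq> V" "conn E C" if "C \<in> insert T \<C>" for C
          using that CV Cc tree(2) XTV by auto
        show "C \<inter> C' = {}" "touch E C C'" if "C \<in> insert T \<C>" "C' \<in> insert T \<C>" "C \<noteq> C'" for C C'
          using that CC[of C C'] TC TT by auto
      qed (use fC in simp)
      show "X \<union> T \<subseteq> \<Union>(insert T \<C>)" using XC by blast
      show "card ((X \<union> T) \<inter> C) \<le> r" if "C \<in> insert T \<C>" for C
      proof (cases "C = T")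
        case True
        then have "(X \<union> T) \<inter> C = T" by blast
        then show ?thesis using tree(3) by simp
      next
        case False
        then have "(X \<union> T) \<inter> C = X \<inter> C" using TC that by blast
        then show ?thesis using Xr that False by simp
      qed
      show "D' \<inter> C = {}" if "C \<in> insert T \<C>" for C
        using that D'D D's dis by blast
    qed (use D' in auto)
    then show False using minimal less by blast
  next
    case sep
    have "card (Nb ` \<C>) * card D \<le> h * card V"
      using card_image_le[OF fC, of Nb] qh DV fin by (intro mult_le_mono card_mono) auto
    then have "r * card Z \<le> r * r" using sep(2) r(1) by linarith
    then have cZ: "card Z \<le> r" using r(2) by simp
    have "card (X \<union> Z) \<le> h * r" using card_Un_le[of X Z] cZ cXr by linarith
    moreover have XZV: "X \<union> Z \<subseteq> V" using XV DV sep(1) by blast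
    ultimately obtain D0 where D0: "component E (V - (X \<union> Z)) D0" "big D0" using bigcomp by blast
    have D0s: "D0 \<subseteq> V - (X \<union> Z)" using component_sub[OF D0(1)] .
    have D0c: "conn E D0" using component_conn[OF D0(1)] .
    have D0n: "\<not> E x y" if "x \<in> D0" "y \<in> V" "y \<notin> X" "y \<notin> Z" "y \<notin> D0" for x y
      using D0(1) that unfolding component_def touch_def by blast
    have D0D: "D0 \<subseteq> D"
      by (rule component_absorb[OF comp D0c]) (use D0s bigint[OF D0(2) bD] in auto)
    \<comment> \<open>As \<open>D0\<close> lies in \<open>D - Z\<close>, it misses the neighbours of
      some member \<open>C\<close>, and \<open>C\<close> can be enlarged within
      \<open>D - D0\<close>.\<close>
    obtain C where C: "C \<in> \<C>" "D0 \<inter> Nb C = {}" using sep(3)[OF D0c] D0D D0s by blast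
    have DC: "D \<inter> C = {}" using dis[OF C(1)] .
    have "finite (C \<union> (D - D0))" using CV[OF C(1)] fD fin finite_subset by blast
    then obtain C' where C': "component E (C \<union> (D - D0)) C'" "C \<subseteq> C'"
      using component_exists[OF sym _ Cc[OF C(1)]] by blast
    have C's: "C' \<subseteq> C \<union> (D - D0)" using component_sub[OF C'(1)] .
    have C'n: "\<not> E x y" if "x \<in> C'" "y \<in> D" "y \<notin> D0" "y \<notin> C'" for x y
      using C'(1) that unfolding component_def touch_def by blast
    \<comment> \<open>The vertices of \<open>X\<close> in \<open>C\<close> are released: as shown
      below, the component containing \<open>D0\<close> cannot reach \<open>C'\<close> once
      \<open>Z \<inter> C'\<close> is deleted.\<close>
    define X' where "X' = (X - C) \<union> (Z \<inter> C')"
    have "D0 \<subseteq> V - X'" using D0s unfolding X'_def by blast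
    moreover have "finite (V - X')" using fin by simp
    ultimately obtain D' where D': "component E (V - X') D'" "D0 \<subseteq> D'"
      using component_exists[OF sym _ D0c] by blast
    have D's: "D' \<subseteq> V - X'" using component_sub[OF D'(1)] .
    obtain d where d: "d \<in> D0" using D0c conn_nonempty by blast
    have D'D: "D' \<subseteq> D - C'"
    proof (rule ccontr)
      assume "\<not> D' \<subseteq> D - C'"
      moreover have "d \<in> D'" "d \<in> D - C'" using d D'(2) D0D C's DC by blast+
      ultimately obtain x y where xy: "x \<in> D' \<inter> (D - C')" "y \<in> D' - (D - C')" "E x y"
        using connD[OF component_conn[OF D'(1)]] by blast
      have yV: "y \<in> V" "y \<notin> X'" using xy(2) D's by blast+
      show False
      proof (cases "y \<in> C'")
        case True
        have xD0: "x \<in> D0"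
        proof (rule ccontr)
          assume "x \<notin> D0"
          then show False using C'n[of y x] True xy sE by blast
        qed
        show False
        proof (cases "y \<in> C")
          case True
          then have "x \<in> Nb C" using xy sE unfolding Nb_def by blast
          then show False using C(2) xD0 by blast
        next
          case False
          then have "y \<in> D" "y \<notin> D0" using True C's by blast+
          then have "y \<in> Z" using D0n[of x y] xD0 xy(3) yV(1) DV by blast
          then show False using yV(2) True unfolding X'_def by blast
        qed
      next
        case False
        then have "y \<notin> D" using xy(2) by blast
        then have "y \<in> X" using Dn[of x y] xy yV by blast
        then show False using yV(2) False C'(2) unfolding X'_def by blast
      qed
    qed
    have "Nb C \<inter> D' = {}"
    proof (rule ccontr)
      assume "Nb C \<inter> D' \<noteq> {}"
      then obtain x where x: "x \<in> Nb C" "x \<in> D'" by blast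
      then have "x \<notin> D0" "x \<in> D" "x \<notin> C'" using C(2) D'D by blast+
      then show False using x(1) C'n C'(2) unfolding Nb_def by blast
    qed
    \<comment> \<open>The neighbours of \<open>C\<close> in \<open>D\<close> exist and are lost, so
      the inclusion is proper.\<close>
    then have "D' \<subset> D" using D'D Nbne[OF C(1)] NbD[of C] by blast
    then have less: "card D' < card D" using fD psubset_card_mono by blast
    have C'o: "C' \<inter> B = {} \<and> touch E C' B \<and> touch E B C'" if "B \<in> \<C>" "B \<noteq> C" for B
    proof -
      have "C \<inter> B = {}" "touch E C B" "touch E B C" using CC[of C B] CC[of B C] that C(1) by auto
      then show ?thesis using C's C'(2) dis[OF that(1)] touch_mono[of E C B C' B] touch_mono[of E B C B C'] by blast
    qed
    have "ok (insert C' (\<C> - {C}), X', D')" unfolding ok_def prod.case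
    proof (intro conjI ballI)
      show "covey E V (insert C' (\<C> - {C}))" unfolding covey_def
      proof (intro conjI ballI impI)
        show "B \<subseteq> V" "conn E B" if "B \<in> insert C' (\<C> - {C})" for B
        proof -
          have "C' \<subseteq> V" using C's CV[OF C(1)] DV by blast
          then show "B \<subseteq> V" using that CV[of B] by auto
          show "conn E B" using that Cc[of B] component_conn[OF C'(1)] by auto
        qed
        show "B \<inter> B' = {}" "touch E B B'" if "B \<in> insert C' (\<C> - {C})" "B' \<in> insert C' (\<C> - {C})" "B \<noteq> B'" for B B'
          using that CC[of B B'] C'o by auto
      qed (use fC in simp)
      show "X' \<subseteq> \<Union>(insert C' (\<C> - {C}))" using XC unfolding X'_def by blast
      show "card (X' \<inter> B) \<le> r" if "B \<in> insert C' (\<C> - {C})" for B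
      proof (cases "B = C'")
        case True
        have "X' \<inter> B \<subseteq> Z" using True C's DV unfolding X'_def by blast
        then have "card (X' \<inter> B) \<le> card Z" using sep(1) fD finite_subset by (intro card_mono) blast+
        then show ?thesis using cZ by simp
      next
        case False
        then have B: "B \<in> \<C>" using that by blast
        have "X' \<inter> B \<subseteq> X \<inter> B" using dis[OF B] sep(1) unfolding X'_def by blast
        then have "card (X' \<inter> B) \<le> card (X \<inter> B)" using fX by (intro card_mono) auto
        then show ?thesis using Xr[OF B] by simp
      qed
      show "big D'" using bigmono[OF D0(2) D'(2)] .
      show "D' \<inter> B = {}" if "B \<in> insert C' (\<C> - {C})" for B
        using that D'D dis by blast
    qed (use D' in auto)
    then show False using minimal less by blast
  qed
qed

text \<open>The usual recursion on components. \<open>U\<close> has odd size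
  \<open>2 * s + 1\<close>, so at most half of it means at most \<open>s\<close>; together with
  \<open>Z\<close> a component inherits at most \<open>2 * s\<close> prescribed vertices, and the
  root bag \<open>U \<union> Z\<close> has at most \<open>3 * s + 1\<close>.\<close>

lemma td_of_separators:
  assumes "finite V" "symp E"
    and sep: "\<And>A W. A \<subseteq> V \<Longrightarrow> W \<subseteq> A \<Longrightarrow> \<exists>Z\<subseteq>A. card Z \<le> s \<and> (\<forall>K. conn E K \<and> K \<subseteq> A - Z \<longrightarrow> 2 * card (K \<inter> W) \<le> card W)"
  shows "A \<subseteq> V \<Longrightarrow> W \<subseteq> A \<Longrightarrow> card W \<le> 2 * s + 1 \<Longrightarrow> \<exists>S. W \<subseteq> S \<and> td E (3 * s + 1) A S"
proof (induction "card A" arbitrary: A W rule: less_induct)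
  case less
  have fA: "finite A" using less.prems(1) assms(1) finite_subset by blast
  show ?case
  proof (cases "card A \<le> 2 * s + 1")
    case True
    then show ?thesis using td.leaf[of A "3 * s + 1" E] fA less.prems(2) by auto
  next
    case False
    then obtain U where U: "W \<subseteq> U" "U \<subseteq> A" "card U = 2 * s + 1"
      using exists_subset_between[of W "2 * s + 1" A] less.prems fA by auto
    obtain Z where Z: "Z \<subseteq> A" "card Z \<le> s" "\<And>K. conn E K \<Longrightarrow> K \<subseteq> A - Z \<Longrightarrow> 2 * card (K \<inter> U) \<le> card U"
      using sep[OF less.prems(1) U(2)] by blast
    let ?S = "U \<union> Z"
    have fS: "finite ?S" using U(2) Z(1) fA finite_subset by blast
    have cS: "card ?S \<le> 3 * s + 1" using card_Un_le[of U Z] U(3) Z(2) by simp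
    have step: "td E (3 * s + 1) (D \<union> ?S) ?S" if D: "component E (A - Z) D" for D
    proof -
      have Ds: "D \<subseteq> A - Z" using component_sub[OF D] .
      have c1: "card (D \<inter> U) \<le> s" using Z(3)[OF component_conn[OF D] Ds] U(3) by simp
      let ?W = "(D \<inter> U) \<union> Z"
      have cW: "card ?W \<le> 2 * s" using card_Un_le[of "D \<inter> U" Z] c1 Z(2) by simp
      \<comment> \<open>Filling \<open>W\<close> up to \<open>2 * s + 1\<close> vertices guarantees
        that the recursive call is on a smaller set.\<close>
      have "\<not> U \<subseteq> D \<union> Z"
      proof
        assume "U \<subseteq> D \<union> Z"
        then have "card U \<le> card ?W" using fS by (intro card_mono) (auto intro: finite_subset)
        then show False using cW U(3) by simp
      qed
      then have "D \<union> Z \<subset> A" using U(2) Ds Z(1) by blast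
      then have "card (D \<union> Z) < card A" "D \<union> Z \<subseteq> V" using psubset_card_mono[OF fA] less.prems(1) by auto
      then obtain S where S: "?W \<subseteq> S" "td E (3 * s + 1) (D \<union> Z) S"
        using less.hyps[of "D \<union> Z" ?W] cW by auto
      have "td E (3 * s + 1) ((D \<union> Z) \<union> ?S) ?S"
      proof (rule td.attach[OF S(2) td.leaf[OF fS cS]])
        show "(D \<union> Z) \<inter> ?S \<subseteq> S \<inter> ?S" using S(1) by blast
        show "no_cross E (D \<union> Z) ?S" unfolding no_cross_def
        proof (intro ballI)
          fix x y assume xy: "x \<in> D \<union> Z - ?S" "y \<in> ?S - (D \<union> Z)"
          then have "x \<in> D" "y \<in> A - Z - D" using U(2) by auto
          then have "\<not> E x y" using D unfolding component_def touch_def by blast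
          then show "\<not> E x y \<and> \<not> E y x" using assms(2) by (meson sympE)
        qed
      qed
      moreover have "(D \<union> Z) \<union> ?S = D \<union> ?S" by blast
      ultimately show ?thesis by simp
    qed
    let ?\<D> = "{D. component E (A - Z) D}"
    have fD: "finite ?\<D>" by (rule finite_subset[of _ "Pow A"]) (use fA component_sub in \<open>auto dest!: component_sub\<close>)
    have "td E (3 * s + 1) (\<Union>\<X> \<union> ?S) ?S" if "finite \<X>" "\<X> \<subseteq> ?\<D>" for \<X>
      using that
    proof (induction \<X> rule: finite_induct)
      case empty
      then show ?case using td.leaf[OF fS cS] by simp
    next
      case (insert D \<X>)
      have D: "component E (A - Z) D" using insert.prems by simp
      have dj: "D \<inter> D' = {}" if "D' \<in> \<X>" for D'
        using component_eq[OF D, of D'] that insert by auto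
      have sub: "\<Union>\<X> \<subseteq> A - Z"
      proof
        fix x assume "x \<in> \<Union>\<X>"
        then obtain D' where "D' \<in> \<X>" "x \<in> D'" by blast
        then show "x \<in> A - Z" using insert.prems component_sub[of E "A - Z" D'] by auto
      qed
      have Ds: "D \<subseteq> A - Z" using component_sub[OF D] .
      have i: "D \<inter> \<Union>\<X> = {}" using dj by blast
      have t: "td E (3 * s + 1) (\<Union>\<X> \<union> ?S) ?S" using insert by simp
      have "td E (3 * s + 1) ((D \<union> ?S) \<union> (\<Union>\<X> \<union> ?S)) ?S"
      proof (rule td.attach[OF step[OF D] t])
        show "(D \<union> ?S) \<inter> (\<Union>\<X> \<union> ?S) \<subseteq> ?S \<inter> ?S" using i by blast
        show "no_cross E (D \<union> ?S) (\<Union>\<X> \<union> ?S)" unfolding no_cross_def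
        proof (intro ballI)
          fix x y assume xy: "x \<in> D \<union> ?S - (\<Union>\<X> \<union> ?S)" "y \<in> \<Union>\<X> \<union> ?S - (D \<union> ?S)"
          then have "x \<in> D" "y \<in> A - Z - D" using sub by auto
          then have "\<not> E x y" using D unfolding component_def touch_def by blast
          then show "\<not> E x y \<and> \<not> E y x" using assms(2) by (meson sympE)
        qed
      qed
      moreover have "(D \<union> ?S) \<union> (\<Union>\<X> \<union> ?S) = \<Union>(insert D \<X>) \<union> ?S" by blast
      ultimately show ?case by simp
    qed
    then have "td E (3 * s + 1) (\<Union>?\<D> \<union> ?S) ?S" using fD by blast
    moreover have "\<Union>?\<D> \<union> ?S = A"
    proof
      show "\<Union>?\<D> \<union> ?S \<subseteq> A" using U(2) Z(1) component_sub[of E "A - Z"] by blast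
      show "A \<subseteq> \<Union>?\<D> \<union> ?S"
      proof
        fix x assume x: "x \<in> A"
        show "x \<in> \<Union>?\<D> \<union> ?S"
        proof (cases "x \<in> Z")
          case False
          then obtain C where "component E (A - Z) C" "x \<in> C"
            using component_of_point[OF assms(2), of "A - Z" x] fA x by blast
          then show ?thesis by blast
        qed simp
      qed
    qed
    ultimately show ?thesis using U(1) by (intro exI[of _ ?S]) auto
  qed
qed

lemma td_minor_free:
  assumes "finite V" "symp E" "\<not> clique_minor E V h" "h * card V \<le> r * r" "r \<ge> 1"
  shows "\<exists>S. td E (3 * (h * r) + 1) V S"
proof -
  have "\<exists>Z\<subseteq>A. card Z \<le> h * r \<and> (\<forall>K. conn E K \<and> K \<subseteq> A - Z \<longrightarrow> 2 * card (K \<inter> W) \<le> card W)"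
    if "A \<subseteq> V" "W \<subseteq> A" for A W
  proof (rule balanced_separator[OF _ assms(2) _ _ assms(5) that(2)])
    show "finite A" using that(1) assms(1) finite_subset by blast
    show "\<not> clique_minor E A h" using assms(3) clique_minor_mono that(1) by blast
    have "h * card A \<le> h * card V" using that(1) assms(1) by (intro mult_le_mono2 card_mono)
    then show "h * card A \<le> r * r" using assms(4) by (rule le_trans)
  qed
  from td_of_separators[OF assms(1,2) this, of V "{}"] show ?thesis by auto
qed

section \<open>Hitting connected sets in graphs of bounded treewidth\<close>

text \<open>\<open>Y0\<close> is the part of the root bag \<open>S\<close> that has been deleted before. The set \<open>Y\<close> meets every connected set
  satisfying \<open>F\<close>, and its size is paid for by the packing \<open>\<P>\<close> of such sets. Only the components of
  \<open>A - Y\<close> that meet \<open>S\<close> can still grow; their neighbours in \<open>Y\<close> are kept inside \<open>Z \<union> Y0\<close>.\<close>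

definition hitting :: "('v \<Rightarrow> 'v \<Rightarrow> bool) \<Rightarrow> ('v set \<Rightarrow> bool) \<Rightarrow> nat \<Rightarrow> 'v set \<Rightarrow> 'v set \<Rightarrow> 'v set \<Rightarrow>
    'v set \<Rightarrow> 'v set \<Rightarrow> 'v set set \<Rightarrow> bool" where
  "hitting E F w A S Y0 Y Z \<P> \<longleftrightarrow>
     Y0 \<subseteq> Y \<and> Y \<subseteq> A \<and> finite Z \<and> card Z \<le> w \<and> S \<inter> Y \<subseteq> Z \<union> Y0 \<and> finite \<P> \<and>
     (\<forall>P\<in>\<P>. conn E P \<and> P \<subseteq> A - Y0 \<and> F P) \<and> (\<forall>P\<in>\<P>. \<forall>Q\<in>\<P>. P \<noteq> Q \<longrightarrow> P \<inter> Q = {}) \<and>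
     (\<P> = {} \<longrightarrow> Y = Y0) \<and> (\<P> \<noteq> {} \<longrightarrow> card (Y - Y0) + w \<le> 2 * w * card \<P>) \<and>
     (\<forall>C. conn E C \<and> C \<subseteq> A - Y \<longrightarrow> \<not> F C \<and> card (nbs E Y C) \<le> 2 * w \<and>
        (C \<inter> S \<noteq> {} \<longrightarrow> nbs E Y C \<subseteq> Z \<union> Y0 \<and> C \<inter> \<Union>\<P> = {}))"

lemma hittingD:
  assumes "hitting E F w A S Y0 Y Z \<P>"
  shows "Y0 \<subseteq> Y" "Y \<subseteq> A" "finite Z" "card Z \<le> w" "S \<inter> Y \<subseteq> Z \<union> Y0" "finite \<P>"
    "\<And>P. P \<in> \<P> \<Longrightarrow> conn E P \<and> P \<subseteq> A - Y0 \<and> F P"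
    "\<And>P Q. P \<in> \<P> \<Longrightarrow> Q \<in> \<P> \<Longrightarrow> P \<noteq> Q \<Longrightarrow> P \<inter> Q = {}"
    "\<P> = {} \<Longrightarrow> Y = Y0" "\<P> \<noteq> {} \<Longrightarrow> card (Y - Y0) + w \<le> 2 * w * card \<P>"
    "\<And>C. conn E C \<Longrightarrow> C \<subseteq> A - Y \<Longrightarrow> \<not> F C"
    "\<And>C. conn E C \<Longrightarrow> C \<subseteq> A - Y \<Longrightarrow> card (nbs E Y C) \<le> 2 * w"
    "\<And>C. conn E C \<Longrightarrow> C \<subseteq> A - Y \<Longrightarrow> C \<inter> S \<noteq> {} \<Longrightarrow> nbs E Y C \<subseteq> Z \<union> Y0"
    "\<And>C. conn E C \<Longrightarrow> C \<subseteq> A - Y \<Longrightarrow> C \<inter> S \<noteq> {} \<Longrightarrow> C \<inter> \<Union>\<P> = {}"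
  using assms unfolding hitting_def by simp_all

lemma card_subset_Un_le:
  assumes "N \<subseteq> Z \<union> S" "finite Z" "finite S" "card Z \<le> w" "card S \<le> w"
  shows "card N \<le> 2 * w"
proof -
  have "card N \<le> card (Z \<union> S)" using assms by (intro card_mono) auto
  also have "\<dots> \<le> card Z + card S" by (rule card_Un_le)
  finally show ?thesis using assms by simp
qed

text \<open>If \<open>D\<close> sees an undeleted vertex of \<open>S\<close>, adding it gives an
  undeleted connected set that meets the root, so its neighbours in \<open>Y\<close> lie in
  \<open>Z \<union> Y0\<close>; with \<open>S'\<close> this makes at most \<open>2 * w\<close>.
  Otherwise all neighbours are in \<open>Y\<close> and the old bound applies.\<close>

lemma hitting_closed_nbs:
  assumes "symp E" "hitting E F w A S Y0 Y Z \<P>" "S \<subseteq> A" "finite A" "Y0 \<subseteq> S'" "finite S'" "card S' \<le> w"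
    and D: "conn E D" "D \<subseteq> A - Y" and R: "\<And>y. y \<in> nbs E R D \<Longrightarrow> y \<in> Y \<or> y \<in> S' \<inter> S"
  shows "card (nbs E R D) \<le> 2 * w"
proof (cases "\<exists>y\<in>nbs E R D. y \<notin> Y")
  case True
  then obtain y c where y: "y \<notin> Y" "c \<in> D" "E c y" "y \<in> S' \<inter> S" using R unfolding nbs_def by blast
  have "conn E (insert y D)" using conn_insert[OF assms(1) D(1) y(2,3)] .
  moreover have "insert y D \<subseteq> A - Y" using D y assms(3) by blast
  ultimately have "nbs E Y (insert y D) \<subseteq> Z \<union> Y0" using hittingD(13)[OF assms(2)] y(4) by blast
  then have "nbs E R D \<subseteq> Z \<union> S'" using R assms(5) unfolding nbs_def by blast
  then show ?thesis using card_subset_Un_le hittingD(3,4)[OF assms(2)] assms(6,7) by metis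
next
  case False
  then have "nbs E R D \<subseteq> nbs E Y D" unfolding nbs_def by blast
  moreover have "finite (nbs E Y D)" using assms(4) hittingD(2)[OF assms(2)] finite_subset[of "nbs E Y D" A]
    unfolding nbs_def by blast
  ultimately have "card (nbs E R D) \<le> card (nbs E Y D)" by (intro card_mono)
  then show ?thesis using hittingD(12)[OF assms(2) D] by simp
qed

text \<open>\<open>B\<close> contributes no bad set away from \<open>S'\<close>. If an undeleted
  connected set satisfying \<open>F\<close> remains, it meets \<open>S'\<close>, hence avoids the
  packing and can join it; then all of \<open>S'\<close> is deleted. If none remains, only
  \<open>Y0\<close> is added.\<close>

lemma hitting_one_sided:
  assumes sym: "symp E" and H: "hitting E F w A S (Y0 \<inter> A) Y Z \<P>"
    and Y0: "Y0 \<subseteq> S'" and S': "S' \<subseteq> B" and SA: "S \<subseteq> A" and AB: "A \<inter> B \<subseteq> S \<inter> S'" and ns: "no_cross E A B"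
    and fin: "finite A" "finite B" and w: "card S' \<le> w"
    and hB: "\<And>C. conn E C \<Longrightarrow> C \<subseteq> B - (Y \<union> Y0) \<Longrightarrow> C \<inter> S' = {} \<Longrightarrow> \<not> F C"
  shows "\<exists>Y' Z' \<P>'. hitting E F w (A \<union> B) S' Y0 Y' Z' \<P>'"
proof -
  note H = hittingD[OF H] and Hitting = H
  let ?Y = "Y \<union> Y0"
  have fS': "finite S'" using S' fin(2) finite_subset by blast
  have sE: "E x y \<longleftrightarrow> E y x" for x y using sym by (meson sympE)
  have cross: "y \<in> B" if "c \<in> B" "c \<notin> A" "y \<in> A" "E c y" for c y
    using ns that unfolding no_cross_def by blast
  have cross': "y \<in> A" if "c \<in> A" "c \<notin> B" "y \<in> B" "E c y" for c y
    using ns that unfolding no_cross_def by blast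
  \<comment> \<open>Inside \<open>A\<close>, such a vertex \<open>c\<close> is still connected to
    the old root \<open>S\<close>, where the invariant for \<open>A\<close> applies.\<close>
  have K: "\<exists>K. conn E K \<and> K \<subseteq> C \<inter> A \<and> c \<in> K \<and> K \<inter> S \<noteq> {}"
    if C: "conn E C" "C \<subseteq> (A \<union> B) - ?Y" "c \<in> C" "c \<in> A" "C \<inter> S' \<noteq> {} \<or> \<not> C \<subseteq> A" for C c
  proof (cases "C \<subseteq> A")
    case True
    then have "C \<inter> S \<noteq> {}" using C(5) S' AB by blast
    then show ?thesis using C True by blast
  next
    case False
    have "finite (C \<inter> A)" using fin by blast
    then obtain K where K: "component E (C \<inter> A) K" "c \<in> K"
      using component_of_point[OF sym, of "C \<inter> A" c] C(3,4) by blast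
    have Ks: "K \<subseteq> C \<inter> A" using component_sub[OF K(1)] .
    then have "\<not> C \<subseteq> K" using False by blast
    then obtain k y where ky: "k \<in> C \<inter> K" "y \<in> C - K" "E k y" using connD[OF C(1,3) K(2)] by blast
    have "y \<notin> A" using K(1) ky unfolding component_def touch_def by blast
    then have "y \<in> B" using ky(2) C(2) by blast
    then have "k \<in> B" using cross[of y k] \<open>y \<notin> A\<close> ky Ks sE by blast
    then have "k \<in> S" using AB ky(1) Ks by blast
    then show ?thesis using component_conn[OF K(1)] Ks K(2) ky(1) by blast
  qed
  have splitC: "C \<subseteq> A - B \<or> C \<subseteq> B - A"
    if C: "conn E C" "C \<subseteq> (A \<union> B) - ?Y" "C \<inter> S' = {}" for C
  proof (cases "C \<subseteq> A")
    case True
    then show ?thesis using C(3) AB by blast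
  next
    case False
    show ?thesis
    proof (rule ccontr)
      assume "\<not> ?thesis"
      then obtain c where c: "c \<in> C" "c \<in> A" using C(2) False by blast
      then obtain x y where xy: "x \<in> C \<inter> A" "y \<in> C - A" "E x y" using connD[OF C(1), of c A] False by blast
      then have "x \<in> B" using cross[of y x] C(2) sE by blast
      then show False using xy AB C(3) by blast
    qed
  qed
  have act: "nbs E ?Y C \<subseteq> Z \<union> Y0" "C \<inter> \<Union>\<P> = {}"
    if C: "conn E C" "C \<subseteq> (A \<union> B) - ?Y" "C \<inter> S' \<noteq> {}" for C
  proof -
    show "nbs E ?Y C \<subseteq> Z \<union> Y0"
    proof
      fix y assume "y \<in> nbs E ?Y C"
      then obtain c where c: "c \<in> C" "E c y" "y \<in> ?Y" unfolding nbs_def by blast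
      show "y \<in> Z \<union> Y0"
      proof (cases "y \<in> Y0")
        case False
        then have y: "y \<in> Y" "y \<in> A" using c(3) H(2) by blast+
        show ?thesis
        proof (cases "c \<in> A")
          case True
          then obtain K where K: "conn E K" "K \<subseteq> C \<inter> A" "c \<in> K" "K \<inter> S \<noteq> {}" using K[OF C(1,2) c(1)] C(3) by blast
          have "K \<subseteq> A - Y" using K(2) C(2) by blast
          then have "nbs E Y K \<subseteq> Z \<union> Y0" using H(13)[OF K(1) _ K(4)] by blast
          then show ?thesis using y c K(3) unfolding nbs_def by blast
        next
          case False
          then have "y \<in> B" using cross[of c y] C(2) c y by blast
          then have "y \<in> S" using y AB by blast
          then show ?thesis using y H(5) by blast
        qed
      qed simp
    qed
    show "C \<inter> \<Union>\<P> = {}"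
    proof (rule ccontr)
      assume "C \<inter> \<Union>\<P> \<noteq> {}"
      then obtain c P where c: "c \<in> C" "P \<in> \<P>" "c \<in> P" by blast
      then have "c \<in> A" using H(7) by blast
      then obtain K where K: "conn E K" "K \<subseteq> C \<inter> A" "c \<in> K" "K \<inter> S \<noteq> {}" using K[OF C(1,2) c(1)] C(3) by blast
      have "K \<subseteq> A - Y" using K(2) C(2) by blast
      then have "K \<inter> \<Union>\<P> = {}" using H(14)[OF K(1) _ K(4)] by blast
      then show False using c K(3) by blast
    qed
  qed
  have nbB: "card (nbs E R C) \<le> 2 * w" if C: "C \<subseteq> B - A" "R \<subseteq> Y \<union> S'" for C R
  proof -
    have "nbs E R C \<subseteq> S'"
    proof
      fix y assume "y \<in> nbs E R C"
      then obtain c where c: "c \<in> C" "E c y" "y \<in> R" unfolding nbs_def by blast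
      show "y \<in> S'"
      proof (cases "y \<in> S'")
        case False
        then have "y \<in> A" using c C(2) H(2) by blast
        then have "y \<in> B" using cross[of c y] c C by blast
        then show ?thesis using \<open>y \<in> A\<close> AB by blast
      qed
    qed
    then have "card (nbs E R C) \<le> card S'" using fS' by (intro card_mono)
    then show ?thesis using w by simp
  qed
  have nbA: "card (nbs E R C) \<le> 2 * w" if C: "conn E C" "C \<subseteq> A - B" "C \<inter> Y = {}" "R \<subseteq> Y \<union> S'" for C R
  proof (rule hitting_closed_nbs[OF sym Hitting SA fin(1) _ fS' w C(1)])
    fix y assume "y \<in> nbs E R C"
    then obtain c where c: "c \<in> C" "E c y" "y \<in> R" unfolding nbs_def by blast
    show "y \<in> Y \<or> y \<in> S' \<inter> S"
    proof (cases "y \<in> Y")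
      case False
      then have "y \<in> S'" using c C by blast
      then have "y \<in> A" using cross'[of c y] c C S' by blast
      then show ?thesis using \<open>y \<in> S'\<close> AB S' by blast
    qed simp
  qed (use C Y0 in blast)+
  have nFout: "\<not> F C" if C: "conn E C" "C \<subseteq> (A \<union> B) - ?Y" "C \<inter> S' = {}" for C
    using splitC[OF C]
  proof
    assume "C \<subseteq> A - B"
    then show ?thesis using H(11)[OF C(1)] C(2) by blast
  next
    assume "C \<subseteq> B - A"
    then show ?thesis using hB[OF C(1) _ C(3)] C(2) by blast
  qed
  have Pout: "conn E P \<and> P \<subseteq> A \<union> B - Y0 \<and> F P" if "P \<in> \<P>" for P using H(7)[OF that] by blast
  have eqY: "?Y - Y0 = Y - (Y0 \<inter> A)" using H(2) by blast
  show ?thesis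
  proof (cases "\<exists>C. conn E C \<and> C \<subseteq> (A \<union> B) - ?Y \<and> F C")
    case False
    have "hitting E F w (A \<union> B) S' Y0 ?Y Z \<P>" unfolding hitting_def
    proof (intro conjI allI impI ballI)
      show "?Y \<subseteq> A \<union> B" using H(2) Y0 S' by blast
      show "S' \<inter> ?Y \<subseteq> Z \<union> Y0" using AB S' H(2,5) by blast
      show "?Y = Y0" if "\<P> = {}" using H(9)[OF that] by blast
      show "card (?Y - Y0) + w \<le> 2 * w * card \<P>" if "\<P> \<noteq> {}" using H(10)[OF that] eqY by simp
      fix C assume "conn E C \<and> C \<subseteq> A \<union> B - ?Y"
      then have C: "conn E C" "C \<subseteq> A \<union> B - ?Y" by blast+
      show "\<not> F C" using False C by blast
      show "nbs E ?Y C \<subseteq> Z \<union> Y0" "C \<inter> \<Union>\<P> = {}" if "C \<inter> S' \<noteq> {}" using act[OF C that] by blast+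
      show "card (nbs E ?Y C) \<le> 2 * w"
      proof (cases "C \<inter> S' = {}")
        case True
        have "?Y \<subseteq> Y \<union> S'" using Y0 by blast
        then show ?thesis using splitC[OF C True] nbA[OF C(1)] nbB C(2) by blast
      next
        case f: False
        then have "nbs E ?Y C \<subseteq> Z \<union> S'" using act(1)[OF C] Y0 by blast
        then show ?thesis using card_subset_Un_le H(3,4) fS' w by metis
      qed
    qed (use H Pout in auto)
    then show ?thesis by blast
  next
    case True
    then obtain C where C: "conn E C" "C \<subseteq> (A \<union> B) - ?Y" "F C" by blast
    have CS: "C \<inter> S' \<noteq> {}" using nFout C by blast
    have CP: "C \<inter> P = {}" if "P \<in> \<P>" for P using act(2)[OF C(1,2) CS] that by blast
    have Cne: "C \<noteq> {}" using conn_nonempty[OF C(1)] .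
    have CnP: "C \<notin> \<P>" using CP Cne by blast
    let ?Y' = "Y \<union> S'"
    have "hitting E F w (A \<union> B) S' Y0 ?Y' S' (insert C \<P>)" unfolding hitting_def
    proof (intro conjI allI impI ballI)
      show "Y0 \<subseteq> ?Y'" using Y0 by blast
      show "?Y' \<subseteq> A \<union> B" using H(2) S' by blast
      show "finite S'" "card S' \<le> w" using fS' w by auto
      show "finite (insert C \<P>)" using H(6) by simp
      show "conn E P" "P \<subseteq> A \<union> B - Y0" "F P" if "P \<in> insert C \<P>" for P
        using that Pout[of P] C by auto
      show "P \<inter> Q = {}" if "P \<in> insert C \<P>" "Q \<in> insert C \<P>" "P \<noteq> Q" for P Q
        using that H(8)[of P Q] CP[of P] CP[of Q] by auto
      \<comment> \<open>The new packed set pays \<open>2 * w\<close>: it covers \<open>S'\<close>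
        and, if it is the first one, also the reserve \<open>w\<close> of the invariant.\<close>
      show "card (?Y' - Y0) + w \<le> 2 * w * card (insert C \<P>)"
      proof -
        have "?Y' - Y0 \<subseteq> (Y - (Y0 \<inter> A)) \<union> S'" using H(2) by blast
        moreover have "finite (Y - (Y0 \<inter> A))" using H(2) fin finite_subset by blast
        ultimately have "card (?Y' - Y0) \<le> card ((Y - (Y0 \<inter> A)) \<union> S')" using fS' by (intro card_mono) auto
        also have "\<dots> \<le> card (Y - (Y0 \<inter> A)) + card S'" by (rule card_Un_le)
        finally have c1: "card (?Y' - Y0) \<le> card (Y - (Y0 \<inter> A)) + w" using w by simp
        have c2: "card (insert C \<P>) = Suc (card \<P>)" using CnP H(6) by simp
        show ?thesis
        proof (cases "\<P> = {}")
          case True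
          then show ?thesis using c1 c2 H(9) by simp
        next
          case False
          then show ?thesis using c1 c2 H(10) by simp
        qed
      qed
      fix D assume "conn E D \<and> D \<subseteq> A \<union> B - ?Y'"
      then have D: "conn E D" "D \<subseteq> A \<union> B - ?Y" "D \<inter> S' = {}" "D \<inter> Y = {}" using Y0 by blast+
      show "\<not> F D" using nFout D by blast
      show "card (nbs E ?Y' D) \<le> 2 * w"
        using splitC[OF D(1,2,3)] nbA[OF D(1) _ D(4)] nbB by blast
      show "nbs E ?Y' D \<subseteq> S' \<union> Y0" "D \<inter> \<Union>(insert C \<P>) = {}" if "D \<inter> S' \<noteq> {}" using D(3) that by blast+
    qed auto
    then show ?thesis by blast
  qed
qed

text \<open>Both packings are nonempty, so each side holds a reserve of \<open>w\<close>. The union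
  has to keep only one of them; the other pays for deleting all of \<open>S\<close>.\<close>

lemma hitting_two_sided:
  assumes sym: "symp E" and H1: "hitting E F w A S Y0 Y1 Z1 \<P>1" and H2: "hitting E F w B S (S \<inter> Y1) Y2 Z2 \<P>2"
    and Y0: "Y0 \<subseteq> S" and AB: "A \<inter> B = S" and ns: "no_cross E A B"
    and fin: "finite A" "finite B" and w: "card S \<le> w" and ne: "\<P>1 \<noteq> {}" "\<P>2 \<noteq> {}"
  shows "\<exists>Y Z \<P>. hitting E F w (A \<union> B) S Y0 Y Z \<P>"
proof -
  note G1 = hittingD[OF H1] and G2 = hittingD[OF H2]
  have fS: "finite S" using AB fin by blast
  have sE: "E x y \<longleftrightarrow> E y x" for x y using sym by (meson sympE)
  let ?Y = "Y1 \<union> Y2 \<union> S"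
  \<comment> \<open>A common vertex would be in \<open>S\<close> and undeleted; alone it is a
    connected set meeting the root, and such sets avoid \<open>\<P>1\<close>.\<close>
  have PP: "P \<inter> Q = {}" if "P \<in> \<P>1" "Q \<in> \<P>2" for P Q
  proof (rule ccontr)
    assume "P \<inter> Q \<noteq> {}"
    then obtain x where x: "x \<in> P" "x \<in> Q" by blast
    then have xs: "x \<in> S" "x \<notin> Y1" using G1(7)[OF that(1)] G2(7)[OF that(2)] AB by blast+
    then have "{x} \<inter> \<Union>\<P>1 = {}" using G1(14)[OF conn_singleton[of E x]] AB by blast
    then show False using x(1) that(1) by blast
  qed
  have disj: "\<P>1 \<inter> \<P>2 = {}"
  proof (rule ccontr)
    assume "\<P>1 \<inter> \<P>2 \<noteq> {}"
    then obtain P where P: "P \<in> \<P>1" "P \<in> \<P>2" by blast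
    then have "P = {}" using PP[OF P] by blast
    then show False using G1(7)[OF P(1)] conn_nonempty by blast
  qed
  have splitC: "C \<subseteq> A - B \<or> C \<subseteq> B - A" if C: "conn E C" "C \<subseteq> (A \<union> B) - S" for C
  proof (rule ccontr)
    assume n: "\<not> ?thesis"
    then obtain c where c: "c \<in> C" "c \<in> A" using C(2) by blast
    have "\<not> C \<subseteq> A" using n C(2) AB by blast
    then obtain x y where xy: "x \<in> C \<inter> A" "y \<in> C - A" "E x y" using connD[OF C(1) c] by blast
    then have "x \<notin> B" "y \<in> B" using C(2) AB by blast+
    then show False using xy ns unfolding no_cross_def by blast
  qed
  have "hitting E F w (A \<union> B) S Y0 ?Y S (\<P>1 \<union> \<P>2)" unfolding hitting_def
  proof (intro conjI allI impI ballI)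
    show "Y0 \<subseteq> ?Y" using Y0 by blast
    show "?Y \<subseteq> A \<union> B" using G1(2) G2(2) AB by blast
    show "finite (\<P>1 \<union> \<P>2)" using G1(6) G2(6) by simp
    show "conn E P" "P \<subseteq> A \<union> B - Y0" "F P" if "P \<in> \<P>1 \<union> \<P>2" for P
    proof -
      have "conn E P \<and> P \<subseteq> A \<union> B - Y0 \<and> F P"
      proof (cases "P \<in> \<P>1")
        case True
        then show ?thesis using G1(7) by blast
      next
        case False
        then have "conn E P \<and> P \<subseteq> B - (S \<inter> Y1) \<and> F P" using G2(7) that by blast
        then show ?thesis using Y0 G1(1) by blast
      qed
      then show "conn E P" "P \<subseteq> A \<union> B - Y0" "F P" by blast+
    qed
    show "P \<inter> Q = {}" if "P \<in> \<P>1 \<union> \<P>2" "Q \<in> \<P>1 \<union> \<P>2" "P \<noteq> Q" for P Q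
      using that(1,2) G1(8)[of P Q] G2(8)[of P Q] PP[of P Q] PP[of Q P] that(3) by auto
    show "?Y = Y0" if "\<P>1 \<union> \<P>2 = {}" using that ne by blast
    show "card (?Y - Y0) + w \<le> 2 * w * card (\<P>1 \<union> \<P>2)"
    proof -
      have f: "finite Y1" "finite Y2" using G1(2) G2(2) fin finite_subset by blast+
      have "?Y - Y0 \<subseteq> (Y1 - Y0) \<union> (Y2 - (S \<inter> Y1)) \<union> S" by blast
      then have "card (?Y - Y0) \<le> card ((Y1 - Y0) \<union> (Y2 - (S \<inter> Y1)) \<union> S)"
        using f fS by (intro card_mono) auto
      also have "\<dots> \<le> card (Y1 - Y0) + card (Y2 - (S \<inter> Y1)) + card S"
        using card_Un_le[of "(Y1 - Y0) \<union> (Y2 - (S \<inter> Y1))" S] card_Un_le[of "Y1 - Y0" "Y2 - (S \<inter> Y1)"] by linarith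
      finally have "card (?Y - Y0) + w \<le> 2 * w * card \<P>1 + 2 * w * card \<P>2"
        using G1(10)[OF ne(1)] G2(10)[OF ne(2)] w by linarith
      then show ?thesis using card_Un_disjoint[OF G1(6) G2(6) disj] by (simp add: distrib_left)
    qed
    fix D assume "conn E D \<and> D \<subseteq> A \<union> B - ?Y"
    then have D: "conn E D" "D \<subseteq> A \<union> B - S" "D \<inter> Y1 = {}" "D \<inter> Y2 = {}" by blast+
    have "\<not> F D \<and> card (nbs E ?Y D) \<le> 2 * w"
      using splitC[OF D(1,2)]
    proof
      assume d: "D \<subseteq> A - B"
      then have dA: "D \<subseteq> A - Y1" using D(3) by blast
      have "card (nbs E ?Y D) \<le> 2 * w"
      proof (rule hitting_closed_nbs[OF sym H1 _ fin(1) Y0 fS w D(1) dA])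
        show "S \<subseteq> A" using AB by blast
        fix y assume "y \<in> nbs E ?Y D"
        then obtain c where c: "c \<in> D" "E c y" "y \<in> ?Y" unfolding nbs_def by blast
        show "y \<in> Y1 \<or> y \<in> S \<inter> S"
        proof (cases "y \<in> A")
          case True
          then show ?thesis using c(3) G2(2) AB by blast
        next
          case False
          then have "y \<in> B" using c(3) G1(2) G2(2) AB by blast
          then show ?thesis using ns c(1,2) d False unfolding no_cross_def by blast
        qed
      qed
      then show ?thesis using G1(11)[OF D(1) dA] by blast
    next
      assume d: "D \<subseteq> B - A"
      then have dB: "D \<subseteq> B - Y2" using D(4) by blast
      have "card (nbs E ?Y D) \<le> 2 * w"
      proof (rule hitting_closed_nbs[OF sym H2 _ fin(2) _ fS w D(1) dB])
        show "S \<subseteq> B" using AB by blast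
        fix y assume "y \<in> nbs E ?Y D"
        then obtain c where c: "c \<in> D" "E c y" "y \<in> ?Y" unfolding nbs_def by blast
        show "y \<in> Y2 \<or> y \<in> S \<inter> S"
        proof (cases "y \<in> B")
          case True
          then show ?thesis using c(3) G1(2) AB by blast
        next
          case False
          then have "y \<in> A" using c(3) G1(2) G2(2) AB by blast
          then show ?thesis using ns c(1,2) d False unfolding no_cross_def by blast
        qed
      qed blast
      then show ?thesis using G2(11)[OF D(1) dB] by blast
    qed
    then show "\<not> F D" "card (nbs E ?Y D) \<le> 2 * w" by blast+
    show "nbs E ?Y D \<subseteq> S \<union> Y0" "D \<inter> \<Union>(\<P>1 \<union> \<P>2) = {}" if "D \<inter> S \<noteq> {}" using D(2) that by blast+
  qed (use fS w in auto)
  then show ?thesis by blast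
qed

text \<open>\<open>Y0\<close> is quantified because at a join the second side starts with the part
  of \<open>S\<close> that the first has deleted. A side with empty packing has deleted nothing
  further and leaves no bad set, so the one-sided step adds it to the other; two nonempty packings
  have the reserves for deleting the root bag.\<close>

lemma hitting_exists:
  assumes "td E w A S" "symp E"
  shows "\<forall>Y0\<subseteq>S. \<exists>Y Z \<P>. hitting E F w A S Y0 Y Z \<P>"
  using assms(1)
proof (induction rule: td_induct)
  case (leaf S)
  show ?case
  proof (intro allI impI)
    fix Y0 assume Y0: "Y0 \<subseteq> S"
    \<comment> \<open>A leaf is the one-sided step from the empty decomposition.\<close>
    have H: "hitting E F w {} {} (Y0 \<inter> {}) {} {} {}"
      unfolding hitting_def using conn_nonempty by auto
    have "\<exists>Y Z \<P>. hitting E F w ({} \<union> S) S Y0 Y Z \<P>"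
    proof (rule hitting_one_sided[OF assms(2) H Y0 order_refl])
      show "\<not> F C" if "conn E C" "C \<subseteq> S - ({} \<union> Y0)" "C \<inter> S = {}" for C
        using that conn_nonempty by blast
    qed (use leaf in \<open>auto simp: no_cross_def\<close>)
    then show "\<exists>Y Z \<P>. hitting E F w S S Y0 Y Z \<P>" by simp
  qed
next
  case (extend A S S')
  have r: "S \<subseteq> A" "finite A" using td_root[OF extend.hyps(1)] by auto
  show ?case
  proof (intro allI impI)
    fix Y0 assume Y0: "Y0 \<subseteq> S'"
    have "Y0 \<inter> A \<subseteq> S" using Y0 extend.hyps(4) by blast
    then obtain Y Z \<P> where H: "hitting E F w A S (Y0 \<inter> A) Y Z \<P>" using extend.IH by blast
    show "\<exists>Y Z \<P>. hitting E F w (A \<union> S') S' Y0 Y Z \<P>"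
    proof (rule hitting_one_sided[OF assms(2) H Y0 order_refl r(1) _ extend.hyps(5) r(2) extend.hyps(2,3)])
      show "\<not> F C" if "conn E C" "C \<subseteq> S' - (Y \<union> Y0)" "C \<inter> S' = {}" for C
        using that conn_nonempty by blast
    qed (use extend.hyps(4) in blast)
  qed
next
  case (join A B S)
  have r: "S \<subseteq> A" "S \<subseteq> B" "finite A" "finite B" "card S \<le> w" using td_root[OF join.hyps(1)] td_root[OF join.hyps(2)] by auto
  show ?case
  proof (intro allI impI)
    fix Y0 assume Y0: "Y0 \<subseteq> S"
    obtain Y1 Z1 \<P>1 where H1: "hitting E F w A S Y0 Y1 Z1 \<P>1" using join.IH(1) Y0 by blast
    have "S \<inter> Y1 \<subseteq> S" by blast
    then obtain Y2 Z2 \<P>2 where H2: "hitting E F w B S (S \<inter> Y1) Y2 Z2 \<P>2" using join.IH(2) by blast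
    consider "\<P>2 = {}" | "\<P>1 = {}" | "\<P>1 \<noteq> {}" "\<P>2 \<noteq> {}" by blast
    then show "\<exists>Y Z \<P>. hitting E F w (A \<union> B) S Y0 Y Z \<P>"
    proof cases
      case 1
      have Y2: "Y2 = S \<inter> Y1" using hittingD(9)[OF H2 1] .
      have e: "Y0 \<inter> A = Y0" using Y0 r by blast
      show ?thesis
      proof (rule hitting_one_sided[OF assms(2) _ Y0 r(2,1) _ join.hyps(4) r(3,4,5)])
        show "hitting E F w A S (Y0 \<inter> A) Y1 Z1 \<P>1" using H1 e by simp
        show "\<not> F C" if C: "conn E C" "C \<subseteq> B - (Y1 \<union> Y0)" for C
          by (rule hittingD(11)[OF H2 C(1)]) (use C(2) Y2 in blast)
      qed (use join.hyps(3) in blast)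
    next
      case 2
      have Y1: "Y1 = Y0" using hittingD(9)[OF H1 2] .
      have e: "S \<inter> Y1 = Y0 \<inter> B" using Y0 r Y1 by blast
      have "\<exists>Y Z \<P>. hitting E F w (B \<union> A) S Y0 Y Z \<P>"
      proof (rule hitting_one_sided[OF assms(2) _ Y0 r(1,2) _ no_cross_sym[OF join.hyps(4)] r(4,3,5)])
        show "hitting E F w B S (Y0 \<inter> B) Y2 Z2 \<P>2" using H2 e by simp
        show "\<not> F C" if C: "conn E C" "C \<subseteq> A - (Y2 \<union> Y0)" for C
          by (rule hittingD(11)[OF H1 C(1)]) (use C(2) Y1 in blast)
      qed (use join.hyps(3) in blast)
      then show ?thesis by (simp add: Un_commute)
    next
      case 3
      show ?thesis by (rule hitting_two_sided[OF assms(2) H1 H2 Y0 join.hyps(3,4) r(3,4,5) 3])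
    qed
  qed
qed

section \<open>Sublinear treewidth for graphs without a large clique minor\<close>

text \<open>After deleting \<open>X' = X \<union> Y\<close> a component has fewer than
  \<open>h\<close> neighbours in \<open>X\<close> and at most \<open>2 * w\<close> in
  \<open>Y\<close>. Only the components assigned a pair are contracted, so the minor has at most
  \<open>(1 + 2 ^ h) * card X'\<close> vertices. Substituting neighbourhoods for the contracted
  vertices gives a decomposition of \<open>X'\<close> that tolerates cliques on all component
  neighbourhoods, and each component is hung on its clique with its old decomposition.\<close>

lemma td_minor_free_deletion:
  assumes fin: "finite V" and sym: "symp E" and nm: "\<not> clique_minor E V h" and XV: "X \<subseteq> V"
    and t: "td E w (V - X) S" and r: "r \<ge> 1" "h * ((1 + 2 ^ h) * ((1 + 2 * w * 2 ^ h) * card X)) \<le> r * r"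
  shows "\<exists>S'. td E ((3 * (h * r) + 1) * (2 * w + h + 1) + (3 * w + h)) V S'"
proof -
  define F where "F = (\<lambda>C. h \<le> card (nbs E X C))"
  have fX: "finite X" using XV fin finite_subset by blast
  have sE: "E x y \<longleftrightarrow> E y x" for x y using sym by (meson sympE)
  obtain Y Z \<P> where H: "hitting E F w (V - X) S {} Y Z \<P>"
    using hitting_exists[OF t sym, of F] by blast
  note H = hittingD[OF H]
  have "card \<P> \<le> 2 ^ h * card X"
    by (rule packing_bound[OF fX H(6) sym nm XV]) (use H(7,8) in \<open>auto simp: F_def\<close>)
  then have "2 * w * card \<P> \<le> 2 * w * (2 ^ h * card X)" by (rule mult_le_mono2)
  moreover have "card Y \<le> 2 * w * card \<P>" using H(9,10) by (cases "\<P> = {}") auto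
  ultimately have cY: "card Y \<le> 2 * w * (2 ^ h * card X)" by linarith
  define X' where "X' = X \<union> Y"
  have X'V: "X' \<subseteq> V" using XV H(2) unfolding X'_def by blast
  have fX': "finite X'" using X'V fin finite_subset by blast
  have cX': "card X' \<le> (1 + 2 * w * 2 ^ h) * card X"
    using card_Un_le[of X Y] cY unfolding X'_def by (simp add: algebra_simps)
  define \<C> where "\<C> = {C. component E (V - X') C}"
  have C: "component E (V - X') C" if "C \<in> \<C>" for C using that unfolding \<C>_def by simp
  have Cs: "C \<subseteq> V - X'" if "C \<in> \<C>" for C using component_sub[OF C[OF that]] .
  have Cc: "conn E C" if "C \<in> \<C>" for C using component_conn[OF C[OF that]] .
  have "\<C> \<subseteq> Pow V" using Cs by blast
  then have fC: "finite \<C>" using fin finite_subset by blast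
  have Cd: "C \<inter> D = {}" if "C \<in> \<C>" "D \<in> \<C>" "C \<noteq> D" for C D
    using component_eq[OF C[OF that(1)] C[OF that(2)]] that(3) by blast
  have nbC: "card (nbs E X' C) \<le> 2 * w + h" if "C \<in> \<C>" for C
  proof -
    have s: "C \<subseteq> (V - X) - Y" using Cs[OF that] unfolding X'_def by blast
    have "nbs E X' C = nbs E X C \<union> nbs E Y C" unfolding X'_def nbs_def by blast
    then have "card (nbs E X' C) \<le> card (nbs E X C) + card (nbs E Y C)" by (simp add: card_Un_le)
    then show ?thesis using H(11)[OF Cc[OF that] s] H(12)[OF Cc[OF that] s] unfolding F_def by simp
  qed
  have CX: "conn E C \<and> C \<subseteq> V - X'" if "C \<in> \<C>" for C using Cs[OF that] Cc[OF that] by blast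
  show ?thesis
  proof (rule assign_pairs[OF fX' fC sym nm X'V])
    show "\<And>C. C \<in> \<C> \<Longrightarrow> conn E C \<and> C \<subseteq> V - X'" by (rule CX)
    show "\<And>C D. C \<in> \<C> \<Longrightarrow> D \<in> \<C> \<Longrightarrow> C \<noteq> D \<Longrightarrow> C \<inter> D = {}" by (rule Cd)
    fix \<A> M
    assume A: "\<A> \<subseteq> \<C>" "card \<A> \<le> 2 ^ h * card X'"
      and M1: "\<And>x y. M x y \<Longrightarrow> \<exists>A\<in>\<A>. x \<in> nbs E X' A \<and> y \<in> nbs E X' A"
      and M2: "\<And>C x y. C \<in> \<C> - \<A> \<Longrightarrow> x \<in> nbs E X' C \<Longrightarrow> y \<in> nbs E X' C \<Longrightarrow> x \<noteq> y \<Longrightarrow> M x y"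
    have AC: "A \<in> \<C>" if "A \<in> \<A>" for A using A(1) that by blast
    have fA: "finite \<A>" using A(1) fC finite_subset by blast
    \<comment> \<open>A contracted component is represented by one of its own vertices, so the minor
      keeps the vertex type and the representatives are outside \<open>X'\<close>.\<close>
    define rep where "rep = (\<lambda>C :: 'a set. SOME x. x \<in> C)"
    have rep: "rep C \<in> C" if "C \<in> \<C>" for C
      using conn_nonempty[OF Cc[OF that]] unfolding rep_def by (simp add: some_in_eq)
    define bl where "bl = (\<lambda>x. if x \<in> X' then {x} else \<Union>{C\<in>\<A>. x \<in> C})"
    have blX: "bl x = {x}" if "x \<in> X'" for x using that unfolding bl_def by simp
    have repX: "rep C \<notin> X'" if "C \<in> \<C>" for C using rep[OF that] Cs[OF that] by blast
    have blr: "bl (rep C) = C" if "C \<in> \<A>" for C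
    proof -
      have "{D\<in>\<A>. rep C \<in> D} = {C}" using rep[OF AC[OF that]] Cd[OF AC[OF that]] AC that by blast
      then show ?thesis using repX[OF AC[OF that]] unfolding bl_def by simp
    qed
    define U where "U = X' \<union> rep ` \<A>"
    define E2 where "E2 = (\<lambda>x y. (x \<in> X' \<and> y \<in> X' \<and> E x y) \<or>
       (\<exists>C\<in>\<A>. (x = rep C \<and> y \<in> nbs E X' C) \<or> (y = rep C \<and> x \<in> nbs E X' C)))"
    have sym2: "symp E2" unfolding E2_def by (rule sympI) (use sE in blast)
    have fU: "finite U" unfolding U_def using fX' fA by simp
    have nb_touch: "touch E C {x} \<and> touch E {x} C" if "x \<in> nbs E X' C" for x C
      using that sE unfolding nbs_def touch_def by blast
    have nm2: "\<not> clique_minor E2 U h"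
    proof
      assume "clique_minor E2 U h"
      then have "clique_minor E V h"
      proof (rule clique_minor_lift[OF _ sym, where bl = bl])
        show "conn E (bl x) \<and> bl x \<subseteq> V" if xU: "x \<in> U" for x
        proof (cases "x \<in> X'")
          case True
          then show ?thesis using blX[OF True] conn_singleton[of E x] X'V by auto
        next
          case False
          then obtain C where "C \<in> \<A>" "x = rep C" using xU unfolding U_def by blast
          then show ?thesis using CX[OF AC] blr by auto
        qed
        show "bl x \<inter> bl y = {}" if xy: "x \<in> U" "y \<in> U" "x \<noteq> y" for x y
        proof (cases "x \<in> X'")
          case x: True
          show ?thesis
          proof (cases "y \<in> X'")
            case True
            then show ?thesis using x xy blX by simp
          next
            case False
            then obtain C where c: "C \<in> \<A>" "y = rep C" using xy(2) unfolding U_def by blast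
            then show ?thesis using blX[OF x] blr[OF c(1)] Cs[OF AC[OF c(1)]] x by auto
          qed
        next
          case False
          then obtain C where c: "C \<in> \<A>" "x = rep C" using xy(1) unfolding U_def by blast
          show ?thesis
          proof (cases "y \<in> X'")
            case True
            then show ?thesis using blX[OF True] blr[OF c(1)] c(2) Cs[OF AC[OF c(1)]] by auto
          next
            case False
            then obtain D where d: "D \<in> \<A>" "y = rep D" using xy(2) unfolding U_def by blast
            then have "C \<noteq> D" using c xy(3) by blast
            then show ?thesis using blr c d Cd[OF AC AC] by simp
          qed
        qed
        show "touch E (bl x) (bl y)" if xy: "x \<in> U" "y \<in> U" "E2 x y" for x y
        proof -
          consider "x \<in> X'" "y \<in> X'" "E x y" | C where "C \<in> \<A>" "x = rep C" "y \<in> nbs E X' C"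
            | C where "C \<in> \<A>" "y = rep C" "x \<in> nbs E X' C" using xy(3) unfolding E2_def by blast
          then show ?thesis
          proof cases
            case 1
            then show ?thesis using blX by (simp add: touch_def)
          next
            case 2
            then have "y \<in> X'" unfolding nbs_def by blast
            then show ?thesis using 2 blX blr nb_touch by simp
          next
            case 3
            then have "x \<in> X'" unfolding nbs_def by blast
            then show ?thesis using 3 blX blr nb_touch by simp
          qed
        qed
      qed
      then show False using nm by blast
    qed
    have cU: "card U \<le> (1 + 2 ^ h) * ((1 + 2 * w * 2 ^ h) * card X)"
    proof -
      have "card U \<le> card X' + card \<A>"
        using card_Un_le[of X' "rep ` \<A>"] card_image_le[OF fA, of rep] unfolding U_def by simp
      also have "\<dots> \<le> (1 + 2 ^ h) * card X'" using A(2) by simp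
      also have "\<dots> \<le> (1 + 2 ^ h) * ((1 + 2 * w * 2 ^ h) * card X)" using cX' by (rule mult_le_mono2)
      finally show ?thesis .
    qed
    have "h * card U \<le> h * ((1 + 2 ^ h) * ((1 + 2 * w * 2 ^ h) * card X))" using cU by (rule mult_le_mono2)
    then have "h * card U \<le> r * r" using r(2) by (rule le_trans)
    then obtain S2 where t2: "td E2 (3 * (h * r) + 1) U S2"
      using td_minor_free[OF fU sym2 nm2 _ r(1)] by blast
    \<comment> \<open>\<open>G\<close> joins all neighbours of each contracted component;
      \<open>G'\<close> is its part on \<open>X'\<close>, the torso to be decomposed.\<close>
    define G where "G = (\<lambda>x y. E x y \<or> (\<exists>A\<in>\<A>. x \<in> nbs E X' A \<and> y \<in> nbs E X' A))"
    define G' where "G' = (\<lambda>x y. x \<in> X' \<and> y \<in> X' \<and> G x y)"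
    \<comment> \<open>A representative contributes itself and at most \<open>2 * w + h\<close>
      neighbours, hence the factor \<open>2 * w + h + 1\<close>; intersecting with \<open>X'\<close>
      later discards the representatives.\<close>
    define \<phi> where "\<phi> = (\<lambda>x. if x \<in> X' then {x} else insert x (nbs E X' (bl x)))"
    have "td G' ((3 * (h * r) + 1) * (2 * w + h + 1)) (\<Union>x\<in>U. \<phi> x) (\<Union>x\<in>S2. \<phi> x)"
    proof (rule td_subst[OF t2 sym2 fU order_refl])
      show "x \<in> \<phi> x \<and> \<phi> x \<subseteq> insert x {y \<in> U. E2 x y} \<and> card (\<phi> x) \<le> 2 * w + h + 1" if xU: "x \<in> U" for x
      proof (cases "x \<in> X'")
        case True
        then show ?thesis unfolding \<phi>_def by simp
      next
        case False
        then obtain C where c: "C \<in> \<A>" "x = rep C" using xU unfolding U_def by blast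
        then have p: "\<phi> x = insert x (nbs E X' C)" using False blr unfolding \<phi>_def by simp
        have "nbs E X' C \<subseteq> {y \<in> U. E2 x y}" using c unfolding U_def E2_def nbs_def by blast
        moreover have "card (insert x (nbs E X' C)) \<le> Suc (card (nbs E X' C))" by (rule card_insert_le_m1) auto
        ultimately show ?thesis using nbC[OF AC[OF c(1)]] p by auto
      qed
      show "E2 x y \<or> (\<exists>z\<in>U. x \<in> \<phi> z \<and> y \<in> \<phi> z)" if g: "G' x y" for x y
      proof -
        have xy: "x \<in> X'" "y \<in> X'" "G x y" using g unfolding G'_def by blast+
        then consider "E x y" | A where "A \<in> \<A>" "x \<in> nbs E X' A" "y \<in> nbs E X' A" unfolding G_def by blast
        then show ?thesis
        proof cases
          case 1
          then show ?thesis using xy unfolding E2_def by blast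
        next
          case 2
          then have "rep A \<in> U" "x \<in> \<phi> (rep A)" "y \<in> \<phi> (rep A)"
            using blr repX[OF AC] unfolding U_def \<phi>_def by auto
          then show ?thesis by blast
        qed
      qed
    qed blast
    then have "td G' ((3 * (h * r) + 1) * (2 * w + h + 1)) ((\<Union>x\<in>U. \<phi> x) \<inter> X') ((\<Union>x\<in>S2. \<phi> x) \<inter> X')"
      by (rule td_Int)
    moreover have "(\<Union>x\<in>U. \<phi> x) \<inter> X' = X'"
    proof -
      have "x \<in> \<phi> x \<and> x \<in> U" if "x \<in> X'" for x using that unfolding \<phi>_def U_def by simp
      then show ?thesis by blast
    qed
    ultimately obtain S3 where t3: "td G' ((3 * (h * r) + 1) * (2 * w + h + 1)) X' S3" by auto
    \<comment> \<open>The sum bounds both kinds of bags: those over \<open>X'\<close>, and those of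
      a component, with up to \<open>w\<close> vertices of its own and \<open>2 * w + h\<close>
      neighbours.\<close>
    let ?W = "(3 * (h * r) + 1) * (2 * w + h + 1) + (3 * w + h)"
    have t4: "td G ?W X' S3" by (rule td_mono[OF t3]) (auto simp: G'_def)
    have GE: "E x y" if "G x y \<or> G y x" "x \<notin> X'" for x y
      using that sE unfolding G_def nbs_def by blast
    have "td G ?W (X' \<union> (\<Union>C\<in>\<C>. C)) S3"
    proof (rule td_attach_cliques[OF fC t4, where K = "nbs E X'"])
      fix C assume c: "C \<in> \<C>"
      have "td E w ((V - X) \<inter> C) (S \<inter> C)" by (rule td_Int[OF t])
      moreover have "(V - X) \<inter> C = C" using Cs[OF c] unfolding X'_def by blast
      ultimately have "td E w C (S \<inter> C)" by simp
      then have "td G w C (S \<inter> C)" by (rule td_mono) (use GE Cs[OF c] in auto)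
      moreover have fn: "finite (nbs E X' C)" using fX' unfolding nbs_def by simp
      ultimately have "td G (w + card (nbs E X' C)) (C \<union> nbs E X' C) (S \<inter> C \<union> nbs E X' C)" by (rule td_add)
      then have "td G ?W (C \<union> nbs E X' C) (S \<inter> C \<union> nbs E X' C)"
        by (rule td_mono) (use nbC[OF c] in auto)
      then show "\<exists>R. nbs E X' C \<subseteq> R \<and> td G ?W (C \<union> nbs E X' C) R" by blast
      show "nbs E X' C \<subseteq> X'" unfolding nbs_def by blast
      show "C \<inter> X' = {}" using Cs[OF c] by blast
      \<comment> \<open>If \<open>C\<close> is not in \<open>\<A>\<close>, the pair is an edge of
        \<open>M\<close> and so lies in the neighbourhood of some member of \<open>\<A>\<close>; if
        \<open>C\<close> is in \<open>\<A>\<close>, it serves itself.\<close>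
      show "G x y" if "x \<in> nbs E X' C" "y \<in> nbs E X' C" "x \<noteq> y" for x y
        using M2[of C x y] M1[of x y] c that unfolding G_def by blast
      show "C \<inter> D = {}" if "D \<in> \<C>" "C \<noteq> D" for D using Cd c that by blast
      show "y \<in> C \<union> nbs E X' C" if xy: "x \<in> C" "y \<in> X' \<union> (\<Union>C\<in>\<C>. C)" "G x y \<or> G y x" for x y
      proof -
        have e: "E x y" using GE[OF xy(3)] xy(1) Cs[OF c] by blast
        show ?thesis
        proof (cases "y \<in> X'")
          case True
          then show ?thesis using e xy(1) unfolding nbs_def by blast
        next
          case False
          then obtain D where "D \<in> \<C>" "y \<in> D" using xy(2) by blast
          then have "y \<in> V - X'" using Cs by blast
          then show ?thesis using C[OF c] e xy(1) unfolding component_def touch_def by blast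
        qed
      qed
    qed
    moreover have "X' \<union> (\<Union>C\<in>\<C>. C) = V"
    proof
      show "X' \<union> (\<Union>C\<in>\<C>. C) \<subseteq> V" using X'V Cs by blast
      show "V \<subseteq> X' \<union> (\<Union>C\<in>\<C>. C)"
      proof
        fix x assume x: "x \<in> V"
        show "x \<in> X' \<union> (\<Union>C\<in>\<C>. C)"
        proof (cases "x \<in> X'")
          case False
          then obtain C where "component E (V - X') C" "x \<in> C"
            using component_of_point[OF sym, of "V - X'" x] fin x by blast
          then show ?thesis unfolding \<C>_def by blast
        qed simp
      qed
    qed
    ultimately have "td G ?W V S3" by simp
    then have "td E ?W V S3" by (rule td_mono) (auto simp: G_def)
    then show ?thesis by blast
  qed
qed

section \<open>A topological form of the nonplanarity of \<open>K\<^sub>3\<^sub>,\<^sub>3\<close>\<close>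

text \<open>Degenerate arcs are allowed, because a leg of a tripod shrinks to a point when its end
  is the centre.\<close>

definition arc_between :: "complex set \<Rightarrow> complex \<Rightarrow> complex \<Rightarrow> bool" where
  "arc_between S x y \<longleftrightarrow> (x = y \<and> S = {x}) \<or>
     (\<exists>g. Path_Connected.arc g \<and> path_image g = S \<and> pathstart g = x \<and> pathfinish g = y)"

lemma arc_between_refl: "arc_between {x} x x"
  unfolding arc_between_def by simp

lemma arc_betweenD:
  assumes "arc_between S x y"
  shows "x \<in> S" "y \<in> S" "compact S" "Topological_Spaces.connected S"
proof -
  have "x \<in> S \<and> y \<in> S \<and> compact S \<and> Topological_Spaces.connected S"
    using assms unfolding arc_between_def
    by (auto simp: compact_arc_image connected_arc_image)
  then show "x \<in> S" "y \<in> S" "compact S" "Topological_Spaces.connected S" by auto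
qed

lemma arc_between_neq:
  assumes "arc_between S x y" "x \<noteq> y"
  obtains g where "Path_Connected.arc g" "path_image g = S" "pathstart g = x" "pathfinish g = y"
  using assms unfolding arc_between_def by blast

lemma arc_between_sym: "arc_between S x y \<Longrightarrow> arc_between S y x"
  unfolding arc_between_def by (metis arc_reversepath path_image_reversepath pathfinish_reversepath pathstart_reversepath)

lemma arc_between_join:
  assumes "arc_between S x y" "arc_between T y z" "S \<inter> T \<subseteq> {y}"
  shows "arc_between (S \<union> T) x z"
proof (cases "x = y \<or> y = z")
  case True
  then show ?thesis
  proof
    assume e: "x = y"
    show ?thesis
    proof (cases "S = {x}")
      case True
      then have "S \<union> T = T" using arc_betweenD(1)[OF assms(2)] e by blast
      then show ?thesis using assms(2) e by simp
    next
      case False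
      then show ?thesis using assms(1) e unfolding arc_between_def by (metis arc_distinct_ends)
    qed
  next
    assume e: "y = z"
    show ?thesis
    proof (cases "T = {y}")
      case True
      then have "S \<union> T = S" using arc_betweenD(2)[OF assms(1)] by blast
      then show ?thesis using assms(1) e by simp
    next
      case False
      then show ?thesis using assms(2) e unfolding arc_between_def by (metis arc_distinct_ends)
    qed
  qed
next
  case False
  then obtain g k where g: "Path_Connected.arc g" "path_image g = S" "pathstart g = x" "pathfinish g = y"
    and k: "Path_Connected.arc k" "path_image k = T" "pathstart k = y" "pathfinish k = z"
    using arc_between_neq assms(1,2) by metis
  have "Path_Connected.arc (g +++ k)" by (rule arc_join) (use g k assms(3) in auto)
  moreover have "path_image (g +++ k) = S \<union> T" using g k by (simp add: path_image_join)
  ultimately show ?thesis unfolding arc_between_def using g k by (metis pathfinish_join pathstart_join)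
qed

lemma arc_between_exists:
  assumes "path_connected P" "x \<in> P" "y \<in> P"
  obtains S where "S \<subseteq> P" "arc_between S x y"
proof (cases "x = y")
  case True
  then show ?thesis using that[of "{x}"] assms arc_between_refl by simp
next
  case False
  then obtain g where "Path_Connected.arc g" "path_image g \<subseteq> P" "pathstart g = x" "pathfinish g = y"
    using assms path_connected_arcwise by metis
  then show ?thesis using that[of "path_image g"] unfolding arc_between_def by blast
qed

lemma arc_between_initial:
  assumes "Path_Connected.arc g" "0 \<le> t" "t \<le> 1"
  shows "arc_between (g ` {0..t}) (g 0) (g t)" "arc_between (g ` {t..1}) (g t) (g 1)"
proof -
  show "arc_between (g ` {0..t}) (g 0) (g t)"
  proof (cases "t = 0")
    case True
    then show ?thesis by (simp add: arc_between_refl)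
  next
    case False
    have "Path_Connected.arc (subpath 0 t g)" by (rule arc_subpath_arc) (use assms False in auto)
    moreover have "path_image (subpath 0 t g) = g ` {0..t}" using assms by (simp add: path_image_subpath)
    ultimately show ?thesis unfolding arc_between_def
      by (metis pathfinish_subpath pathstart_subpath)
  qed
  show "arc_between (g ` {t..1}) (g t) (g 1)"
  proof (cases "t = 1")
    case True
    then show ?thesis by (simp add: arc_between_refl)
  next
    case False
    have "Path_Connected.arc (subpath t 1 g)" by (rule arc_subpath_arc) (use assms False in auto)
    moreover have "path_image (subpath t 1 g) = g ` {t..1}" using assms by (simp add: path_image_subpath)
    ultimately show ?thesis unfolding arc_between_def
      by (metis pathfinish_subpath pathstart_subpath)
  qed
qed

lemma arc_between_split:
  assumes "arc_between S x y" "z \<in> S"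
  obtains S1 S2 where "arc_between S1 x z" "arc_between S2 z y" "S1 \<union> S2 = S" "S1 \<inter> S2 = {z}"
proof (cases "x = y \<and> S = {x}")
  case True
  then show ?thesis using that[of S S] assms arc_between_refl by auto
next
  case False
  then obtain g where g: "Path_Connected.arc g" "path_image g = S" "pathstart g = x" "pathfinish g = y"
    using assms(1) unfolding arc_between_def by blast
  then obtain t where t: "0 \<le> t" "t \<le> 1" "z = g t" using assms(2) unfolding path_image_def by auto
  have "g ` {0..t} \<union> g ` {t..1} = S" using t g(2) unfolding path_image_def by (auto simp: image_Un[symmetric] ivl_disj_un)
  moreover have "g ` {0..t} \<inter> g ` {t..1} = g ` ({0..t} \<inter> {t..1})"
    using g(1) t by (intro inj_on_image_Int[symmetric, of _ "{0..1}"]) (auto simp: Path_Connected.arc_def)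
  moreover have "{0..t} \<inter> {t..1} = {t}" using t by auto
  ultimately show ?thesis using that[of "g ` {0..t}" "g ` {t..1}"] arc_between_initial[OF g(1) t(1,2)] g(3,4) t(3)
    by (simp add: pathstart_def pathfinish_def)
qed

lemma arc_between_first_hit:
  assumes "arc_between S x y" "closed K" "y \<in> K"
  obtains z T where "arc_between T x z" "T \<subseteq> S" "T \<inter> K = {z}"
proof (cases "x \<in> K")
  case True
  then show ?thesis using that[of "{x}" x] arc_between_refl arc_betweenD[OF assms(1)] by auto
next
  case False
  then have "x \<noteq> y" using assms(3) by auto
  then obtain g where g: "Path_Connected.arc g" "path_image g = S" "pathstart g = x" "pathfinish g = y"
    using arc_between_neq[OF assms(1)] by metis
  let ?J = "{0..1} \<inter> g -` K"
  have cont: "continuous_on {0..1} g" using g(1) unfolding Path_Connected.arc_def path_def by simp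
  have "closed ?J" using continuous_on_closed_vimage[of "{0..1}" g] cont assms(2) by (simp add: Int_commute)
  then have "compact ?J" by (metis compact_Icc closed_Int_compact inf.idem inf_commute inf_left_commute)
  moreover have "1 \<in> ?J" using g(4) assms(3) by (simp add: pathfinish_def)
  ultimately obtain t where t: "t \<in> ?J" "\<And>s. s \<in> ?J \<Longrightarrow> t \<le> s" using compact_attains_inf[of ?J] by blast
  have "g ` {0..t} \<inter> K = {g t}"
  proof (intro equalityI subsetI)
    fix u assume "u \<in> g ` {0..t} \<inter> K"
    then obtain s where s: "0 \<le> s" "s \<le> t" "u = g s" "g s \<in> K" by auto
    then have "t \<le> s" using t by auto
    then show "u \<in> {g t}" using s by simp
  qed (use t in auto)
  moreover have "g ` {0..t} \<subseteq> S" using g(2) t unfolding path_image_def by auto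
  ultimately show ?thesis using that arc_between_initial(1)[OF g(1), of t] t g(3) by (auto simp: pathstart_def)
qed

lemma arc_between_minus_start:
  assumes "arc_between S x y" "x \<noteq> y"
  shows "Topological_Spaces.connected (S - {x})" "x \<in> closure (S - {x})" "Topological_Spaces.connected (S - {x, y})"
proof -
  obtain g where g: "Path_Connected.arc g" "path_image g = S" "pathstart g = x" "pathfinish g = y"
    using arc_between_neq[OF assms] by metis
  have cont: "continuous_on {0..1} g" and inj: "inj_on g {0..1}" using g(1) unfolding Path_Connected.arc_def path_def by auto
  have e: "x = g 0" "y = g 1" "S = g ` {0..1}" using g by (auto simp: pathstart_def pathfinish_def path_image_def)
  have "S - {x} = g ` ({0..1} - {0})" using inj_on_image_set_diff[OF inj, of "{0..1}" "{0}"] e by auto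
  moreover have "{0..1} - {0} = {0<..1::real}" by auto
  ultimately have "S - {x} = g ` {0<..1}" by simp
  then show "Topological_Spaces.connected (S - {x})"
    using connected_continuous_image[of "{0<..1}" g] continuous_on_subset[OF cont, of "{0<..1}"]
    by (simp add: greaterThanAtMost_subseteq_atLeastAtMost_iff)
  have "S - {x, y} = g ` ({0..1} - {0, 1})" using inj_on_image_set_diff[OF inj, of "{0..1}" "{0,1}"] e by auto
  moreover have "{0..1} - {0, 1} = {0<..<1::real}" by auto
  ultimately have "S - {x, y} = g ` {0<..<1}" by simp
  then show "Topological_Spaces.connected (S - {x, y})"
    using connected_continuous_image[of "{0<..<1}" g] continuous_on_subset[OF cont, of "{0<..<1}"]
    by (simp add: greaterThanLessThan_subseteq_atLeastAtMost_iff)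
  have "x islimpt S"
    by (rule connected_imp_perfect[OF arc_betweenD(4,1)[OF assms(1)]]) (use arc_betweenD(1,2)[OF assms(1)] assms(2) in auto)
  then show "x \<in> closure (S - {x})" using islimpt_in_closure by blast
qed

text \<open>Let \<open>D\<close> be the side of \<open>C1 \<union> C2\<close> that avoids \<open>Q\<close>. Neither \<open>C1 \<union> C3\<close> nor \<open>C2 \<union> C3\<close> separates \<open>D\<close>
  from \<open>Q\<close>, and they meet in the connected set \<open>C3\<close>; by Janiszewski's theorem their union does not
  separate them either.\<close>

lemma theta_no_common_side:
  assumes C: "arc_between C1 a b" "arc_between C2 a b" "arc_between C3 a b" and ab: "a \<noteq> b"
    and I: "C1 \<inter> C2 = {a, b}" "C1 \<inter> C3 = {a, b}" "C2 \<inter> C3 = {a, b}"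
    and Q: "Topological_Spaces.connected Q" "Q \<inter> (C1 \<union> C2 \<union> C3) = {}"
    and q: "q1 \<in> closure Q" "q1 \<in> C1 - {a, b}" "q2 \<in> closure Q" "q2 \<in> C2 - {a, b}" "q3 \<in> closure Q" "q3 \<in> C3 - {a, b}"
  shows False
proof -
  have "Q \<noteq> {}" using q(1) by auto
  then obtain x where x: "x \<in> Q" by blast
  have QC: "Topological_Spaces.connected (Q \<union> (K - {a, b}))"
    if K: "arc_between K a b" "u \<in> closure Q" "u \<in> K - {a, b}" for K u
  proof -
    have "Topological_Spaces.connected (insert u Q)"
      by (rule connected_intermediate_closure[OF Q(1)]) (use K(2) closure_subset in auto)
    then have "Topological_Spaces.connected (insert u Q \<union> (K - {a, b}))"
      using arc_between_minus_start(3)[OF K(1) ab] K(3) by (intro connected_Un) auto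
    moreover have "insert u Q \<union> (K - {a, b}) = Q \<union> (K - {a, b})" using K(3) by blast
    ultimately show ?thesis by simp
  qed
  obtain g1 g2 where g1: "Path_Connected.arc g1" "path_image g1 = C1" "pathstart g1 = a" "pathfinish g1 = b"
    and g2: "Path_Connected.arc g2" "path_image g2 = C2" "pathstart g2 = a" "pathfinish g2 = b"
    using arc_between_neq C(1,2) ab by metis
  let ?c = "g1 +++ reversepath g2"
  let ?J = "C1 \<union> C2"
  have sp: "simple_path ?c"
    by (rule simple_path_join_loop) (use g1 g2 I(1) arc_reversepath in auto)
  have img: "path_image ?c = ?J" using g1 g2 by (simp add: path_image_join)
  have cl: "pathfinish ?c = pathstart ?c" using g1 g2 by simp
  note J = Jordan_inside_outside[OF sp cl, unfolded img]
  have T3: "Topological_Spaces.connected (Q \<union> (C3 - {a, b}))" using QC[OF C(3) q(5,6)] .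
  have T3J: "(Q \<union> (C3 - {a, b})) \<inter> ?J = {}" using Q(2) I by blast
  have "\<exists>D D'. {D, D'} = {inside ?J, outside ?J} \<and> Q \<union> (C3 - {a, b}) \<subseteq> D'"
  proof (rule ccontr)
    assume n: "\<not> ?thesis"
    have ni: "\<not> Q \<union> (C3 - {a, b}) \<subseteq> inside ?J" "\<not> Q \<union> (C3 - {a, b}) \<subseteq> outside ?J"
      using n by (auto dest: spec)
    have cov: "Q \<union> (C3 - {a, b}) \<subseteq> inside ?J \<union> outside ?J" using J T3J by blast
    have "inside ?J \<inter> outside ?J \<inter> (Q \<union> (C3 - {a, b})) = {}" using J by blast
    then have "inside ?J \<inter> (Q \<union> (C3 - {a, b})) = {} \<or> outside ?J \<inter> (Q \<union> (C3 - {a, b})) = {}"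
      using connectedD[OF T3, of "inside ?J" "outside ?J"] J cov by blast
    then show False using cov ni by blast
  qed
  then obtain D D' where D: "{D, D'} = {inside ?J, outside ?J}" "Q \<union> (C3 - {a, b}) \<subseteq> D'" by blast
  have DD: "D \<inter> D' = {}" "D \<union> D' = - ?J" "open D" "open D'" "Topological_Spaces.connected D" "D \<noteq> {}" "frontier D = ?J"
    using D(1) J unfolding doubleton_eq_iff by (elim disjE; simp add: Int_commute Un_commute)+
  obtain y where y: "y \<in> D" using DD(6) by blast
  \<comment> \<open>\<open>L\<close> is the arc of the closed curve other than \<open>K\<close>. Its
    interior lies on the frontier of \<open>D\<close> and contains the limit point \<open>u\<close>
    of \<open>Q\<close>, so it links \<open>x\<close> to \<open>y\<close> off
    \<open>K \<union> C3\<close>.\<close>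
  have key: "connected_component (- (K \<union> C3)) x y"
    if K: "arc_between L a b" "u \<in> closure Q" "u \<in> L - {a, b}" "L \<subseteq> ?J" "K \<subseteq> ?J" "K \<inter> L = {a, b}" "L \<inter> C3 = {a, b}" for K L u
  proof -
    have "L - {a, b} \<subseteq> closure D" using K(4) DD(7) unfolding frontier_def by blast
    then have c1: "Topological_Spaces.connected (D \<union> (L - {a, b}))"
      by (intro connected_intermediate_closure[OF DD(5)]) (use closure_subset in auto)
    have c2: "Topological_Spaces.connected ((D \<union> (L - {a, b})) \<union> (Q \<union> (L - {a, b})))"
      by (rule connected_Un[OF c1 QC[OF K(1,2,3)]]) (use K(3) in blast)
    have "(D \<union> (L - {a, b})) \<union> (Q \<union> (L - {a, b})) \<subseteq> - (K \<union> C3)"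
    proof -
      have "D \<inter> ?J = {}" using DD(2) by blast
      moreover have "a \<in> ?J" "b \<in> ?J" using I(1) by blast+
      moreover have "D \<inter> (C3 - {a, b}) = {}" using D(2) DD(1) by blast
      ultimately have "D \<inter> (K \<union> C3) = {}" using K(5) by blast
      moreover have "Q \<inter> (K \<union> C3) = {}" using Q(2) K(5) by blast
      ultimately show ?thesis using K(6,7) by blast
    qed
    then show ?thesis unfolding connected_component_def using c2 x y by (intro exI) auto
  qed
  have k1: "connected_component (- (C1 \<union> C3)) x y" by (rule key[OF C(2) q(3,4)]) (use I in auto)
  have k2: "connected_component (- (C2 \<union> C3)) x y" by (rule key[OF C(1) q(1,2)]) (use I in auto)
  have "(C1 \<union> C3) \<inter> (C2 \<union> C3) = C3" using I by blast
  then have "connected_component (- ((C1 \<union> C3) \<union> (C2 \<union> C3))) x y"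
    using arc_betweenD(3,4)[OF C(1)] arc_betweenD(3,4)[OF C(2)] arc_betweenD(3,4)[OF C(3)]
    by (intro Janiszewski[OF _ _ _ k1 k2]) (auto simp: compact_Un compact_imp_closed)
  then obtain T where T: "Topological_Spaces.connected T" "T \<subseteq> - ((C1 \<union> C3) \<union> (C2 \<union> C3))" "x \<in> T" "y \<in> T"
    unfolding connected_component_def by blast
  have "T \<subseteq> D \<union> D'" using T(2) DD(2) by blast
  then have "D \<inter> T = {} \<or> D' \<inter> T = {}" using connectedD[OF T(1) DD(3,4)] DD(1) by blast
  then show False using T(3,4) x y D(2) by blast
qed

text \<open>The centre is the first point at which an arc coming from \<open>p3\<close> hits an arc
  from \<open>p1\<close> to \<open>p2\<close>. The ends may lie outside \<open>A\<close> if they are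
  accessible from it, but ends may coincide only inside \<open>A\<close>; this keeps the centre in
  \<open>A\<close>.\<close>

lemma tripod3:
  assumes A: "A \<noteq> {}" "path_connected (insert p1 A)" "path_connected (insert p2 A)" "path_connected (insert p3 A)"
    and p: "p1 = p2 \<Longrightarrow> p1 \<in> A" "p1 = p3 \<Longrightarrow> p1 \<in> A" "p2 = p3 \<Longrightarrow> p2 \<in> A"
  shows "\<exists>a\<in>A. \<exists>L1 L2 L3. arc_between L1 a p1 \<and> arc_between L2 a p2 \<and> arc_between L3 a p3 \<and>
     L1 \<subseteq> insert p1 A \<and> L2 \<subseteq> insert p2 A \<and> L3 \<subseteq> insert p3 A \<and> L1 \<inter> L2 = {a} \<and> L1 \<inter> L3 = {a} \<and> L2 \<inter> L3 = {a}"
proof (cases "p1 = p2")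
  case True
  then have a: "p1 \<in> A" using p by blast
  obtain L where L: "L \<subseteq> insert p3 A" "arc_between L p1 p3" using arc_between_exists[OF A(4), of p1 p3] a by blast
  have "p1 \<in> L" using arc_betweenD[OF L(2)] by blast
  then show ?thesis using a L True arc_between_refl[of p1]
    by (intro bexI[of _ p1] exI[of _ "{p1}"] exI[of _ L]) auto
next
  case False
  have "path_connected (insert p1 A \<union> insert p2 A)" by (rule path_connected_Un) (use A in auto)
  then obtain G where G: "G \<subseteq> insert p1 A \<union> insert p2 A" "arc_between G p1 p2"
    using arc_between_exists[of _ p1 p2] by blast
  \<comment> \<open>Otherwise \<open>G\<close> would be a connected set with exactly two
    points.\<close>
  have "G \<inter> A \<noteq> {}"
  proof
    assume n: "G \<inter> A = {}"
    then have "G = {p1, p2}" using G(1) arc_betweenD(1,2)[OF G(2)] by blast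
    moreover have "infinite G"
      using arc_betweenD[OF G(2)] False connected_finite_iff_sing[of G] by auto
    ultimately show False by simp
  qed
  then obtain x where x: "x \<in> G" "x \<in> A" by blast
  obtain N where N: "N \<subseteq> insert p3 A" "arc_between N p3 x" using arc_between_exists[OF A(4), of p3 x] x by blast
  have "closed G" using arc_betweenD(3)[OF G(2)] compact_imp_closed by blast
  then obtain a L3 where L3: "arc_between L3 p3 a" "L3 \<subseteq> N" "L3 \<inter> G = {a}"
    using arc_between_first_hit[OF N(2) _ x(1)] by metis
  have aG: "a \<in> G" "a \<in> L3" using L3 by blast+
  \<comment> \<open>A centre outside \<open>A\<close> would be \<open>p3\<close> and also
    \<open>p1\<close> or \<open>p2\<close>, but coinciding ends lie in \<open>A\<close>.\<close>
  have aA: "a \<in> A"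
  proof (rule ccontr)
    assume n: "a \<notin> A"
    then have "a = p3" using aG(2) L3(2) N(1) by blast
    moreover have "a = p1 \<or> a = p2" using n aG(1) G(1) by blast
    ultimately show False using p n by metis
  qed
  obtain L1 L2 where L: "arc_between L1 p1 a" "arc_between L2 a p2" "L1 \<union> L2 = G" "L1 \<inter> L2 = {a}"
    using arc_between_split[OF G(2) aG(1)] by metis
  have "p2 \<in> L2" "p1 \<in> L1" using arc_betweenD[OF L(1)] arc_betweenD[OF L(2)] by blast+
  then have e: "p2 \<in> L1 \<Longrightarrow> p2 = a" "p1 \<in> L2 \<Longrightarrow> p1 = a" using L(4) by blast+
  have "L1 \<subseteq> insert p1 (insert p2 A)" "L2 \<subseteq> insert p1 (insert p2 A)" using L(3) G(1) by blast+
  then have s: "L1 \<subseteq> insert p1 A" "L2 \<subseteq> insert p2 A" using e aA by auto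
  have "L1 \<inter> L3 = {a}" "L2 \<inter> L3 = {a}" using L(3,4) L3(3) by blast+
  moreover have "L3 \<subseteq> insert p3 A" using L3(2) N(1) by blast
  ultimately show ?thesis using aA s L(2,4) arc_between_sym[OF L(1)] arc_between_sym[OF L3(1)]
    by (intro bexI[of _ a] exI[of _ L1] exI[of _ L2] exI[of _ L3]) simp_all
qed

lemma less_3_cases: "(j::nat) < 3 \<Longrightarrow> (j = 0 \<Longrightarrow> P) \<Longrightarrow> (j = 1 \<Longrightarrow> P) \<Longrightarrow> (j = 2 \<Longrightarrow> P) \<Longrightarrow> P"
  by linarith

lemma tripod:
  fixes p :: "nat \<Rightarrow> complex"
  assumes "A \<noteq> {}" "\<And>j. j < 3 \<Longrightarrow> path_connected (insert (p j) A)"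
    "\<And>j k. j < 3 \<Longrightarrow> k < 3 \<Longrightarrow> j \<noteq> k \<Longrightarrow> p j = p k \<Longrightarrow> p j \<in> A"
  shows "\<exists>a L. a \<in> A \<and> (\<forall>j<3. arc_between (L j) a (p j) \<and> L j \<subseteq> insert (p j) A \<and> (\<forall>k<3. j \<noteq> k \<longrightarrow> L j \<inter> L k = {a}))"
proof -
  obtain a L1 L2 L3 where *: "a \<in> A" "arc_between L1 a (p 0)" "arc_between L2 a (p 1)" "arc_between L3 a (p 2)"
     "L1 \<subseteq> insert (p 0) A" "L2 \<subseteq> insert (p 1) A" "L3 \<subseteq> insert (p 2) A" "L1 \<inter> L2 = {a}" "L1 \<inter> L3 = {a}" "L2 \<inter> L3 = {a}"
    using tripod3[of A "p 0" "p 1" "p 2"] assms(1) assms(2)[of 0] assms(2)[of 1] assms(2)[of 2]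
      assms(3)[of 0 1] assms(3)[of 0 2] assms(3)[of 1 2] by auto
  define L where "L = (\<lambda>j::nat. if j = 0 then L1 else if j = 1 then L2 else L3)"
  have "\<forall>j<3. arc_between (L j) a (p j) \<and> L j \<subseteq> insert (p j) A \<and> (\<forall>k<3. j \<noteq> k \<longrightarrow> L j \<inter> L k = {a})"
  proof (intro allI impI)
    fix j :: nat assume "j < 3"
    then show "arc_between (L j) a (p j) \<and> L j \<subseteq> insert (p j) A \<and> (\<forall>k<3. j \<noteq> k \<longrightarrow> L j \<inter> L k = {a})"
      using * by (elim less_3_cases) (auto simp: L_def Int_commute elim!: less_3_cases)
  qed
  then show ?thesis using *(1) by blast
qed

text \<open>The arcs from \<open>a 0\<close> to \<open>a 1\<close> through the three points
  \<open>b j\<close> form a theta. The star at \<open>a 2\<close> without its tips is a connected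
  set off the theta with a limit point \<open>b j\<close> inside each of the arcs.\<close>

lemma no_K33_arcs:
  fixes a b :: "nat \<Rightarrow> complex" and H :: "nat \<Rightarrow> nat \<Rightarrow> complex set"
  assumes H: "\<And>i j. i < 3 \<Longrightarrow> j < 3 \<Longrightarrow> arc_between (H i j) (a i) (b j)"
    and ab: "\<And>i j. i < 3 \<Longrightarrow> j < 3 \<Longrightarrow> a i \<noteq> b j" "a 0 \<noteq> a 1"
    and I1: "\<And>i j k. i < 3 \<Longrightarrow> j < 3 \<Longrightarrow> k < 3 \<Longrightarrow> j \<noteq> k \<Longrightarrow> H i j \<inter> H i k = {a i}"
    and I2: "\<And>i j k. i < 3 \<Longrightarrow> j < 3 \<Longrightarrow> k < 3 \<Longrightarrow> i \<noteq> k \<Longrightarrow> H i j \<inter> H k j = {b j}"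
    and I3: "\<And>i j k l. i < 3 \<Longrightarrow> j < 3 \<Longrightarrow> k < 3 \<Longrightarrow> l < 3 \<Longrightarrow> i \<noteq> k \<Longrightarrow> j \<noteq> l \<Longrightarrow> H i j \<inter> H k l = {}"
  shows False
proof -
  let ?C = "\<lambda>j. H 0 j \<union> H 1 j"
  have C: "arc_between (?C j) (a 0) (a 1)" if "j < 3" for j
    by (rule arc_between_join[OF H arc_between_sym[OF H]]) (use that I2[of 0 j 1] in auto)
  have CI: "?C j \<inter> ?C k = {a 0, a 1}" if "j < 3" "k < 3" "j \<noteq> k" for j k
    using I1[of 0 j k] I1[of 1 j k] I3[of 0 j 1 k] I3[of 1 j 0 k] that by auto
  define Q where "Q = (\<Union>j\<in>{..<3}. H 2 j - {b j})"
  have HQ: "Topological_Spaces.connected (H 2 j - {b j})" "b j \<in> closure (H 2 j - {b j})" "a 2 \<in> H 2 j - {b j}"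
    if "j < 3" for j
    using arc_between_minus_start[OF arc_between_sym[OF H[of 2 j]]] arc_betweenD(1)[OF H[of 2 j]] ab(1)[of 2 j] that by auto
  have cQ: "Topological_Spaces.connected Q" unfolding Q_def
  proof (rule connected_Union)
    have "a 2 \<in> \<Inter>((\<lambda>j. H 2 j - {b j}) ` {..<3})" using HQ(3) by blast
    then show "\<Inter>((\<lambda>j. H 2 j - {b j}) ` {..<3}) \<noteq> {}" by blast
  qed (use HQ(1) in auto)
  have bQ: "b j \<in> closure Q" if "j < 3" for j
    using closure_mono[of "H 2 j - {b j}" Q] HQ(2)[OF that] that unfolding Q_def by blast
  have QC: "Q \<inter> ?C k = {}" if "k < 3" for k
  proof -
    have "(H 2 j - {b j}) \<inter> ?C k = {}" if "j < 3" for j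
      using I2[of 2 j 0] I2[of 2 j 1] I3[of 2 j 0 k] I3[of 2 j 1 k] that \<open>k < 3\<close> by (cases "j = k") auto
    then show ?thesis unfolding Q_def by blast
  qed
  have bC: "b j \<in> ?C j - {a 0, a 1}" if "j < 3" for j
    using arc_betweenD(2)[OF H[of 0 j]] ab(1)[of 0 j] ab(1)[of 1 j] that by auto
  show False
    by (rule theta_no_common_side[OF C[of 0] C[of 1] C[of 2] ab(2) CI CI CI cQ _ bQ bC bQ bC bQ bC])
      (use QC[of 0] QC[of 1] QC[of 2] in auto)
qed

text \<open>Each region gets a tripod to its three link points. Legs of \<open>A i\<close> and
  \<open>B j\<close> can meet only in \<open>p i j\<close>, which one of the two regions contains,
  so joining the legs gives a drawing of \<open>K\<^sub>3\<^sub>,\<^sub>3\<close> by arcs.\<close>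

lemma no_K33_linked:
  fixes A B :: "nat \<Rightarrow> complex set" and p :: "nat \<Rightarrow> nat \<Rightarrow> complex"
  assumes ne: "\<And>i. i < 3 \<Longrightarrow> A i \<noteq> {}" "\<And>j. j < 3 \<Longrightarrow> B j \<noteq> {}"
    and pc: "\<And>i j. i < 3 \<Longrightarrow> j < 3 \<Longrightarrow> path_connected (insert (p i j) (A i))"
       "\<And>i j. i < 3 \<Longrightarrow> j < 3 \<Longrightarrow> path_connected (insert (p i j) (B j))"
    and p: "\<And>i j. i < 3 \<Longrightarrow> j < 3 \<Longrightarrow> p i j \<in> A i \<union> B j"
    and dA: "\<And>i k. i < 3 \<Longrightarrow> k < 3 \<Longrightarrow> i \<noteq> k \<Longrightarrow> A i \<inter> A k = {}"
    and dB: "\<And>i k. i < 3 \<Longrightarrow> k < 3 \<Longrightarrow> i \<noteq> k \<Longrightarrow> B i \<inter> B k = {}"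
    and dAB: "\<And>i k. i < 3 \<Longrightarrow> k < 3 \<Longrightarrow> A i \<inter> B k = {}"
  shows False
proof -
  have "\<exists>a L. a \<in> A i \<and> (\<forall>j<3. arc_between (L j) a (p i j) \<and> L j \<subseteq> insert (p i j) (A i) \<and> (\<forall>k<3. j \<noteq> k \<longrightarrow> L j \<inter> L k = {a}))"
    if i: "i < 3" for i
  proof (rule tripod[OF ne(1)[OF i] pc(1)[OF i]])
    fix j k :: nat assume jk: "j < 3" "k < 3" "j \<noteq> k" "p i j = p i k"
    then show "p i j \<in> A i" using p[OF i jk(1)] p[OF i jk(2)] dB[OF jk(1-3)] by auto
  qed
  then obtain a L where aL: "\<And>i. i < 3 \<Longrightarrow> a i \<in> A i \<and> (\<forall>j<3. arc_between (L i j) (a i) (p i j) \<and>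
     L i j \<subseteq> insert (p i j) (A i) \<and> (\<forall>k<3. j \<noteq> k \<longrightarrow> L i j \<inter> L i k = {a i}))" by metis
  have "\<exists>b M. b \<in> B j \<and> (\<forall>i<3. arc_between (M i) b (p i j) \<and> M i \<subseteq> insert (p i j) (B j) \<and> (\<forall>k<3. i \<noteq> k \<longrightarrow> M i \<inter> M k = {b}))"
    if j: "j < 3" for j
  proof (rule tripod[OF ne(2)[OF j] pc(2)[OF _ j]])
    fix i k :: nat assume ik: "i < 3" "k < 3" "i \<noteq> k" "p i j = p k j"
    then show "p i j \<in> B j" using p[OF ik(1) j] p[OF ik(2) j] dA[OF ik(1-3)] by auto
  qed
  then obtain b M where bM: "\<And>j. j < 3 \<Longrightarrow> b j \<in> B j \<and> (\<forall>i<3. arc_between (M j i) (b j) (p i j) \<and>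
     M j i \<subseteq> insert (p i j) (B j) \<and> (\<forall>k<3. i \<noteq> k \<longrightarrow> M j i \<inter> M j k = {b j}))" by metis
  have aA: "a i \<in> A i" if "i < 3" for i using aL[OF that] by blast
  have Lab: "arc_between (L i j) (a i) (p i j)" "L i j \<subseteq> insert (p i j) (A i)" if "i < 3" "j < 3" for i j
    using aL[OF that(1)] that(2) by simp_all
  have LI: "L i j \<inter> L i k = {a i}" if "i < 3" "j < 3" "k < 3" "j \<noteq> k" for i j k
    using aL[OF that(1)] that by simp
  have bB: "b j \<in> B j" if "j < 3" for j using bM[OF that] by blast
  have Mab: "arc_between (M j i) (b j) (p i j)" "M j i \<subseteq> insert (p i j) (B j)" if "i < 3" "j < 3" for i j
    using bM[OF that(2)] that(1) by simp_all
  have MI: "M j i \<inter> M j k = {b j}" if "i < 3" "j < 3" "k < 3" "i \<noteq> k" for i j k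
    using bM[OF that(2)] that by simp
  define H where "H = (\<lambda>i j. L i j \<union> M j i)"
  \<comment> \<open>Inside \<open>A i\<close> the arc \<open>H i j\<close> is just the leg
    \<open>L i j\<close>, because the leg from \<open>B j\<close> can enter \<open>A i\<close> only
    at \<open>p i j\<close>.\<close>
  have HA: "x \<in> L i j" if "i < 3" "j < 3" "x \<in> H i j" "x \<in> A i" for i j x
    using that(3,4) Mab(2)[OF that(1,2)] dAB[OF that(1,2)] arc_betweenD(2)[OF Lab(1)[OF that(1,2)]]
    unfolding H_def by blast
  have HB: "x \<in> M j i" if "i < 3" "j < 3" "x \<in> H i j" "x \<in> B j" for i j x
    using that(3,4) Lab(2)[OF that(1,2)] dAB[OF that(1,2)] arc_betweenD(2)[OF Mab(1)[OF that(1,2)]]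
    unfolding H_def by blast
  have Hs: "H i j \<subseteq> A i \<union> B j" if "i < 3" "j < 3" for i j
    using Lab(2)[OF that] Mab(2)[OF that] p[OF that] unfolding H_def by blast
  have Hab: "a i \<in> H i j" "b j \<in> H i j" if "i < 3" "j < 3" for i j
    using arc_betweenD(1)[OF Lab(1)[OF that]] arc_betweenD(1)[OF Mab(1)[OF that]] unfolding H_def by simp_all
  show False
  proof (rule no_K33_arcs[of H a b])
    show "arc_between (H i j) (a i) (b j)" if "i < 3" "j < 3" for i j
      unfolding H_def
    proof (rule arc_between_join)
      have l: "arc_between (L i j) (a i) (p i j)" "L i j \<subseteq> insert (p i j) (A i)" using Lab that by simp_all
      have m: "arc_between (M j i) (b j) (p i j)" "M j i \<subseteq> insert (p i j) (B j)" using Mab that by simp_all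
      show "arc_between (L i j) (a i) (p i j)" by (rule l)
      show "arc_between (M j i) (p i j) (b j)" by (rule arc_between_sym[OF m(1)])
      show "L i j \<inter> M j i \<subseteq> {p i j}" using l(2) m(2) dAB[of i j] that by blast
    qed
    show "a i \<noteq> b j" if "i < 3" "j < 3" for i j using aA[OF that(1)] bB[OF that(2)] dAB[OF that] by (metis disjoint_iff)
    show "a 0 \<noteq> a 1" using aA[of 0] aA[of 1] dA[of 0 1] by auto
    show "H i j \<inter> H i k = {a i}" if t: "i < 3" "j < 3" "k < 3" "j \<noteq> k" for i j k
    proof (intro equalityI subsetI)
      fix x assume x: "x \<in> H i j \<inter> H i k"
      then have "x \<in> A i" using Hs[OF t(1,2)] Hs[OF t(1,3)] dB[OF t(2-4)] by blast
      then show "x \<in> {a i}" using HA[OF t(1,2)] HA[OF t(1,3)] x LI[OF t] by blast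
    qed (use Hab t in auto)
    show "H i j \<inter> H k j = {b j}" if t: "i < 3" "j < 3" "k < 3" "i \<noteq> k" for i j k
    proof (intro equalityI subsetI)
      fix x assume x: "x \<in> H i j \<inter> H k j"
      then have "x \<in> B j" using Hs[OF t(1,2)] Hs[OF t(3,2)] dA[OF t(1,3,4)] by blast
      then show "x \<in> {b j}" using HB[OF t(1,2)] HB[OF t(3,2)] x MI[OF t] by blast
    qed (use Hab t in auto)
    show "H i j \<inter> H k l = {}" if "i < 3" "j < 3" "k < 3" "l < 3" "i \<noteq> k" "j \<noteq> l" for i j k l
      using Hs[OF that(1,2)] Hs[OF that(3,4)] dA[OF that(1,3,5)] dB[OF that(2,4,6)] dAB[OF that(1,4)] dAB[OF that(3,2)] by blast
  qed
qed

section \<open>The incidence graph of nations and vertices\<close>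

text \<open>A plane graph is simple here, so an edge is determined by its trace on the finite set
  \<open>V\<close>.\<close>

lemma plane_graph_finite_edges:
  assumes "plane_graph V E"
  shows "finite E"
proof -
  have "inj_on (\<lambda>e. e \<inter> V) E" using assms unfolding plane_graph_def inj_on_def by blast
  moreover have "finite ((\<lambda>e. e \<inter> V) ` E)"
    by (rule finite_subset[of _ "Pow V"]) (use assms in \<open>auto simp: plane_graph_def\<close>)
  ultimately show ?thesis using finite_imageD by blast
qed

lemma plane_graph_closed:
  assumes "plane_graph V E"
  shows "closed (V \<union> \<Union>E)"
proof -
  have "closed e" if e: "e \<in> E" for e
  proof -
    obtain \<gamma> where "Path_Connected.arc \<gamma>" "path_image \<gamma> = e" using assms e unfolding plane_graph_def by metis
    then show ?thesis using compact_arc_image compact_imp_closed by blast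
  qed
  then have "closed (\<Union>E)" using plane_graph_finite_edges[OF assms] by (intro closed_Union) auto
  moreover have "closed V" using assms finite_imp_closed unfolding plane_graph_def by blast
  ultimately show ?thesis by (rule closed_Un[rotated])
qed

lemma face_props:
  assumes "plane_graph V E" "f \<in> faces V E"
  shows "open f" "path_connected f" "f \<noteq> {}" "f \<inter> (V \<union> \<Union>E) = {}"
proof -
  have o: "open (- (V \<union> \<Union>E))" using plane_graph_closed[OF assms(1)] by (rule open_Compl)
  have c: "f \<in> components (- (V \<union> \<Union>E))" using assms(2) unfolding faces_def .
  show "open f" using open_components[OF o c] .
  moreover have "Topological_Spaces.connected f" using in_components_connected[OF c] .
  ultimately show "path_connected f" using connected_open_path_connected by blast
  show "f \<noteq> {}" using in_components_nonempty[OF c] .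
  show "f \<inter> (V \<union> \<Union>E) = {}" using in_components_subset[OF c] by blast
qed

lemma faces_disjoint: "f \<in> faces V E \<Longrightarrow> g \<in> faces V E \<Longrightarrow> f \<noteq> g \<Longrightarrow> f \<inter> g = {}"
  unfolding faces_def using components_eq by blast

text \<open>The end thirds of the incident edges are added to a vertex because only a dense set of frontier
  points is known to be accessible from a face; a vertex itself need not be among them.\<close>

lemma vertex_blobs:
  assumes pg: "plane_graph V E"
  obtains blob where "\<And>v. v \<in> V \<Longrightarrow> path_connected (blob v) \<and> v \<in> blob v \<and> blob v \<subseteq> V \<union> \<Union>E"
    "\<And>u v. u \<in> V \<Longrightarrow> v \<in> V \<Longrightarrow> u \<noteq> v \<Longrightarrow> blob u \<inter> blob v = {}"
    "\<And>f v. closed_face V E f \<Longrightarrow> v \<in> V \<Longrightarrow> v \<in> frontier f \<Longrightarrow> \<exists>p\<in>blob v. path_connected (insert p f)"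
proof -
  have "\<forall>e\<in>E. \<exists>\<gamma>. Path_Connected.arc \<gamma> \<and> path_image \<gamma> = e \<and> e \<inter> V = {pathstart \<gamma>, pathfinish \<gamma>}"
    using pg unfolding plane_graph_def by blast
  then obtain \<gamma> where \<gamma>: "\<And>e. e \<in> E \<Longrightarrow> Path_Connected.arc (\<gamma> e) \<and> path_image (\<gamma> e) = e \<and> e \<inter> V = {pathstart (\<gamma> e), pathfinish (\<gamma> e)}"
    by metis
  have ee: "e \<inter> e' \<subseteq> V" if "e \<in> E" "e' \<in> E" "e \<noteq> e'" for e e' using pg that unfolding plane_graph_def by blast
  \<comment> \<open>The arc of \<open>e\<close> parametrised from its end \<open>v\<close>, so that
    the third next to \<open>v\<close> is the image of \<open>{0..1/3}\<close>.\<close>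
  define half where "half = (\<lambda>e v. if pathstart (\<gamma> e) = v then \<gamma> e else reversepath (\<gamma> e))"
  have half: "Path_Connected.arc (half e v)" "path_image (half e v) = e" "half e v 0 = v" "e \<inter> V = {half e v 0, half e v 1}"
    if "e \<in> E" "v \<in> V" "v \<in> e" for e v
  proof -
    have v: "v = pathstart (\<gamma> e) \<or> v = pathfinish (\<gamma> e)" using \<gamma>[OF that(1)] that(2,3) by blast
    show "Path_Connected.arc (half e v)" "path_image (half e v) = e"
      using \<gamma>[OF that(1)] arc_reversepath unfolding half_def by auto
    show "half e v 0 = v" using v unfolding half_def by (auto simp: reversepath_def pathstart_def pathfinish_def)
    show "e \<inter> V = {half e v 0, half e v 1}"
      using \<gamma>[OF that(1)] unfolding half_def by (auto simp: reversepath_def pathstart_def pathfinish_def)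
  qed
  have inj: "s = s'" if "e \<in> E" "v \<in> V" "v \<in> e" "half e v s = half e v s'" "s \<in> {0..1}" "s' \<in> {0..1}" for e v s s'
    using half(1)[OF that(1-3)] that(4-6) unfolding Path_Connected.arc_def inj_on_def by blast
  have himg: "half e v s \<in> e" if "e \<in> E" "v \<in> V" "v \<in> e" "s \<in> {0..1}" for e v s
    using half(2)[OF that(1-3)] that(4) unfolding path_image_def by blast
  have hV: "s = 0 \<or> s = 1" if "e \<in> E" "v \<in> V" "v \<in> e" "s \<in> {0..1}" "half e v s \<in> V" for e v s
  proof -
    have "half e v s \<in> {half e v 0, half e v 1}" using himg[OF that(1-4)] that(5) half(4)[OF that(1-3)] by blast
    then show ?thesis using inj[OF that(1-3), of s 0] inj[OF that(1-3), of s 1] that(4) by auto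
  qed
  define blob where "blob = (\<lambda>v. {v} \<union> (\<Union>e\<in>{e\<in>E. v \<in> e}. half e v ` {0..1/3}))"
  have blobE: "x = v \<or> (\<exists>e\<in>E. \<exists>s. v \<in> e \<and> 0 \<le> s \<and> s \<le> 1/3 \<and> x = half e v s)" if xb: "x \<in> blob v" for x v
  proof (cases "x = v")
    case False
    then obtain e s where s: "e \<in> E" "v \<in> e" "s \<in> {0..1/3}" "x = half e v s" using xb unfolding blob_def by blast
    then have "0 \<le> s" "s \<le> 1/3" by auto
    then show ?thesis using s by blast
  qed simp
  show ?thesis
  proof (rule that[of blob])
    fix v assume v: "v \<in> V"
    have "path_connected (half e v ` {0..1/3})" if "e \<in> E" "v \<in> e" for e
    proof (rule path_connected_continuous_image)
      show "continuous_on {0..1/3} (half e v)"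
        using half(1)[OF that(1) v that(2)] unfolding Path_Connected.arc_def path_def
        by (auto intro: continuous_on_subset)
    qed (simp add: convex_imp_path_connected)
    moreover have "v \<in> half e v ` {0..1/3}" if "e \<in> E" "v \<in> e" for e
      using half(3)[OF that(1) v that(2)] by (intro image_eqI[of _ _ 0]) auto
    ultimately have pc: "path_connected (half e v ` {0..1/3}) \<and> v \<in> half e v ` {0..1/3}" if "e \<in> E" "v \<in> e" for e
      using that by blast
    have "path_connected (\<Union>X\<in>insert {v} ((\<lambda>e. half e v ` {0..1/3}) ` {e\<in>E. v \<in> e}). X)"
      by (rule path_connected_UNION[where z = v]) (use pc in auto)
    then have "path_connected (blob v)" unfolding blob_def by simp
    moreover have "half e v ` {0..1/3} \<subseteq> e" if "e \<in> E" "v \<in> e" for e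
      using himg[OF that(1) v that(2)] by auto
    then have "blob v \<subseteq> V \<union> \<Union>E" unfolding blob_def using v by blast
    ultimately show "path_connected (blob v) \<and> v \<in> blob v \<and> blob v \<subseteq> V \<union> \<Union>E"
      unfolding blob_def by blast
  next
    fix u v assume uv: "u \<in> V" "v \<in> V" "u \<noteq> v"
    have bV: "x = w" if x: "x \<in> blob w" "x \<in> V" "w \<in> V" for x w
      using blobE[OF x(1)]
    proof
      assume "\<exists>e\<in>E. \<exists>s. w \<in> e \<and> 0 \<le> s \<and> s \<le> 1/3 \<and> x = half e w s"
      then obtain e s where s: "e \<in> E" "w \<in> e" "0 \<le> s" "s \<le> 1/3" "x = half e w s" by blast
      then have "s = 0" using hV[OF s(1) x(3) s(2), of s] x(2) by auto
      then show "x = w" using half(3)[OF s(1) x(3) s(2)] s(5) by simp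
    qed
    show "blob u \<inter> blob v = {}"
    proof (rule ccontr)
      assume "blob u \<inter> blob v \<noteq> {}"
      then obtain x where x: "x \<in> blob u" "x \<in> blob v" by blast
      have xV: "x \<notin> V" using bV[OF x(1) _ uv(1)] bV[OF x(2) _ uv(2)] uv(3) by blast
      then obtain e s where s: "e \<in> E" "u \<in> e" "0 \<le> s" "s \<le> 1/3" "x = half e u s"
        using blobE[OF x(1)] uv(1) by blast
      obtain e' s' where s': "e' \<in> E" "v \<in> e'" "0 \<le> s'" "s' \<le> 1/3" "x = half e' v s'"
        using blobE[OF x(2)] uv(2) xV by blast
      have "x \<in> e" "x \<in> e'" using himg[OF s(1) uv(1) s(2), of s] himg[OF s'(1) uv(2) s'(2), of s'] s s' by auto
      then have e: "e = e'" using ee[OF s(1) s'(1)] xV by blast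
      have "inj_on (\<gamma> e) {0..1}" using \<gamma>[OF s(1)] unfolding Path_Connected.arc_def by blast
      then have i: "a = b" if "\<gamma> e a = \<gamma> e b" "a \<in> {0..1}" "b \<in> {0..1}" for a b using that unfolding inj_on_def by blast
      have "u = pathstart (\<gamma> e) \<or> u = pathfinish (\<gamma> e)" "v = pathstart (\<gamma> e) \<or> v = pathfinish (\<gamma> e)"
      proof -
        have "u \<in> e \<inter> V" "v \<in> e \<inter> V" using uv s(2) s'(2) e by auto
        then show "u = pathstart (\<gamma> e) \<or> u = pathfinish (\<gamma> e)" "v = pathstart (\<gamma> e) \<or> v = pathfinish (\<gamma> e)"
          using \<gamma>[OF s(1)] by auto
      qed
      \<comment> \<open>Measured from the same end of the edge, the two parameters are at most
        \<open>1/3\<close> and at least \<open>2/3\<close>.\<close>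
      then consider "pathstart (\<gamma> e) = u" "pathstart (\<gamma> e) \<noteq> v" | "pathstart (\<gamma> e) = v" "pathstart (\<gamma> e) \<noteq> u"
        using uv(3) by metis
      then show False
      proof cases
        case 1
        then have "\<gamma> e s = \<gamma> e (1 - s')" using s(5) s'(5) e unfolding half_def by (simp add: reversepath_def)
        then show False using i[of s "1 - s'"] s s' by auto
      next
        case 2
        then have "\<gamma> e (1 - s) = \<gamma> e s'" using s(5) s'(5) e unfolding half_def by (simp add: reversepath_def)
        then show False using i[of "1 - s" s'] s s' by auto
      qed
    qed
  next
    fix f v assume f: "closed_face V E f" and v: "v \<in> V" "v \<in> frontier f"
    have ff: "f \<in> faces V E" using f unfolding closed_face_def by blast
    have "\<exists>\<F>\<subseteq>E. frontier f = \<Union>\<F>" using f unfolding closed_face_def by (metis (lifting) mem_Collect_eq subsetI)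
    then obtain \<F> where FE: "\<F> \<subseteq> E" and p: "frontier f = \<Union>\<F>" by blast
    have "v \<in> \<Union>\<F>" using v(2) p by simp
    then obtain e where e: "e \<in> \<F>" "v \<in> e" by (rule UnionE)
    have eE: "e \<in> E" using e(1) FE by (rule subsetD[rotated])
    note fp = face_props[OF pg ff]
    let ?h = "half e v"
    let ?U = "?h ` {0<..<1/3}"
    \<comment> \<open>\<open>?K\<close> is the frontier of \<open>f\<close> without the open piece
      \<open>?U\<close> of \<open>e\<close> next to \<open>v\<close>. It is closed because a closed
      face is bounded by finitely many whole edges; so \<open>?U\<close> is open in the frontier and
      contains an accessible point.\<close>
    let ?K = "\<Union>(\<F> - {e}) \<union> ?h ` ({0} \<union> {1/3..1})"
    have cont: "continuous_on {0..1} ?h" using half(1)[OF eE v(1) e(2)] unfolding Path_Connected.arc_def path_def by blast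
    have "closed c" if c: "c \<in> E" for c
    proof -
      have "Path_Connected.arc (\<gamma> c)" "path_image (\<gamma> c) = c" using \<gamma>[OF c] by blast+
      then show ?thesis using compact_arc_image compact_imp_closed by metis
    qed
    then have "closed (\<Union>(\<F> - {e}))" using finite_subset[OF FE plane_graph_finite_edges[OF pg]] subsetD[OF FE] by (intro closed_Union) auto
    moreover have "compact (?h ` ({0} \<union> {1/3..1}))"
      by (rule compact_continuous_image[OF continuous_on_subset[OF cont]]) auto
    ultimately have cK: "closed ?K" using compact_imp_closed closed_Un by blast
    have "?U = frontier f \<inter> - ?K"
    proof (intro equalityI subsetI)
      fix x assume "x \<in> ?U"
      then obtain t where t: "0 < t" "t < 1/3" "x = ?h t" by auto
      have xe: "x \<in> e" using himg[OF eE v(1) e(2), of t] t by auto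
      have "x \<notin> V" using hV[OF eE v(1) e(2), of t] t by auto
      then have "x \<notin> \<Union>(\<F> - {e})" using ee[OF eE] xe subsetD[OF FE] by blast
      moreover have "x \<notin> ?h ` ({0} \<union> {1/3..1})"
      proof
        assume "x \<in> ?h ` ({0} \<union> {1/3..1})"
        then obtain s where "s \<in> {0} \<union> {1/3..1}" "x = ?h s" by blast
        then have s: "s = 0 \<or> (1/3 \<le> s \<and> s \<le> 1)" "x = ?h s" by auto
        then have "s = t" using inj[OF eE v(1) e(2), of s t] t by auto
        then show False using s t by auto
      qed
      ultimately show "x \<in> frontier f \<inter> - ?K" using xe e(1) p by blast
    next
      fix x assume x: "x \<in> frontier f \<inter> - ?K"
      then have "x \<in> e" using p by blast
      then have "x \<in> path_image ?h" using half(2)[OF eE v(1) e(2)] by simp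
      then obtain t where t: "0 \<le> t" "t \<le> 1" "x = ?h t" unfolding path_image_def by auto
      have "t \<notin> {0} \<union> {1/3..1}" using x t(3) by blast
      then show "x \<in> ?U" using t by auto
    qed
    then have "openin (top_of_set (frontier f)) ?U" using cK by (metis open_Compl openin_open_Int)
    moreover have "?h (1/6) \<in> ?U" by (rule imageI) simp
    then have "?U \<noteq> {}" by blast
    ultimately obtain g where g: "Path_Connected.arc g" "g ` {0..<1} \<subseteq> f" "pathstart g \<in> f" "pathfinish g \<in> ?U"
      using dense_accessible_frontier_points[OF fp(1)] by metis
    have "path_image g \<subseteq> insert (pathfinish g) f"
    proof
      fix x assume "x \<in> path_image g"
      then obtain t where t: "0 \<le> t" "t \<le> 1" "x = g t" unfolding path_image_def by auto
      show "x \<in> insert (pathfinish g) f"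
      proof (cases "t = 1")
        case True
        then show ?thesis using t by (simp add: pathfinish_def)
      next
        case False
        then have "t \<in> {0..<1}" using t by simp
        then show ?thesis using t(3) g(2) by blast
      qed
    qed
    then have "insert (pathfinish g) f = path_image g \<union> f" using pathfinish_in_path_image by blast
    moreover have "path_connected (path_image g \<union> f)"
    proof (rule path_connected_Un[OF _ fp(2)])
      show "path_connected (path_image g)" using g(1) arc_imp_path path_connected_path_image by blast
      show "path_image g \<inter> f \<noteq> {}" using g(3) pathstart_in_path_image by blast
    qed
    ultimately have "path_connected (insert (pathfinish g) f)" by simp
    moreover have "?U \<subseteq> ?h ` {0..1/3}" by (rule image_mono) auto
    then have "?U \<subseteq> blob v" unfolding blob_def using eE e(2) by blast
    ultimately show "\<exists>p\<in>blob v. path_connected (insert p f)" using g(4) by blast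
  qed
qed

text \<open>Touching closures would not suffice for drawing arcs: the common point has to be
  reachable by paths. As it belongs to one of the regions, accessibility is really a condition on
  the other.\<close>

definition linked :: "complex set \<Rightarrow> complex set \<Rightarrow> bool" where
  "linked P Q \<longleftrightarrow> (\<exists>p\<in>P \<union> Q. path_connected (insert p P) \<and> path_connected (insert p Q))"

text \<open>A branch set becomes the union of its regions. Link points lie in the regions, so the
  unions are path connected, stay disjoint and are linked again; three of the six against the other
  three contradict \<open>no_K33_linked\<close>.\<close>

lemma no_K6_linked_regions:
  fixes reg :: "'n \<Rightarrow> complex set"
  assumes fin: "finite U" and reg: "\<And>x. x \<in> U \<Longrightarrow> path_connected (reg x) \<and> reg x \<noteq> {}"
    and dis: "\<And>x y. x \<in> U \<Longrightarrow> y \<in> U \<Longrightarrow> x \<noteq> y \<Longrightarrow> reg x \<inter> reg y = {}"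
    and R: "\<And>x y. x \<in> U \<Longrightarrow> y \<in> U \<Longrightarrow> R x y \<Longrightarrow> linked (reg x) (reg y)"
  shows "\<not> clique_minor R U 6"
proof
  assume "clique_minor R U 6"
  then obtain \<M> where M: "finite \<M>" "card \<M> = 6" "\<And>M. M \<in> \<M> \<Longrightarrow> M \<subseteq> U \<and> conn R M"
    "\<And>M N. M \<in> \<M> \<Longrightarrow> N \<in> \<M> \<Longrightarrow> M \<noteq> N \<Longrightarrow> M \<inter> N = {} \<and> touch R M N"
    using clique_minorE by metis
  define W where "W = (\<lambda>M. \<Union>x\<in>M. reg x)"
  have Wsub: "reg x \<subseteq> W M" if "x \<in> M" for x M using that unfolding W_def by blast
  have Wpc: "path_connected (W M)" if Mm: "M \<in> \<M>" for M
  proof -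
    have MU: "M \<subseteq> U" and c: "conn R M" using M(3)[OF Mm] by auto
    have fM: "finite M" using MU fin finite_subset by blast
    obtain x where x: "x \<in> M" using c conn_nonempty by blast
    from c fM x show ?thesis
    proof (induction rule: conn_induct)
      case base
      have "W {x} = reg x" unfolding W_def by simp
      then show ?case using reg x MU by auto
    next
      case (step T y z)
      have yz: "y \<in> U" "z \<in> U" using step.hyps MU by auto
      obtain p where p: "p \<in> reg y \<union> reg z" "path_connected (insert p (reg y))" "path_connected (insert p (reg z))"
        using R[OF yz step.hyps(5)] unfolding linked_def by blast
      have "path_connected (insert p (reg y) \<union> insert p (reg z))"
        by (rule path_connected_Un[OF p(2,3)]) blast
      then have "path_connected (W T \<union> (insert p (reg y) \<union> insert p (reg z)))"
        by (rule path_connected_Un[OF step.IH]) (use reg[OF yz(1)] Wsub[OF step.hyps(3)] in blast)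
      moreover have "W T \<union> (insert p (reg y) \<union> insert p (reg z)) = W (insert z T)"
        using p(1) Wsub[OF step.hyps(3)] unfolding W_def by blast
      ultimately show ?case by simp
    qed
  qed
  have Wne: "W M \<noteq> {}" if Mm: "M \<in> \<M>" for M
  proof -
    obtain x where x: "x \<in> M" using M(3)[OF Mm] conn_nonempty by blast
    then have "x \<in> U" using M(3)[OF Mm] by blast
    then show ?thesis using reg[of x] Wsub[OF x] by blast
  qed
  have Wdis: "W M \<inter> W N = {}" if MN: "M \<in> \<M>" "N \<in> \<M>" "M \<noteq> N" for M N
  proof (rule ccontr)
    assume "W M \<inter> W N \<noteq> {}"
    then obtain x y where xy: "x \<in> M" "y \<in> N" "reg x \<inter> reg y \<noteq> {}" unfolding W_def by blast
    then have "x \<noteq> y" using M(4)[OF MN] by blast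
    moreover have "x \<in> U" "y \<in> U" using xy M(3) MN by auto
    ultimately show False using dis xy(3) by blast
  qed
  have Wl: "\<exists>p\<in>W M \<union> W N. path_connected (insert p (W M)) \<and> path_connected (insert p (W N))"
    if MN: "M \<in> \<M>" "N \<in> \<M>" "M \<noteq> N" for M N
  proof -
    obtain x y where xy: "x \<in> M" "y \<in> N" "R x y" using M(4)[OF MN] unfolding touch_def by blast
    have xyU: "x \<in> U" "y \<in> U" using xy M(3) MN by auto
    obtain p where p: "p \<in> reg x \<union> reg y" "path_connected (insert p (reg x))" "path_connected (insert p (reg y))"
      using R[OF xyU xy(3)] unfolding linked_def by blast
    have "path_connected (W M \<union> insert p (reg x))"
      by (rule path_connected_Un[OF Wpc[OF MN(1)] p(2)]) (use reg[OF xyU(1)] Wsub[OF xy(1)] in blast)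
    moreover have "path_connected (W N \<union> insert p (reg y))"
      by (rule path_connected_Un[OF Wpc[OF MN(2)] p(3)]) (use reg[OF xyU(2)] Wsub[OF xy(2)] in blast)
    moreover have "W M \<union> insert p (reg x) = insert p (W M)" "W N \<union> insert p (reg y) = insert p (W N)"
      using Wsub[OF xy(1)] Wsub[OF xy(2)] by blast+
    moreover have "p \<in> W M \<union> W N" using p(1) Wsub[OF xy(1)] Wsub[OF xy(2)] by blast
    ultimately show ?thesis by auto
  qed
  obtain g where g: "bij_betw g {0..<6::nat} \<M>" using ex_bij_betw_nat_finite[OF M(1)] M(2) by metis
  have gM: "g i \<in> \<M>" if "i < 6" for i using g that unfolding bij_betw_def by auto
  have gd: "g i \<noteq> g j" if "i < 6" "j < 6" "i \<noteq> j" for i j using g that unfolding bij_betw_def inj_on_def by auto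
  have "\<forall>i j. \<exists>p. i < 3 \<and> j < 3 \<longrightarrow> p \<in> W (g i) \<union> W (g (3 + j)) \<and> path_connected (insert p (W (g i))) \<and> path_connected (insert p (W (g (3 + j))))"
  proof (intro allI)
    fix i j :: nat
    show "\<exists>p. i < 3 \<and> j < 3 \<longrightarrow> p \<in> W (g i) \<union> W (g (3 + j)) \<and> path_connected (insert p (W (g i))) \<and> path_connected (insert p (W (g (3 + j))))"
      using Wl[of "g i" "g (3 + j)"] gM[of i] gM[of "3 + j"] gd[of i "3 + j"] by (cases "i < 3 \<and> j < 3") auto
  qed
  then obtain p where p: "\<And>i j. i < 3 \<Longrightarrow> j < 3 \<Longrightarrow> p i j \<in> W (g i) \<union> W (g (3 + j)) \<and>
      path_connected (insert (p i j) (W (g i))) \<and> path_connected (insert (p i j) (W (g (3 + j))))"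
    by metis
  show False
  proof (rule no_K33_linked[of "\<lambda>i. W (g i)" "\<lambda>j. W (g (3 + j))" p])
    show "W (g i) \<inter> W (g k) = {}" if "i < 3" "k < 3" "i \<noteq> k" for i k
      by (rule Wdis) (use that gM gd in auto)
    show "W (g (3 + i)) \<inter> W (g (3 + k)) = {}" if "i < 3" "k < 3" "i \<noteq> k" for i k
      by (rule Wdis) (use that gM gd in auto)
    show "W (g i) \<inter> W (g (3 + k)) = {}" if "i < 3" "k < 3" for i k
      by (rule Wdis) (use that gM gd in auto)
  qed (use p Wne gM in auto)
qed

fun incidence :: "('n \<Rightarrow> complex set) \<Rightarrow> 'n + complex \<Rightarrow> 'n + complex \<Rightarrow> bool" where
  "incidence reg (Inl a) (Inr v) \<longleftrightarrow> v \<in> frontier (reg a)"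
| "incidence reg (Inr v) (Inl a) \<longleftrightarrow> v \<in> frontier (reg a)"
| "incidence reg _ _ \<longleftrightarrow> False"

lemma symp_incidence: "symp (incidence reg)"
proof (rule sympI)
  fix x y show "incidence reg x y \<Longrightarrow> incidence reg y x" by (cases x; cases y) auto
qed

text \<open>Faces serve as regions for nations and blobs for map vertices. Faces avoid the drawing
  while blobs lie in it, so regions of different kinds are disjoint.\<close>

lemma incidence_no_K6_minor:
  assumes pg: "plane_graph V E" and fin: "finite N"
    and reg: "\<And>a. a \<in> N \<Longrightarrow> closed_face V E (reg a)" and inj: "inj_on reg N"
  shows "\<not> clique_minor (incidence reg) (Inl ` N \<union> Inr ` V) 6"
proof -
  obtain blob where b1: "\<And>v. v \<in> V \<Longrightarrow> path_connected (blob v) \<and> v \<in> blob v \<and> blob v \<subseteq> V \<union> \<Union>E"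
    and b2: "\<And>u v. u \<in> V \<Longrightarrow> v \<in> V \<Longrightarrow> u \<noteq> v \<Longrightarrow> blob u \<inter> blob v = {}"
    and b3: "\<And>f v. closed_face V E f \<Longrightarrow> v \<in> V \<Longrightarrow> v \<in> frontier f \<Longrightarrow> \<exists>p\<in>blob v. path_connected (insert p f)"
    using vertex_blobs[OF pg] by metis
  have fc: "reg a \<in> faces V E" if "a \<in> N" for a using reg[OF that] unfolding closed_face_def by blast
  have lk: "linked (reg a) (blob v) \<and> linked (blob v) (reg a)" if av: "a \<in> N" "v \<in> V" "v \<in> frontier (reg a)" for a v
  proof -
    obtain p where p: "p \<in> blob v" "path_connected (insert p (reg a))" using b3[OF reg[OF av(1)] av(2,3)] by blast
    then have "insert p (blob v) = blob v" by blast
    then show ?thesis unfolding linked_def using p b1[OF that(2)] by (metis UnI1 UnI2)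
  qed
  have fb: "reg a \<inter> blob v = {}" if "a \<in> N" "v \<in> V" for a v
    using face_props(4)[OF pg fc[OF that(1)]] b1[OF that(2)] by blast
  show ?thesis
  proof (rule no_K6_linked_regions[where reg = "case_sum reg blob"])
    show "finite (Inl ` N \<union> Inr ` V)" using fin pg by (simp add: plane_graph_def)
    show "path_connected (case_sum reg blob x) \<and> case_sum reg blob x \<noteq> {}" if "x \<in> Inl ` N \<union> Inr ` V" for x
    proof -
      have "path_connected (blob v) \<and> blob v \<noteq> {}" if "v \<in> V" for v using b1[OF that] by blast
      then show ?thesis using that face_props(2,3)[OF pg fc] by auto
    qed
    show "case_sum reg blob x \<inter> case_sum reg blob y = {}"
      if "x \<in> Inl ` N \<union> Inr ` V" "y \<in> Inl ` N \<union> Inr ` V" "x \<noteq> y" for x y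
    proof -
      have ff: "reg a \<inter> reg b = {}" if "a \<in> N" "b \<in> N" "a \<noteq> b" for a b
        using faces_disjoint[OF fc[OF that(1)] fc[OF that(2)]] inj that unfolding inj_on_def by blast
      have fb': "blob v \<inter> reg a = {}" if "a \<in> N" "v \<in> V" for a v using fb[OF that] by blast
      show ?thesis using that by (elim UnE imageE) (simp_all add: ff fb fb' b2)
    qed
    show "linked (case_sum reg blob x) (case_sum reg blob y)"
      if "x \<in> Inl ` N \<union> Inr ` V" "y \<in> Inl ` N \<union> Inr ` V" "incidence reg x y" for x y
      using that lk by auto
  qed
qed

section \<open>Rooted decompositions and treewidth\<close>

definition adj :: "('a, 'b) pre_digraph \<Rightarrow> 'a \<Rightarrow> 'a \<Rightarrow> bool" where
  "adj G u v \<longleftrightarrow> (u, v) \<in> arcs_ends G \<or> (v, u) \<in> arcs_ends G"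

lemma symp_adj: "symp (adj G)"
  unfolding adj_def by (rule sympI) blast

lemma connected_iff_conn:
  assumes "finite (verts G)"
  shows "Digraph_Component.connected G \<longleftrightarrow> conn (adj G) (verts G)"
proof -
  have ends: "parcs (mk_symmetric G) = {(u, v). adj G u v}" "pverts (mk_symmetric G) = verts G"
    unfolding mk_symmetric_def adj_def by (auto simp: arcs_ends_def arc_to_ends_def)
  have con: "Digraph_Component.connected G \<longleftrightarrow>
     verts G \<noteq> {} \<and> (\<forall>u\<in>verts G. \<forall>v\<in>verts G. (u, v) \<in> rtrancl_on (verts G) {(u, v). adj G u v})"
    unfolding Digraph_Component.connected_def strongly_connected_def reachable_def by (simp add: ends)
  show ?thesis
  proof
    assume c: "Digraph_Component.connected G"
    show "conn (adj G) (verts G)" unfolding conn_def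
    proof (intro conjI allI impI)
      show "verts G \<noteq> {}" using c con by blast
      fix P assume P: "P \<subseteq> verts G \<and> P \<noteq> {} \<and> P \<noteq> verts G"
      then obtain u v where uv: "u \<in> P" "v \<in> verts G" "v \<notin> P" by blast
      then have r: "(u, v) \<in> rtrancl_on (verts G) {(u, v). adj G u v}" using c con P by blast
      show "touch (adj G) P (verts G - P)"
      proof (rule ccontr)
        assume n: "\<not> touch (adj G) P (verts G - P)"
        from r have "v \<in> P"
        proof (induction rule: rtrancl_on_induct)
          case base
          show ?case by (rule uv(1))
        next
          case (step y z)
          then show ?case using n unfolding touch_def by blast
        qed
        then show False using uv(3) by blast
      qed
    qed
  next
    assume c: "conn (adj G) (verts G)"
    define R where "R = rtrancl_on (verts G) {(u, v). adj G u v}"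
    have "\<forall>v\<in>verts G. (u, v) \<in> R" if "u \<in> verts G" for u
      using c assms that
    proof (induction rule: conn_induct)
      case base
      then show ?case using that unfolding R_def by blast
    next
      case (step T y z)
      have "(u, z) \<in> R" unfolding R_def
        by (rule rtrancl_on_into_rtrancl_on[of _ y]) (use step in \<open>auto simp: R_def\<close>)
      then show ?case using step.IH by blast
    qed
    then show "Digraph_Component.connected G" using con conn_nonempty[OF c] unfolding R_def by blast
  qed
qed

lemma arcs_ends_induce: "arcs_ends (G \<restriction> S) = {(u, v)\<in>arcs_ends G. u \<in> S \<and> v \<in> S}"
  unfolding arcs_ends_def arc_to_ends_def by auto

lemma connected_induce_iff:
  assumes "finite S"
  shows "Digraph_Component.connected (G \<restriction> S) \<longleftrightarrow> conn (adj G) S"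
proof -
  have "conn (adj (G \<restriction> S)) S \<longleftrightarrow> conn (adj G) S"
    by (rule iffI; erule conn_mono_rel) (auto simp: adj_def arcs_ends_induce)
  then show ?thesis using connected_iff_conn[of "G \<restriction> S"] assms by simp
qed

subsection \<open>From tree decompositions to rooted decompositions\<close>

lemma walk_of_vertices:
  assumes "successively (\<lambda>u v. (u, v) \<in> arcs_ends T) ws" "ws \<noteq> []"
  shows "\<exists>p. set p \<subseteq> arcs T \<and> pre_digraph.cas T (hd ws) p (last ws) \<and> pre_digraph.awalk_verts T (hd ws) p = ws"
  using assms
proof (induction ws rule: induct_list012)
  case (2 x)
  then show ?case by (intro exI[of _ "[]"]) (simp add: pre_digraph.cas.simps pre_digraph.awalk_verts.simps)
next
  case (3 x y zs)
  obtain p where p: "set p \<subseteq> arcs T" "pre_digraph.cas T y p (last (y # zs))" "pre_digraph.awalk_verts T y p = y # zs"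
    using 3 by auto
  obtain e where e: "e \<in> arcs T" "tail T e = x" "head T e = y"
    using 3(3) unfolding arcs_ends_def arc_to_ends_def by auto
  show ?case
    by (rule exI[of _ "e # p"]) (use p e in \<open>simp add: pre_digraph.cas.simps pre_digraph.awalk_verts.simps\<close>)
qed simp

text \<open>The first vertex of a longest path in \<open>N\<close> has all its neighbours from
  \<open>N\<close> on the path, and two of them would close a cycle. An arbitrary \<open>N\<close>
  is allowed because leaves are removed one after another.\<close>

lemma acyclic_has_leaf:
  assumes "graph T" "\<not> (\<exists>p. undirected_cycle T p)" "N \<subseteq> verts T" "N \<noteq> {}"
  shows "\<exists>l\<in>N. \<forall>y\<in>N. \<forall>z\<in>N. adj T l y \<longrightarrow> adj T l z \<longrightarrow> y = z"
proof (rule ccontr)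
  assume "\<not> ?thesis"
  then have two: "\<exists>y\<in>N. \<exists>z\<in>N. adj T l y \<and> adj T l z \<and> y \<noteq> z" if "l \<in> N" for l using that by blast
  interpret graph T by (rule assms(1))
  have fN: "finite N" using assms(3) finite_verts finite_subset by blast
  have adjE: "adj T x y \<longleftrightarrow> (x, y) \<in> arcs_ends T" for x y
    using sym_arcs unfolding adj_def symmetric_def by (meson symE)
  have irr: "\<not> adj T x x" for x
    using no_loops unfolding adjE arcs_ends_def arc_to_ends_def by auto
  let ?Q = "\<lambda>vs. vs \<noteq> [] \<and> distinct vs \<and> set vs \<subseteq> N \<and> successively (adj T) vs"
  obtain x0 where x0: "x0 \<in> N" using assms(4) by blast
  have "\<exists>vs. ?Q vs \<and> (\<forall>us. ?Q us \<longrightarrow> length us \<le> length vs)"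
  proof (rule ex_has_greatest_nat[of ?Q "[x0]"])
    show "?Q [x0]" using x0 by simp
    show "\<forall>vs. ?Q vs \<longrightarrow> length vs < Suc (card N)"
      using card_mono[OF fN] distinct_card by (metis less_Suc_eq_le)
  qed
  then obtain vs where vs: "?Q vs" "\<And>us. ?Q us \<Longrightarrow> length us \<le> length vs" by blast
  obtain x r where xr: "vs = x # r" using vs(1) by (cases vs) auto
  have nb: "y \<in> set vs" if "y \<in> N" "adj T x y" for y
  proof (rule ccontr)
    assume n: "y \<notin> set vs"
    have "adj T y x" using that(2) symp_adj by (meson sympE)
    then have "?Q (y # vs)" using vs(1) n that(1) xr by simp
    then show False using vs(2)[of "y # vs"] by simp
  qed
  have xN: "x \<in> N" using vs(1) xr by auto
  obtain y z where yz: "y \<in> N" "z \<in> N" "adj T x y" "adj T x z" "y \<noteq> z" using two[OF xN] by blast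
  \<comment> \<open>Only one of the two neighbours can follow \<open>x\<close> directly on the path;
    the other has index at least 2, so the closed walk has at least three arcs.\<close>
  have "\<exists>j. 2 \<le> j \<and> j < length vs \<and> adj T x (vs ! j)"
  proof -
    obtain i where i: "i < length vs" "vs ! i = y" using nb[OF yz(1,3)] by (auto simp: in_set_conv_nth)
    obtain k where k: "k < length vs" "vs ! k = z" using nb[OF yz(2,4)] by (auto simp: in_set_conv_nth)
    have "i \<noteq> 0" "k \<noteq> 0" using i k yz irr xr by (metis nth_Cons_0)+
    moreover have "i \<noteq> k" using i k yz(5) by blast
    ultimately have "2 \<le> i \<or> 2 \<le> k" by linarith
    then show ?thesis using i k yz by blast
  qed
  then obtain j where j: "2 \<le> j" "j < length vs" "adj T x (vs ! j)" by blast
  let ?c = "take (Suc j) vs"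
  let ?ws = "?c @ [x]"
  have c: "?c \<noteq> []" "hd ?c = x" "last ?c = vs ! j" "length ?c = Suc j"
    using j xr by (auto simp: last_conv_nth)
  have "successively (adj T) ?c"
    using vs(1) by (metis append_take_drop_id successively_append_iff)
  then have "successively (adj T) ?ws"
    using j(3) c symp_adj[of T] unfolding successively_append_iff by (auto dest: sympD)
  then have "successively (\<lambda>u v. (u, v) \<in> arcs_ends T) ?ws"
    by (rule successively_mono) (simp add: adjE)
  then obtain p where p: "set p \<subseteq> arcs T" "cas x p x" "awalk_verts x p = ?ws"
    using walk_of_vertices[of T ?ws] c by fastforce
  have "length ?ws = Suc (length p)"
    using p(3) length_awalk_verts by metis
  then have lp: "length p \<ge> 3" using c(4) j(1) by simp
  have "tl ?ws = tl ?c @ [x]" using c(1) by (cases ?c) auto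
  moreover have "distinct (tl ?c @ [x])"
  proof -
    have "distinct ?c" using vs(1) by simp
    then show ?thesis using c(1,2) by (cases ?c) auto
  qed
  ultimately have "distinct (tl (awalk_verts x p))" using p(3) by simp
  moreover have "awalk x p x" unfolding awalk_def using p(1,2) xN assms(3) by blast
  ultimately have "cycle p" unfolding cycle_def using lp by auto
  then show False using assms(2) lp unfolding undirected_cycle_def by blast
qed

text \<open>A cut of \<open>S - {l}\<close> extends to a cut of \<open>S\<close> with
  \<open>l\<close> on the side of its only neighbour \<open>r\<close>, and the crossing edge cannot
  start at \<open>l\<close>.\<close>

lemma conn_remove_leaf:
  assumes "symp F" "conn F S" "l \<in> S" "S \<noteq> {l}" "\<And>x. \<not> F x x"
    and leaf: "\<And>y z. y \<in> S \<Longrightarrow> z \<in> S \<Longrightarrow> F l y \<Longrightarrow> F l z \<Longrightarrow> y = z"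
  shows "conn F (S - {l})"
proof -
  have sF: "F x y \<longleftrightarrow> F y x" for x y using assms(1) by (meson sympE)
  have "\<not> S \<subseteq> {l}" using assms(3,4) by blast
  then obtain r where r: "r \<in> S" "r \<noteq> l" "F l r" using connD[OF assms(2,3), of "{l}"] by blast
  show ?thesis
  proof (rule connI[of r])
    show "r \<in> S - {l}" using r by blast
    fix P y assume P: "r \<in> P" "P \<subseteq> S - {l}" "y \<in> S - {l} - P"
    have "\<not> S \<subseteq> insert l P" using P(3) by blast
    then obtain a b where ab: "a \<in> S \<inter> insert l P" "b \<in> S - insert l P" "F a b"
      using connD[OF assms(2), of r "insert l P"] r(1) P(1) by blast
    have "a \<noteq> l" using ab leaf[of b r] r P(1) by blast
    then show "touch F P (S - {l} - P)" using ab unfolding touch_def by blast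
  qed (rule assms(1))
qed

text \<open>The relation of sharing a bag turns bags into cliques, so a leaf bag can be hung on by
  its intersection with the rest, which lies in the bag of the leaf's neighbour. The edges of the
  graph are a subrelation.\<close>

lemma td_of_tree:
  assumes "finite N" "N \<noteq> {}" "symp F" "\<And>x. \<not> F x x"
    and "\<And>M. M \<subseteq> N \<Longrightarrow> M \<noteq> {} \<Longrightarrow> \<exists>l\<in>M. \<forall>y\<in>M. \<forall>z\<in>M. F l y \<longrightarrow> F l z \<longrightarrow> y = z"
    and "conn F N" "\<And>v. v \<in> (\<Union>x\<in>N. B x) \<Longrightarrow> conn F {x\<in>N. v \<in> B x}"
    and "\<And>x. x \<in> N \<Longrightarrow> finite (B x) \<and> card (B x) \<le> w"
  shows "\<exists>S. td (\<lambda>u v. \<exists>x\<in>N. u \<in> B x \<and> v \<in> B x) w (\<Union>x\<in>N. B x) S"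
  using assms
proof (induction "card N" arbitrary: N rule: less_induct)
  case less
  obtain l where l: "l \<in> N" "\<And>y z. y \<in> N \<Longrightarrow> z \<in> N \<Longrightarrow> F l y \<Longrightarrow> F l z \<Longrightarrow> y = z"
    using less.prems(5)[OF order_refl less.prems(2)] by blast
  show ?case
  proof (cases "N = {l}")
    case True
    then show ?thesis using td.leaf[of "B l" w] less.prems(8)[of l] l(1) by auto
  next
    case False
    let ?N = "N - {l}"
    have "\<not> N \<subseteq> {l}" using l(1) False by blast
    then obtain r where r: "r \<in> N" "r \<noteq> l" "F l r" using connD[OF less.prems(6) l(1), of "{l}"] by blast
    have IH: "\<exists>S. td (\<lambda>u v. \<exists>x\<in>?N. u \<in> B x \<and> v \<in> B x) w (\<Union>x\<in>?N. B x) S"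
    proof (rule less.hyps)
      show "card ?N < card N" using l(1) less.prems(1) by (meson card_Diff1_less)
      show "conn F ?N" by (rule conn_remove_leaf[OF less.prems(3,6) l(1) False less.prems(4)]) (rule l(2))
      show "conn F {x \<in> ?N. v \<in> B x}" if v: "v \<in> (\<Union>x\<in>?N. B x)" for v
      proof -
        have c: "conn F {x \<in> N. v \<in> B x}" using less.prems(7) v by blast
        have e: "{x \<in> ?N. v \<in> B x} = {x \<in> N. v \<in> B x} - {l}" by blast
        show ?thesis
        proof (cases "l \<in> {x \<in> N. v \<in> B x}")
          case True
          have ne: "{x \<in> N. v \<in> B x} \<noteq> {l}" using v by blast
          show ?thesis unfolding e
            by (rule conn_remove_leaf[OF less.prems(3) c True ne less.prems(4)]) (use l(2) in blast)
        next
          case False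
          then have "{x \<in> ?N. v \<in> B x} = {x \<in> N. v \<in> B x}" by blast
          then show ?thesis using c by simp
        qed
      qed
      show "\<exists>l\<in>M. \<forall>y\<in>M. \<forall>z\<in>M. F l y \<longrightarrow> F l z \<longrightarrow> y = z" if "M \<subseteq> ?N" "M \<noteq> {}" for M
        using less.prems(5)[of M] that by blast
    qed (use less.prems r in auto)
    let ?E = "\<lambda>u v. \<exists>x\<in>N. u \<in> B x \<and> v \<in> B x"
    let ?A = "\<Union>x\<in>?N. B x"
    \<comment> \<open>The nodes containing \<open>v\<close> are connected, and the only way out of
      the leaf \<open>l\<close> leads to \<open>r\<close>.\<close>
    have Kr: "v \<in> B r" if v: "v \<in> ?A" "v \<in> B l" for v
    proof -
      have c: "conn F {x \<in> N. v \<in> B x}" using less.prems(7) v l(1) by blast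
      have "\<not> {x \<in> N. v \<in> B x} \<subseteq> {l}" using v(1) by blast
      then obtain b where b: "b \<in> N" "v \<in> B b" "F l b" using connD[OF c, of l "{l}"] v(2) l(1) by blast
      then have "b = r" using l(2) r by blast
      then show ?thesis using b by simp
    qed
    obtain S where S: "td (\<lambda>u v. \<exists>x\<in>?N. u \<in> B x \<and> v \<in> B x) w ?A S" using IH by blast
    have t1: "td ?E w ?A S"
    proof (rule td_mono[OF S order_refl])
      fix x y assume xy: "x \<in> ?A" "y \<in> ?A" "?E x y"
      then show "\<exists>z\<in>?N. x \<in> B z \<and> y \<in> B z" using Kr[of x] Kr[of y] r by (metis DiffI singletonD)
    qed
    have t2: "td ?E w (B l) (B l)" using less.prems(8)[OF l(1)] by (intro td.leaf) auto
    have "td ?E w (?A \<union> B l) S"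
    proof (rule td_attach_clique[OF t1 t2, of "?A \<inter> B l"])
      show "no_cross ?E ?A (B l)" unfolding no_cross_def by blast
      show "?E x y" if "x \<in> ?A \<inter> B l" "y \<in> ?A \<inter> B l" for x y using that l(1) by blast
    qed auto
    moreover have "?A \<union> B l = (\<Union>x\<in>N. B x)" using l(1) by blast
    ultimately show ?thesis by auto
  qed
qed

lemma td_of_tree_decomposition:
  assumes td: "tree_decomposition G T B" and fin: "finite (verts G)" and w: "\<And>x. x \<in> verts T \<Longrightarrow> card (B x) \<le> w"
  shows "\<exists>S. td (adj G) w (verts G) S"
proof -
  have T: "graph T" "Digraph_Component.connected T" "\<not> (\<exists>p. undirected_cycle T p)"
    and U: "(\<Union>x\<in>verts T. B x) = verts G"
    and e: "\<And>u v. (u, v) \<in> arcs_ends G \<Longrightarrow> \<exists>x\<in>verts T. u \<in> B x \<and> v \<in> B x"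
    and c: "\<And>v. v \<in> verts G \<Longrightarrow> Digraph_Component.connected (T \<restriction> {x \<in> verts T. v \<in> B x})"
    using td unfolding tree_decomposition_def undirected_tree_def by auto
  interpret graph T by (rule T(1))
  have con: "conn (adj T) (verts T)" using T(2) connected_iff_conn[OF finite_verts] by simp
  have "\<exists>S. td (\<lambda>u v. \<exists>x\<in>verts T. u \<in> B x \<and> v \<in> B x) w (\<Union>x\<in>verts T. B x) S"
  proof (rule td_of_tree[of _ "adj T"])
    show "finite (verts T)" by simp
    show "verts T \<noteq> {}" using conn_nonempty[OF con] .
    show "symp (adj T)" by (rule symp_adj)
    show "\<not> adj T x x" for x using no_loops unfolding adj_def arcs_ends_def arc_to_ends_def by auto
    show "\<exists>l\<in>M. \<forall>y\<in>M. \<forall>z\<in>M. adj T l y \<longrightarrow> adj T l z \<longrightarrow> y = z" if "M \<subseteq> verts T" "M \<noteq> {}" for M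
      using acyclic_has_leaf[OF T(1,3) that] .
    show "conn (adj T) (verts T)" by (rule con)
    show "conn (adj T) {x \<in> verts T. v \<in> B x}" if v: "v \<in> (\<Union>x\<in>verts T. B x)" for v
    proof -
      have "finite {x \<in> verts T. v \<in> B x}" by simp
      then show ?thesis using c[of v] v U connected_induce_iff by blast
    qed
    show "finite (B x) \<and> card (B x) \<le> w" if x: "x \<in> verts T" for x
    proof -
      have "B x \<subseteq> verts G" using U x by blast
      then show ?thesis using fin w[OF x] finite_subset by blast
    qed
  qed
  then obtain S where "td (\<lambda>u v. \<exists>x\<in>verts T. u \<in> B x \<and> v \<in> B x) w (verts G) S" unfolding U by blast
  then have "td (adj G) w (verts G) S" by (rule td_mono) (use e in \<open>auto simp: adj_def\<close>)
  then show ?thesis by blast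
qed

subsection \<open>From rooted decompositions to tree decompositions\<close>

text \<open>A rooted tree on \<open>{..<n}\<close> with root \<open>n - 1\<close>, in which every
  parent has a larger index than its child. Two arrays combine by a shift, and acyclicity can be
  read off from the smallest node.\<close>

definition parent_array :: "nat \<Rightarrow> (nat \<Rightarrow> nat) \<Rightarrow> bool" where
  "parent_array n p \<longleftrightarrow> n \<ge> 1 \<and> (\<forall>i. Suc i < n \<longrightarrow> i < p i \<and> p i < n)"

definition array_tree :: "nat \<Rightarrow> (nat \<Rightarrow> nat) \<Rightarrow> (nat, nat \<times> nat) pre_digraph" where
  "array_tree n p = with_proj \<lparr>pverts = {..<n},
     parcs = {(i, j). i < n \<and> j < n \<and> ((Suc i < n \<and> j = p i) \<or> (Suc j < n \<and> i = p j))}\<rparr>"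

lemma adj_array_tree:
  "adj (array_tree n p) i j \<longleftrightarrow> i < n \<and> j < n \<and> ((Suc i < n \<and> j = p i) \<or> (Suc j < n \<and> i = p j))"
  unfolding adj_def array_tree_def by auto

text \<open>Parents inside \<open>X\<close> lead up to \<open>t\<close>: in any cut, the largest
  node on the side without \<open>t\<close> has its parent on the other side.\<close>

lemma conn_array_tree:
  assumes "parent_array n p" "X \<subseteq> {..<n}" "t \<in> X" "\<And>i. i \<in> X \<Longrightarrow> i \<noteq> t \<Longrightarrow> Suc i < n \<and> p i \<in> X"
  shows "conn (adj (array_tree n p)) X"
proof (rule connI[OF assms(3) _ symp_adj])
  fix P y assume P: "t \<in> P" "P \<subseteq> X" "y \<in> X - P"
  let ?m = "Max (X - P)"
  have fin: "finite (X - P)" using assms(2) finite_subset by blast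
  then have m: "?m \<in> X - P" using P(3) by (intro Max_in) auto
  then have pm: "Suc ?m < n" "p ?m \<in> X" using assms(4)[of ?m] P(1) by auto
  then have "?m < p ?m" using assms(1) unfolding parent_array_def by blast
  then have "p ?m \<notin> X - P" using Max_ge[OF fin, of "p ?m"] by auto
  then have "p ?m \<in> P" using pm by blast
  moreover have "adj (array_tree n p) (p ?m) ?m" unfolding adj_array_tree using pm assms(2) by auto
  ultimately show "touch (adj (array_tree n p)) P (X - P)" using m unfolding touch_def by blast
qed

lemma successively_walk:
  assumes "set q \<subseteq> arcs T" "pre_digraph.cas T u q v"
  shows "successively (\<lambda>u v. (u, v) \<in> arcs_ends T) (pre_digraph.awalk_verts T u q) \<and>
    hd (pre_digraph.awalk_verts T u q) = u \<and> last (pre_digraph.awalk_verts T u q) = v \<and>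
    length (pre_digraph.awalk_verts T u q) = Suc (length q)"
  using assms
proof (induction q arbitrary: u)
  case Nil
  then show ?case by (simp add: pre_digraph.cas.simps pre_digraph.awalk_verts.simps)
next
  case (Cons e q)
  have t: "tail T e = u" "pre_digraph.cas T (head T e) q v" using Cons.prems(2) by (simp_all add: pre_digraph.cas.simps)
  let ?r = "pre_digraph.awalk_verts T (head T e) q"
  have IH: "successively (\<lambda>u v. (u, v) \<in> arcs_ends T) ?r" "hd ?r = head T e" "last ?r = v" "length ?r = Suc (length q)"
    using Cons.IH[OF _ t(2)] Cons.prems(1) by auto
  have "?r \<noteq> []" using IH(4) by auto
  moreover have "(u, head T e) \<in> arcs_ends T" using Cons.prems(1) t(1) unfolding arcs_ends_def arc_to_ends_def by force
  ultimately show ?case using IH t(1) by (simp add: pre_digraph.awalk_verts.simps successively_Cons)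
qed

text \<open>Both neighbours of the smallest node on a cycle are at least as large, so both are its
  parent; but a cycle of length at least 3 makes them distinct.\<close>

lemma array_tree_acyclic:
  assumes pa: "parent_array n p"
  shows "\<not> undirected_cycle (array_tree n p) q"
proof
  let ?T = "array_tree n p"
  assume cyc: "undirected_cycle ?T q"
  then obtain u where u: "pre_digraph.awalk ?T u q u" "distinct (tl (pre_digraph.awalk_verts ?T u q))"
    and len: "length q \<ge> 3"
    unfolding undirected_cycle_def pre_digraph.cycle_def by blast
  have q: "set q \<subseteq> arcs ?T" "pre_digraph.cas ?T u q u" using u(1) unfolding pre_digraph.awalk_def by auto
  let ?ws = "pre_digraph.awalk_verts ?T u q"
  note W = successively_walk[OF q]
  obtain c where ws: "?ws = u # c" using W by (cases ?ws) auto
  have dc: "distinct c" using u(2) ws by simp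
  have lc: "length c = length q" using W ws by simp
  let ?m = "length c"
  have m3: "?m \<ge> 3" using lc len by simp
  have lastc: "last c = u" using W ws m3 by (auto split: if_splits)
  have suc: "successively (adj ?T) (u # c)"
    by (rule successively_mono[of "\<lambda>u v. (u, v) \<in> arcs_ends ?T"]) (use W ws in \<open>auto simp: adj_def\<close>)
  have step: "adj ?T (c ! i) (c ! (Suc i mod ?m))" if i: "i < ?m" for i
  proof (cases "Suc i < ?m")
    case True
    have "adj ?T ((u # c) ! Suc i) ((u # c) ! Suc (Suc i))"
      using suc True successively_nth[of "adj ?T" "u # c" "Suc i"] by simp
    then show ?thesis using True by simp
  next
    case False
    then have "Suc i = ?m" using i by simp
    then have "c ! i = u" using lastc m3 by (metis diff_Suc_1 last_conv_nth list.size(3) not_numeral_le_zero)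
    moreover have "adj ?T ((u # c) ! 0) ((u # c) ! Suc 0)"
      using suc m3 successively_nth[of "adj ?T" "u # c" 0] by (cases c) auto
    ultimately show ?thesis using \<open>Suc i = ?m\<close> by simp
  qed
  have ne: "set c \<noteq> {}" using m3 by auto
  have "Min (set c) \<in> set c" using ne by simp
  then obtain k where k: "k < ?m" "c ! k = Min (set c)" by (auto simp: in_set_conv_nth)
  have up: "j = p (c ! k)" if "adj ?T (c ! k) j" "j \<in> set c" for j
  proof -
    have "c ! k \<le> j" using that(2) k(2) by simp
    then show ?thesis using that(1) pa unfolding adj_array_tree parent_array_def by (metis leD)
  qed
  let ?s = "Suc k mod ?m"
  obtain l where l: "l < ?m" "Suc l mod ?m = k" "l \<noteq> ?s"
  proof (cases "k = 0")
    case True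
    have "Suc (?m - 1) = ?m" using m3 by simp
    then have "Suc (?m - 1) mod ?m = k" using True by simp
    then show ?thesis by (rule that[of "?m - 1", rotated]) (use True m3 in auto)
  next
    case False
    show ?thesis
    proof (rule that[of "k - 1"])
      show "k - 1 \<noteq> ?s" using False k m3 by (cases "Suc k = ?m") auto
    qed (use False k in auto)
  qed
  have s: "?s < ?m" by (rule mod_less_divisor) (use m3 in linarith)
  have "c ! ?s = p (c ! k)" using up[OF step[OF k(1)]] s by simp
  moreover have "adj ?T (c ! k) (c ! l)" using step[OF l(1)] l(2) symp_adj by (metis sympE)
  then have "c ! l = p (c ! k)" using up l(1) by simp
  ultimately have "c ! l = c ! ?s" by simp
  then show False using dc l s by (simp add: nth_eq_iff_index_eq)
qed

lemma undirected_tree_array_tree: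
  assumes pa: "parent_array n p"
  shows "undirected_tree (array_tree n p)"
proof -
  let ?H = "\<lparr>pverts = {..<n}, parcs = {(i, j). i < n \<and> j < n \<and> ((Suc i < n \<and> j = p i) \<or> (Suc j < n \<and> i = p j))}\<rparr>"
  have "pair_graph ?H"
  proof unfold_locales
    show "finite (parcs ?H)" by (rule finite_subset[of _ "{..<n} \<times> {..<n}"]) auto
    show "symmetric (with_proj ?H)" unfolding symmetric_def by (auto simp: sym_def)
    show "fst e \<noteq> snd e" if "e \<in> parcs ?H" for e
      using that pa unfolding parent_array_def by fastforce
  qed auto
  then interpret pair_graph ?H .
  have g: "graph (array_tree n p)" unfolding array_tree_def by (rule pair_graphD_graph)
  have "conn (adj (array_tree n p)) {..<n}"
    by (rule conn_array_tree[OF pa order_refl, of "n - 1"]) (use pa in \<open>auto simp: parent_array_def\<close>)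
  moreover have "verts (array_tree n p) = {..<n}" unfolding array_tree_def by simp
  ultimately have "Digraph_Component.connected (array_tree n p)" using connected_iff_conn[of "array_tree n p"] by simp
  then show ?thesis unfolding undirected_tree_def using g array_tree_acyclic[OF pa] by blast
qed

text \<open>The last clause encodes connectedness of the nodes containing \<open>v\<close> by a top
  node \<open>t\<close>: every other such node passes \<open>v\<close> on to its parent.\<close>

lemma td_parent_array:
  assumes "td E w A S"
  shows "\<exists>n p B. parent_array n p \<and> B (n - 1) = S \<and> (\<Union>i\<in>{..<n}. B i) = A \<and> (\<forall>i<n. card (B i) \<le> w) \<and>
     (\<forall>x\<in>A. \<forall>y\<in>A. E x y \<longrightarrow> (\<exists>i<n. x \<in> B i \<and> y \<in> B i)) \<and>
     (\<forall>v\<in>A. \<exists>t<n. v \<in> B t \<and> (\<forall>i<n. v \<in> B i \<and> i \<noteq> t \<longrightarrow> Suc i < n \<and> v \<in> B (p i)))"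
  using assms
proof (induction rule: td.induct)
  case (leaf S)
  show ?case by (intro exI[of _ 1] exI[of _ "\<lambda>i. 0"] exI[of _ "\<lambda>i. S"]) (use leaf in \<open>auto simp: parent_array_def\<close>)
next
  case (attach A S C S')
  obtain n1 p1 B1 where 1: "parent_array n1 p1" "B1 (n1 - 1) = S" "(\<Union>i\<in>{..<n1}. B1 i) = A" "\<forall>i<n1. card (B1 i) \<le> w"
    "\<forall>x\<in>A. \<forall>y\<in>A. E x y \<longrightarrow> (\<exists>i<n1. x \<in> B1 i \<and> y \<in> B1 i)"
    "\<forall>v\<in>A. \<exists>t<n1. v \<in> B1 t \<and> (\<forall>i<n1. v \<in> B1 i \<and> i \<noteq> t \<longrightarrow> Suc i < n1 \<and> v \<in> B1 (p1 i))"
    using attach.IH(1) by (elim exE conjE) (rule that)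
  obtain n2 p2 B2 where 2: "parent_array n2 p2" "B2 (n2 - 1) = S'" "(\<Union>i\<in>{..<n2}. B2 i) = C" "\<forall>i<n2. card (B2 i) \<le> w"
    "\<forall>x\<in>C. \<forall>y\<in>C. E x y \<longrightarrow> (\<exists>i<n2. x \<in> B2 i \<and> y \<in> B2 i)"
    "\<forall>v\<in>C. \<exists>t<n2. v \<in> B2 t \<and> (\<forall>i<n2. v \<in> B2 i \<and> i \<noteq> t \<longrightarrow> Suc i < n2 \<and> v \<in> B2 (p2 i))"
    using attach.IH(2) by (elim exE conjE) (rule that)
  define n where "n = n1 + n2"
  \<comment> \<open>The first array keeps its indices, the second is shifted by \<open>n1\<close>,
    and the root \<open>n1 - 1\<close> of the first becomes a child of the common root
    \<open>n - 1\<close>.\<close>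
  define p where "p = (\<lambda>i. if Suc i < n1 then p1 i else if Suc i = n1 then n - 1 else p2 (i - n1) + n1)"
  define B where "B = (\<lambda>i. if i < n1 then B1 i else B2 (i - n1))"
  have n12: "n1 \<ge> 1" "n2 \<ge> 1" using 1(1) 2(1) unfolding parent_array_def by auto
  have p1: "i < p1 i" "p1 i < n1" if "Suc i < n1" for i using 1(1) that unfolding parent_array_def by auto
  have p2: "i < p2 i" "p2 i < n2" if "Suc i < n2" for i using 2(1) that unfolding parent_array_def by auto
  have Bl: "B i = B1 i" if "i < n1" for i using that unfolding B_def by simp
  have Br: "B (i + n1) = B2 i" for i unfolding B_def by simp
  have pl: "p i = p1 i" if "Suc i < n1" for i using that unfolding p_def by simp
  have pm: "p (n1 - 1) = n - 1" using n12 unfolding p_def by simp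
  have pr: "p (i + n1) = p2 i + n1" for i unfolding p_def by simp
  have split: "i < n1 \<or> (\<exists>j<n2. i = j + n1)" if "i < n" for i
  proof (cases "i < n1")
    case False
    then have "i - n1 < n2" "i = (i - n1) + n1" using that unfolding n_def by auto
    then show ?thesis by blast
  qed simp
  have root: "B (n - 1) = S'" using 2(2) n12 Br[of "n2 - 1"] unfolding n_def by (simp add: add.commute)
  show ?case
  proof (rule exI[of _ n], rule exI[of _ p], rule exI[of _ B], intro conjI allI impI ballI)
    show "parent_array n p" unfolding parent_array_def
    proof (intro conjI allI impI)
      show "1 \<le> n" using n12 unfolding n_def by simp
      fix i assume i: "Suc i < n"
      have "i < p i \<and> p i < n"
      proof -
        consider "Suc i < n1" | "Suc i = n1" | "i \<ge> n1" by linarith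
        then show ?thesis
        proof cases
          case 1
          then show ?thesis using p1[OF 1] pl[OF 1] unfolding n_def by simp
        next
          case 2
          then have "i = n1 - 1" by simp
          then have "p i = n - 1" using pm by simp
          then show ?thesis using i by simp
        next
          case 3
          then have "Suc (i - n1) < n2" using i unfolding n_def by simp
          then show ?thesis using p2[of "i - n1"] pr[of "i - n1"] 3 unfolding n_def by simp
        qed
      qed
      then show "i < p i" "p i < n" by auto
    qed
    show "B (n - 1) = S'" by (rule root)
    show "(\<Union>i\<in>{..<n}. B i) = A \<union> C"
    proof (intro equalityI subsetI)
      fix x assume "x \<in> (\<Union>i\<in>{..<n}. B i)"
      then obtain i where i: "i < n" "x \<in> B i" by auto
      then show "x \<in> A \<union> C" using split[OF i(1)] Bl Br 1(3) 2(3) by auto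
    next
      fix x assume "x \<in> A \<union> C"
      then consider i where "i < n1" "x \<in> B1 i" | j where "j < n2" "x \<in> B2 j" using 1(3) 2(3) by blast
      then show "x \<in> (\<Union>i\<in>{..<n}. B i)"
      proof cases
        case 1
        then show ?thesis using Bl[of i] unfolding n_def by (intro UN_I[of i]) auto
      next
        case 2
        then show ?thesis using Br[of j] unfolding n_def by (intro UN_I[of "j + n1"]) auto
      qed
    qed
    show "card (B i) \<le> w" if "i < n" for i using split[OF that] 1(4) 2(4) Bl Br by auto
    show "\<exists>i<n. x \<in> B i \<and> y \<in> B i" if xy: "x \<in> A \<union> C" "y \<in> A \<union> C" "E x y" for x y
    proof -
      have "(x \<in> A \<and> y \<in> A) \<or> (x \<in> C \<and> y \<in> C)" using attach.hyps(4) xy unfolding no_cross_def by blast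
      then show ?thesis
      proof
        assume "x \<in> A \<and> y \<in> A"
        then obtain i where "i < n1" "x \<in> B1 i \<and> y \<in> B1 i" using 1(5) xy(3) by blast
        then show ?thesis using Bl[of i] unfolding n_def by (intro exI[of _ i]) auto
      next
        assume "x \<in> C \<and> y \<in> C"
        then obtain j where "j < n2" "x \<in> B2 j \<and> y \<in> B2 j" using 2(5) xy(3) by blast
        then show ?thesis using Br[of j] unfolding n_def by (intro exI[of _ "j + n1"]) auto
      qed
    qed
    show "\<exists>t<n. v \<in> B t \<and> (\<forall>i<n. v \<in> B i \<and> i \<noteq> t \<longrightarrow> Suc i < n \<and> v \<in> B (p i))" if v: "v \<in> A \<union> C" for v
    proof (cases "v \<in> C")
      case True
      obtain t where t: "t < n2" "v \<in> B2 t" "\<And>i. i < n2 \<Longrightarrow> v \<in> B2 i \<Longrightarrow> i \<noteq> t \<Longrightarrow> Suc i < n2 \<and> v \<in> B2 (p2 i)"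
        using 2(6) True by blast
      have "Suc i < n \<and> v \<in> B (p i)" if i: "i < n" "v \<in> B i" "i \<noteq> t + n1" for i
        using split[OF i(1)]
      proof
        assume l: "i < n1"
        then have vi: "v \<in> B1 i" using i(2) Bl by simp
        then have vA: "v \<in> A" using 1(3) l by blast
        then have vS: "v \<in> S" "v \<in> S'" using True attach.hyps(3) by blast+
        have sn: "Suc i < n" using l n12 unfolding n_def by simp
        obtain t1 where t1: "\<And>i. i < n1 \<Longrightarrow> v \<in> B1 i \<Longrightarrow> i \<noteq> t1 \<Longrightarrow> Suc i < n1 \<and> v \<in> B1 (p1 i)"
          using 1(6) vA by blast
        \<comment> \<open>\<open>v\<close> is in the root bag \<open>S\<close> of the first array,
          and the root has no parent there, so it is the top node of \<open>v\<close>.\<close>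
        have t1e: "t1 = n1 - 1" using t1[of "n1 - 1"] vS(1) 1(2) n12 by fastforce
        show ?thesis
        proof (cases "i = n1 - 1")
          case True
          then show ?thesis using sn pm root vS(2) by simp
        next
          case False
          then have s: "Suc i < n1" "v \<in> B1 (p1 i)" using t1[OF l vi] t1e by auto
          then show ?thesis using sn pl[OF s(1)] Bl[OF p1(2)[OF s(1)]] by simp
        qed
      next
        assume "\<exists>j<n2. i = j + n1"
        then obtain j where j: "j < n2" "i = j + n1" by blast
        then have "Suc j < n2 \<and> v \<in> B2 (p2 j)" using t(3)[of j] i Br by auto
        then show ?thesis using j pr[of j] Br[of "p2 j"] unfolding n_def by simp
      qed
      then show ?thesis using t Br[of t] unfolding n_def by (intro exI[of _ "t + n1"]) auto
    next
      case False
      then have vA: "v \<in> A" using v by blast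
      obtain t where t: "t < n1" "v \<in> B1 t" "\<And>i. i < n1 \<Longrightarrow> v \<in> B1 i \<Longrightarrow> i \<noteq> t \<Longrightarrow> Suc i < n1 \<and> v \<in> B1 (p1 i)"
        using 1(6) vA by blast
      have "Suc i < n \<and> v \<in> B (p i)" if i: "i < n" "v \<in> B i" "i \<noteq> t" for i
        using split[OF i(1)]
      proof
        assume l: "i < n1"
        then have s: "Suc i < n1" "v \<in> B1 (p1 i)" using t(3)[OF l] i Bl by auto
        then show ?thesis using pl[OF s(1)] Bl[OF p1(2)[OF s(1)]] unfolding n_def by simp
      next
        assume "\<exists>j<n2. i = j + n1"
        then have "v \<in> C" using i(2) Br 2(3) by auto
        then show ?thesis using False by blast
      qed
      then show ?thesis using t Bl[of t] unfolding n_def by (intro exI[of _ t]) auto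
    qed
  qed
qed

lemma tree_decomposition_of_td:
  assumes "td E w (verts G) S" "\<And>u v. (u, v) \<in> arcs_ends G \<Longrightarrow> u \<in> verts G \<and> v \<in> verts G \<and> E u v"
  obtains T :: "(nat, nat \<times> nat) pre_digraph" and B
  where "tree_decomposition G T B" "decomposition_width T B \<le> int w - 1"
proof -
  obtain n p B where pa: "parent_array n p" and U: "(\<Union>i\<in>{..<n}. B i) = verts G" and w: "\<forall>i<n. card (B i) \<le> w"
    and e: "\<forall>x\<in>verts G. \<forall>y\<in>verts G. E x y \<longrightarrow> (\<exists>i<n. x \<in> B i \<and> y \<in> B i)"
    and c: "\<forall>v\<in>verts G. \<exists>t<n. v \<in> B t \<and> (\<forall>i<n. v \<in> B i \<and> i \<noteq> t \<longrightarrow> Suc i < n \<and> v \<in> B (p i))"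
    using td_parent_array[OF assms(1)] by (elim exE conjE) (rule that)
  let ?T = "array_tree n p"
  have vT: "verts ?T = {..<n}" unfolding array_tree_def by simp
  have n1: "n \<ge> 1" and pn: "\<And>i. Suc i < n \<Longrightarrow> p i < n" using pa unfolding parent_array_def by auto
  have "tree_decomposition G ?T B" unfolding tree_decomposition_def vT
  proof (intro conjI ballI)
    show "undirected_tree ?T" by (rule undirected_tree_array_tree[OF pa])
    show "(\<Union>x\<in>{..<n}. B x) = verts G" by (rule U)
    show "case z of (u, v) \<Rightarrow> \<exists>x\<in>{..<n}. u \<in> B x \<and> v \<in> B x" if "z \<in> arcs_ends G" for z
      using that assms(2) e by (cases z) blast
    show "Digraph_Component.connected (?T \<restriction> {x \<in> {..<n}. v \<in> B x})" if v: "v \<in> verts G" for v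
    proof -
      obtain t where t: "t < n" "v \<in> B t" "\<And>i. i < n \<Longrightarrow> v \<in> B i \<Longrightarrow> i \<noteq> t \<Longrightarrow> Suc i < n \<and> v \<in> B (p i)"
        using c v by blast
      have "conn (adj ?T) {x \<in> {..<n}. v \<in> B x}"
        by (rule conn_array_tree[OF pa, of _ t]) (use t pn in auto)
      moreover have "finite {x \<in> {..<n}. v \<in> B x}" by simp
      ultimately show ?thesis using connected_induce_iff by blast
    qed
  qed
  moreover have "Max ((\<lambda>x. card (B x)) ` verts ?T) \<le> w" unfolding vT using n1 w by (auto simp: lessThan_empty_iff)
  then have "decomposition_width ?T B \<le> int w - 1" unfolding decomposition_width_def by simp
  ultimately show ?thesis using that by blast
qed

lemma decomposition_width_ge: "decomposition_width T B \<ge> -1"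
  unfolding decomposition_width_def by simp

lemma treewidth_le:
  assumes "td E w (verts G) S" "\<And>u v. (u, v) \<in> arcs_ends G \<Longrightarrow> u \<in> verts G \<and> v \<in> verts G \<and> E u v"
  shows "treewidth G \<le> int w - 1"
proof -
  obtain T :: "(nat, nat \<times> nat) pre_digraph" and B where T: "tree_decomposition G T B" "decomposition_width T B \<le> int w - 1"
    using tree_decomposition_of_td[OF assms] by blast
  have "treewidth G \<le> decomposition_width T B" unfolding treewidth_def
    by (rule cInf_lower) (use T decomposition_width_ge in \<open>auto simp: bdd_below_def\<close>)
  then show ?thesis using T(2) by simp
qed

lemma td_of_treewidth:
  assumes fin: "finite (verts G)" and wf: "\<And>u v. (u, v) \<in> arcs_ends G \<Longrightarrow> u \<in> verts G \<and> v \<in> verts G"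
    and w: "treewidth G \<le> int w - 1"
  shows "\<exists>S. td (adj G) w (verts G) S"
proof -
  let ?W = "{decomposition_width T B | (T :: (nat, nat \<times> nat) pre_digraph) B. tree_decomposition G T B}"
  \<comment> \<open>The trivial decomposition shows that the set of widths is nonempty; otherwise
    its infimum would carry no information.\<close>
  have "td (adj G) (card (verts G)) (verts G) (verts G)" by (rule td.leaf[OF fin order_refl])
  moreover have "u \<in> verts G \<and> v \<in> verts G \<and> adj G u v" if "(u, v) \<in> arcs_ends G" for u v
    using wf[OF that] that unfolding adj_def by blast
  ultimately obtain T :: "(nat, nat \<times> nat) pre_digraph" and B where "tree_decomposition G T B"
    by (rule tree_decomposition_of_td)
  then have ne: "?W \<noteq> {}" by blast
  have "Inf ?W < int w" using w unfolding treewidth_def by simp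
  then obtain x where "x \<in> ?W" "x < int w" using cInf_lessD[OF ne] by blast
  then obtain T :: "(nat, nat \<times> nat) pre_digraph" and B where T: "tree_decomposition G T B" "decomposition_width T B < int w"
    by blast
  have "finite (verts T)"
    using T(1) unfolding tree_decomposition_def undirected_tree_def by (meson graph.axioms(1) digraph.axioms(1) fin_digraph.finite_verts)
  then have "card (B x) \<le> Max ((\<lambda>x. card (B x)) ` verts T)" if "x \<in> verts T" for x using that by simp
  moreover have "Max ((\<lambda>x. card (B x)) ` verts T) \<le> w" using T(2) unfolding decomposition_width_def by simp
  ultimately have "card (B x) \<le> w" if "x \<in> verts T" for x using that by (meson le_trans)
  then show ?thesis using td_of_tree_decomposition[OF T(1) fin] by blast
qed

section \<open>Map graphs\<close>

lemma treewidth_remove_none: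
  assumes "wf_digraph G"
  shows "treewidth (remove_verts G {}) = treewidth G"
proof -
  interpret wf_digraph G by (rule assms)
  have "verts (remove_verts G {}) = verts G" unfolding remove_verts_def by simp
  moreover have "arcs_ends (remove_verts G {}) = arcs_ends G"
    unfolding remove_verts_def arcs_ends_induce by (auto simp: arcs_ends_def arc_to_ends_def)
  ultimately show ?thesis unfolding treewidth_def tree_decomposition_def by simp
qed

text \<open>The map is carried over to the vertices of \<open>G\<close> along the isomorphism.
  Finiteness of \<open>G\<close> comes from excluding a clique, not from counting faces.\<close>

lemma map_graph_incidence:
  fixes G :: "('a, 'b) pre_digraph"
  assumes "map_graph G" "complete_free t G"
  obtains V E and reg :: "'a \<Rightarrow> complex set" where
    "wf_digraph G" "plane_graph V E" "finite (verts G)" "inj_on reg (verts G)"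
    "\<And>a. a \<in> verts G \<Longrightarrow> closed_face V E (reg a)"
    "\<And>u v. (u, v) \<in> arcs_ends G \<longleftrightarrow>
       u \<in> verts G \<and> v \<in> verts G \<and> u \<noteq> v \<and> (\<exists>z\<in>V. z \<in> frontier (reg u) \<and> z \<in> frontier (reg v))"
    "\<And>z. z \<in> V \<Longrightarrow> card {a \<in> verts G. z \<in> frontier (reg a)} < t"
proof -
  obtain V E \<omega> where m: "is_map V E \<omega>" "digraph_iso (graph_of_map V E \<omega>) G"
    using assms(1) unfolding map_graph_def by blast
  have pg: "plane_graph V E" using m(1) unfolding is_map_def by blast
  have fV: "finite V" using pg unfolding plane_graph_def by (elim conjE)
  let ?M = "graph_of_map V E \<omega>"
  let ?N = "nations V E \<omega>"
  obtain hom where hom: "pre_digraph.digraph_isomorphism ?M hom" "G = app_iso hom ?M"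
    using m(2) unfolding digraph_iso_def by blast
  have vM: "verts ?M = ?N" unfolding graph_of_map_def by simp
  have aM: "arcs ?M = {(f, g). f \<in> ?N \<and> g \<in> ?N \<and> f \<noteq> g \<and> (\<exists>v\<in>V. v \<in> frontier f \<and> v \<in> frontier g)}"
    "tail ?M = fst" "head ?M = snd" unfolding graph_of_map_def by simp_all
  let ?i = "iso_verts hom"
  have inj: "inj_on ?i ?N" and inja: "inj_on (iso_arcs hom) (arcs ?M)"
    and ends: "\<And>a. a \<in> arcs ?M \<Longrightarrow> ?i (fst a) = iso_tail hom (iso_arcs hom a) \<and> ?i (snd a) = iso_head hom (iso_arcs hom a)"
    using hom(1) unfolding pre_digraph.digraph_isomorphism_def vM aM(2,3) by auto
  have vG: "verts G = ?i ` ?N" and aG: "arcs G = iso_arcs hom ` arcs ?M" and tG: "tail G = iso_tail hom" "head G = iso_head hom"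
    using hom(2) vM by simp_all
  define reg where "reg = the_inv_into ?N ?i"
  have reg: "reg (?i f) = f" if "f \<in> ?N" for f using the_inv_into_f_f[OF inj that] unfolding reg_def .
  have regN: "reg a \<in> ?N" "?i (reg a) = a" if "a \<in> verts G" for a using that vG reg by auto
  have arcsG: "arcs_ends G = (\<lambda>a. (?i (fst a), ?i (snd a))) ` arcs ?M"
    unfolding arcs_ends_def arc_to_ends_def aG tG image_image using ends by (auto intro!: image_cong)
  have AE: "(u, v) \<in> arcs_ends G \<longleftrightarrow>
       u \<in> verts G \<and> v \<in> verts G \<and> u \<noteq> v \<and> (\<exists>z\<in>V. z \<in> frontier (reg u) \<and> z \<in> frontier (reg v))" for u v
  proof
    assume "(u, v) \<in> arcs_ends G"
    then obtain f g where fg: "(f, g) \<in> arcs ?M" "u = ?i f" "v = ?i g" unfolding arcsG by auto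
    then have fgN: "f \<in> ?N" "g \<in> ?N" "f \<noteq> g" "\<exists>z\<in>V. z \<in> frontier f \<and> z \<in> frontier g" using aM by auto
    then have "u \<noteq> v" using fg inj unfolding inj_on_def by blast
    then show "u \<in> verts G \<and> v \<in> verts G \<and> u \<noteq> v \<and> (\<exists>z\<in>V. z \<in> frontier (reg u) \<and> z \<in> frontier (reg v))"
      using fgN fg reg vG by simp
  next
    assume a: "u \<in> verts G \<and> v \<in> verts G \<and> u \<noteq> v \<and> (\<exists>z\<in>V. z \<in> frontier (reg u) \<and> z \<in> frontier (reg v))"
    then have "(reg u, reg v) \<in> arcs ?M" using regN[of u] regN[of v] unfolding aM by auto
    then show "(u, v) \<in> arcs_ends G" unfolding arcsG using regN[of u] regN[of v] a by force
  qed
  have wf: "wf_digraph G"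
  proof
    fix e assume "e \<in> arcs G"
    then obtain a where a: "a \<in> arcs ?M" "e = iso_arcs hom a" unfolding aG by blast
    then have "fst a \<in> ?N" "snd a \<in> ?N" unfolding aM by auto
    then have "?i (fst a) \<in> verts G" "?i (snd a) \<in> verts G" unfolding vG by blast+
    then show "tail G e \<in> verts G" "head G e \<in> verts G" using ends[OF a(1)] a(2) unfolding tG by simp_all
  qed
  have nomulti: "e1 = e2" if e: "e1 \<in> arcs G" "e2 \<in> arcs G" "arc_to_ends G e1 = arc_to_ends G e2" for e1 e2
  proof -
    obtain a1 a2 where a: "a1 \<in> arcs ?M" "e1 = iso_arcs hom a1" "a2 \<in> arcs ?M" "e2 = iso_arcs hom a2"
      using e(1,2) unfolding aG by blast
    have n: "fst a1 \<in> ?N" "snd a1 \<in> ?N" "fst a2 \<in> ?N" "snd a2 \<in> ?N" using a(1,3) unfolding aM by auto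
    have "?i (fst a1) = ?i (fst a2)" "?i (snd a1) = ?i (snd a2)"
      using e(3) ends[OF a(1)] ends[OF a(3)] unfolding arc_to_ends_def tG a(2,4) by auto
    then have "fst a1 = fst a2" "snd a1 = snd a2" using inj n unfolding inj_on_def by blast+
    then have "a1 = a2" by (rule prod_eqI)
    then show ?thesis using a by simp
  qed
  have cf: "closed_face V E (reg a)" if "a \<in> verts G" for a
    using regN(1)[OF that] m(1) unfolding is_map_def nations_def by blast
  have irr: "(x, x) \<notin> arcs_ends G" for x using AE by blast
  let ?K = "\<lambda>z. {a \<in> verts G. z \<in> frontier (reg a)}"
  \<comment> \<open>Nations at \<open>z\<close> are pairwise adjacent, so \<open>t\<close> of them
    induce a complete graph. Finiteness is proved together with the bound, because an infinite set
    has \<open>card\<close> 0.\<close>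
  have K: "finite (?K z) \<and> card (?K z) < t" if z: "z \<in> V" for z
  proof (rule ccontr)
    assume "\<not> ?thesis"
    then obtain L where L: "L \<subseteq> ?K z" "card L = t" "finite L"
      by (metis (lifting) infinite_arbitrarily_large not_less obtain_subset_with_card_n)
    interpret wf_digraph G by (rule wf)
    have LV: "L \<subseteq> verts G" using L(1) by blast
    have ends: "arcs_ends (G \<restriction> L) = {(u, v). (u, v) \<in> L \<times> L \<and> u \<noteq> v}"
      unfolding arcs_ends_induce using AE L(1) z by blast
    have "graph (G \<restriction> L)"
    proof
      show "finite (verts (G \<restriction> L))" using L(3) by simp
      have "arc_to_ends G ` arcs (G \<restriction> L) \<subseteq> L \<times> L" by (auto simp: arc_to_ends_def)
      then have "finite (arc_to_ends G ` arcs (G \<restriction> L))" using L(3) finite_subset by blast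
      moreover have "inj_on (arc_to_ends G) (arcs (G \<restriction> L))" using nomulti by (auto intro!: inj_onI)
      ultimately show "finite (arcs (G \<restriction> L))" using finite_imageD by blast
      show "tail (G \<restriction> L) e \<noteq> head (G \<restriction> L) e" if "e \<in> arcs (G \<restriction> L)" for e
        using that irr[of "tail G e"] by (force simp: arcs_ends_def arc_to_ends_def)
      show "e1 = e2" if "e1 \<in> arcs (G \<restriction> L)" "e2 \<in> arcs (G \<restriction> L)"
        "arc_to_ends (G \<restriction> L) e1 = arc_to_ends (G \<restriction> L) e2" for e1 e2
        using that nomulti[of e1 e2] by (simp add: arc_to_ends_def)
      show "symmetric (G \<restriction> L)" unfolding symmetric_def ends by (auto simp: sym_def)
    qed auto
    then have "complete_digraph t (G \<restriction> L)" unfolding complete_digraph_def using L(2) ends by simp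
    moreover have "induced_subgraph (G \<restriction> L) G" using LV by (rule induced_induce)
    ultimately show False using assms(2) unfolding complete_free_def by blast
  qed
  \<comment> \<open>The boundary cycle of a nation contains a map vertex, and there are finitely
    many vertices with finitely many nations each.\<close>
  have "verts G \<subseteq> (\<Union>z\<in>V. ?K z)"
  proof
    fix a assume a: "a \<in> verts G"
    obtain p where p: "undirected_cycle (plane_skeleton V E) p"
      "frontier (reg a) = \<Union>{e \<in> E. \<exists>(u, v)\<in>set p. e \<inter> V = {u, v}}"
      using cf[OF a] unfolding closed_face_def by (elim conjE exE) (rule that)
    have "length p \<ge> 3" "set p \<subseteq> arcs (plane_skeleton V E)"
      using p(1) unfolding undirected_cycle_def pre_digraph.cycle_def pre_digraph.awalk_def by auto
    then have hp: "hd p \<in> set p" "hd p \<in> arcs (plane_skeleton V E)" by (auto intro!: hd_in_set)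
    obtain u v where uv: "hd p = (u, v)" by (cases "hd p")
    then have "\<exists>e\<in>E. e \<inter> V = {u, v}" using hp(2) unfolding plane_skeleton_def by auto
    then obtain e where e: "(u, v) \<in> set p" "e \<in> E" "e \<inter> V = {u, v}" using hp(1) uv by metis
    then have "e \<in> {e \<in> E. \<exists>(u, v)\<in>set p. e \<inter> V = {u, v}}" by blast
    moreover have "u \<in> e" "u \<in> V" using e(3) by blast+
    ultimately have "u \<in> frontier (reg a)" "u \<in> V" unfolding p(2) by blast+
    then show "a \<in> (\<Union>z\<in>V. ?K z)" using a by blast
  qed
  then have fin: "finite (verts G)" using K fV finite_subset[of "verts G" "\<Union>z\<in>V. ?K z"] by blast
  have "inj_on reg (verts G)" by (rule inj_onI) (metis regN(2))
  then show ?thesis using that[OF wf pg fin _ cf AE] K by blast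
qed

text \<open>Passing to the incidence graph keeps the bag size \<open>w\<close>, since a map vertex
  and its nations fill a bag of at most \<open>t \<le> w\<close> elements. Only the way back, where
  a map vertex is replaced by its nations, costs the factor \<open>t\<close>. The numeral 6 is the
  order of the excluded clique minor.\<close>

lemma map_graph_treewidth_bound:
  assumes G: "map_graph G" "complete_free t G" and X: "X \<subseteq> verts G"
    and w: "1 \<le> t" "t \<le> w" "treewidth (remove_verts G X) \<le> int w - 1"
    and r: "r \<ge> 1" "6 * ((1 + 2 ^ 6) * ((1 + 2 * w * 2 ^ 6) * card X)) \<le> r * r"
  shows "treewidth G \<le> int (((3 * (6 * r) + 1) * (2 * w + 6 + 1) + (3 * w + 6)) * t)"
proof (rule map_graph_incidence[OF G])
  fix V E and reg :: "'a \<Rightarrow> complex set"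
  assume wf: "wf_digraph G" and pg: "plane_graph V E"
    and fin: "finite (verts G)" and inj: "inj_on reg (verts G)"
    and cf: "\<And>a. a \<in> verts G \<Longrightarrow> closed_face V E (reg a)"
    and AE: "\<And>u v. (u, v) \<in> arcs_ends G \<longleftrightarrow>
       u \<in> verts G \<and> v \<in> verts G \<and> u \<noteq> v \<and> (\<exists>z\<in>V. z \<in> frontier (reg u) \<and> z \<in> frontier (reg v))"
    and K: "\<And>z. z \<in> V \<Longrightarrow> card {a \<in> verts G. z \<in> frontier (reg a)} < t"
  have fV: "finite V" using pg unfolding plane_graph_def by (elim conjE)
  let ?N = "verts G"
  let ?R = "incidence reg"
  define U :: "('a + complex) set" where "U = Inl ` ?N \<union> Inr ` V"
  define K where "K = (\<lambda>z. {a \<in> ?N. z \<in> frontier (reg a)})"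
  have Kt: "card (K z) < t" if "z \<in> V" for z using K[OF that] unfolding K_def .
  have KN: "K z \<subseteq> ?N" for z unfolding K_def by blast
  have fK: "finite (K z)" for z using KN fin finite_subset by blast
  have adjI: "adj G a b" if "z \<in> V" "a \<in> K z" "b \<in> K z" "a \<noteq> b" for a b z
    using that AE unfolding adj_def K_def by blast
  have adjE: "\<exists>z\<in>V. a \<in> K z \<and> b \<in> K z" if "adj G a b" for a b
    using that AE unfolding adj_def K_def by blast
  have adjV: "a \<in> ?N \<and> b \<in> ?N" if "adj G a b" for a b
    using that AE unfolding adj_def by blast
  have fU: "finite U" unfolding U_def using fin fV by simp
  have nm: "\<not> clique_minor ?R U 6" unfolding U_def by (rule incidence_no_K6_minor[OF pg fin cf inj])
  have RK: "?R (Inl a) (Inr z) \<longleftrightarrow> a \<in> K z" if "a \<in> ?N" for a z using that unfolding K_def by simp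
  define J :: "'a + complex \<Rightarrow> 'a + complex \<Rightarrow> bool" where "J = (\<lambda>x y. \<exists>a b. x = Inl a \<and> y = Inl b \<and> adj G a b)"
  \<comment> \<open>The adjacency \<open>J\<close> of nations is kept only until the map vertices
    are hung on; the decomposition for \<open>?R\<close> alone then follows by monotonicity.\<close>
  define F where "F = (\<lambda>x y. ?R x y \<or> J x y)"
  have JK: "\<exists>z\<in>V. x \<in> Inl ` K z \<and> y \<in> Inl ` K z" if "J x y" for x y :: "'a + complex"
    using that adjE unfolding J_def by blast
  \<comment> \<open>The nations at a map vertex form a clique, so the vertex can be added below a bag containing it.\<close>
  have "\<exists>S. td ?R w (U - Inl ` X) S"
  proof -
    let ?H = "remove_verts G X"
    have vH: "verts ?H = ?N - X" unfolding remove_verts_def by simp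
    have eH: "arcs_ends ?H = {(u, v) \<in> arcs_ends G. u \<in> ?N - X \<and> v \<in> ?N - X}"
      unfolding remove_verts_def arcs_ends_induce ..
    obtain S where "td (adj ?H) w (?N - X) S"
      using td_of_treewidth[of ?H w] w(3) fin unfolding vH eH by auto
    then have t1: "td F w (Inl ` (?N - X)) (Inl ` S)"
      by (rule td_image) (auto simp: F_def J_def adj_def eH)
    have "td F w (Inl ` (?N - X) \<union> (\<Union>z\<in>V. {Inr z})) (Inl ` S)"
    proof (rule td_attach_cliques[OF fV t1, where K = "\<lambda>z. Inl ` (K z - X)"])
      fix z assume z: "z \<in> V"
      have "card ({Inr z :: 'a + complex} \<union> Inl ` (K z - X)) \<le> 1 + card (K z - X)"
        using card_Un_le[of "{Inr z :: 'a + complex}" "Inl ` (K z - X)"]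
          card_image_le[of "K z - X" "Inl :: 'a \<Rightarrow> 'a + complex"] fK[of z] by simp
      also have "card (K z - X) \<le> card (K z)" using fK[of z] by (intro card_mono) auto
      finally have "card ({Inr z :: 'a + complex} \<union> Inl ` (K z - X)) \<le> w" using Kt[OF z] w(2) by simp
      then have "td F w ({Inr z} \<union> Inl ` (K z - X)) ({Inr z} \<union> Inl ` (K z - X))"
        using fK[of z] by (intro td.leaf) auto
      then show "\<exists>R. Inl ` (K z - X) \<subseteq> R \<and> td F w ({Inr z} \<union> Inl ` (K z - X)) R" by blast
      show "Inl ` (K z - X) \<subseteq> Inl ` (?N - X)" using KN[of z] by blast
      show "{Inr z} \<inter> Inl ` (?N - X) = {}" by blast
      show "F x y" if "x \<in> Inl ` (K z - X)" "y \<in> Inl ` (K z - X)" "x \<noteq> y" for x y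
        using that adjI[OF z] unfolding F_def J_def by blast
      show "{Inr z :: 'a + complex} \<inter> {Inr y} = {}" if "z \<noteq> y" for y using that by simp
      show "y \<in> {Inr z} \<union> Inl ` (K z - X)"
        if xy: "x \<in> {Inr z}" "y \<in> Inl ` (?N - X) \<union> (\<Union>j\<in>V. {Inr j})" "F x y \<or> F y x" for x y
      proof -
        have R: "?R x y \<or> ?R y x" using xy(1,3) unfolding F_def J_def by auto
        show ?thesis
        proof (cases y)
          case (Inl a)
          then have "a \<in> ?N - X" using xy(2) by auto
          then show ?thesis using R xy(1) Inl RK[of a z] by auto
        next
          case (Inr b)
          then show ?thesis using R xy(1) by auto
        qed
      qed
    qed
    moreover have "Inl ` (?N - X) \<union> (\<Union>z\<in>V. {Inr z}) = U - Inl ` X" unfolding U_def by auto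
    ultimately have "td F w (U - Inl ` X) (Inl ` S)" by simp
    then have "td ?R w (U - Inl ` X) (Inl ` S)" by (rule td_mono) (auto simp: F_def)
    then show ?thesis by blast
  qed
  then obtain S1 where t1: "td ?R w (U - Inl ` X) S1" by blast
  let ?W = "(3 * (6 * r) + 1) * (2 * w + 6 + 1) + (3 * w + 6)"
  have "card (Inl ` X :: ('a + complex) set) = card X" by (simp add: card_image)
  then have r2: "6 * ((1 + 2 ^ 6) * ((1 + 2 * w * 2 ^ 6) * card (Inl ` X :: ('a + complex) set))) \<le> r * r" using r(2) by simp
  have XU: "Inl ` X \<subseteq> U" using X unfolding U_def by blast
  obtain S2 where t2: "td ?R ?W U S2"
    using td_minor_free_deletion[OF fU symp_incidence nm XU t1 r(1) r2] by blast
  \<comment> \<open>Fewer than \<open>t\<close> nations and the vertex itself make at most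
    \<open>t\<close> elements; intersecting with the nations afterwards removes the map
    vertices.\<close>
  define \<phi> where "\<phi> = (\<lambda>x. case x of Inl a \<Rightarrow> {Inl a} | Inr z \<Rightarrow> insert (Inr z) (Inl ` K z))"
  have "td J (?W * t) (\<Union>x\<in>U. \<phi> x) (\<Union>x\<in>S2. \<phi> x)"
  proof (rule td_subst[OF t2 symp_incidence fU order_refl])
    show "x \<in> \<phi> x \<and> \<phi> x \<subseteq> insert x {y \<in> U. ?R x y} \<and> card (\<phi> x) \<le> t" if x: "x \<in> U" for x
    proof (cases x)
      case (Inl a)
      then show ?thesis using w(1) unfolding \<phi>_def by simp
    next
      case (Inr z)
      then have z: "z \<in> V" using x unfolding U_def by auto
      have "card (insert (Inr z) (Inl ` K z) :: ('a + complex) set) \<le> Suc (card (K z))"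
        using card_insert_if[of "Inl ` K z :: ('a + complex) set" "Inr z"] fK[of z]
          card_image_le[OF fK[of z], of "Inl :: 'a \<Rightarrow> 'a + complex"] by auto
      then have "card (\<phi> x) \<le> t" using Inr Kt[OF z] unfolding \<phi>_def by simp
      then show ?thesis using Inr KN[of z] unfolding \<phi>_def U_def K_def by auto
    qed
    show "?R x y \<or> (\<exists>z\<in>U. x \<in> \<phi> z \<and> y \<in> \<phi> z)" if j: "J x y" for x y
    proof -
      obtain z where z: "z \<in> V" "x \<in> Inl ` K z" "y \<in> Inl ` K z" using JK[OF j] by blast
      then have "Inr z \<in> U" "x \<in> \<phi> (Inr z)" "y \<in> \<phi> (Inr z)" unfolding U_def \<phi>_def by auto
      then show ?thesis by blast
    qed
  qed blast
  then have "td J (?W * t) ((\<Union>x\<in>U. \<phi> x) \<inter> Inl ` ?N) ((\<Union>x\<in>S2. \<phi> x) \<inter> Inl ` ?N)" by (rule td_Int)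
  moreover have "(\<Union>x\<in>U. \<phi> x) \<inter> Inl ` ?N = Inl ` ?N" unfolding U_def \<phi>_def by auto
  ultimately obtain S3 where t3: "td J (?W * t) (Inl ` ?N) S3" by auto
  have "td (adj G) (?W * t) (projl ` (Inl ` ?N :: ('a + complex) set)) (projl ` S3)"
    by (rule td_image[OF t3]) (auto simp: J_def inj_on_def)
  then have "td (adj G) (?W * t) ?N (projl ` S3)" by (simp add: image_image)
  then have "treewidth G \<le> int (?W * t) - 1"
    by (rule treewidth_le) (use AE in \<open>auto simp: adj_def\<close>)
  then show ?thesis by linarith
qed

theorem theorem2:
  fixes t :: nat
  assumes "t \<ge> 1"
  shows "truly_sublinear_treewidth (complete_free_map_graphs t :: ('a, 'b) pre_digraph set) (1 / 2)"
  unfolding truly_sublinear_treewidth_def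
proof (intro conjI allI impI)
  fix \<eta> :: real assume \<eta>: "\<eta> > 0"
  \<comment> \<open>Width at most the floor of \<open>\<eta>\<close> means bags with one vertex
    more; \<open>t\<close> leaves room for the bags around map vertices.\<close>
  define w where "w = max (nat \<lfloor>\<eta>\<rfloor> + 1) t"
  \<comment> \<open>The factor of \<open>card X\<close> in the size condition for
    \<open>h = 6\<close>. With \<open>card X \<le> r0 * r0\<close>, the choice \<open>c * r0\<close>
    for \<open>r\<close> meets that condition because \<open>c \<le> c * c\<close>.\<close>
  define c :: nat where "c = 6 * ((1 + 2 ^ 6) * (1 + 2 * w * 2 ^ 6))"
  \<comment> \<open>The bound evaluated at \<open>r = 2 * c\<close>: rounding up the root
    \<open>s \<ge> 1\<close> at most doubles it, so \<open>r \<le> 2 * c * s\<close>, and the terms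
    without \<open>r\<close> are multiplied by \<open>s\<close>.\<close>
  define \<beta> where "\<beta> = real (((3 * (6 * (2 * c)) + 1) * (2 * w + 6 + 1) + (3 * w + 6)) * t)"
  have c1: "c \<ge> 1" unfolding c_def by simp
  have "\<beta> > 0" unfolding \<beta>_def using assms by (simp only: of_nat_0_less_iff) simp
  moreover have "real_of_int (treewidth G) \<le> \<eta> + \<beta> * real (card X) powr (1 / 2)"
    if G: "G \<in> (complete_free_map_graphs t :: ('a, 'b) pre_digraph set)" and X: "X \<subseteq> verts G"
      and tw: "real_of_int (treewidth (remove_verts G X)) \<le> \<eta>" for G X
  proof -
    have mg: "map_graph G" "complete_free t G" using G unfolding complete_free_map_graphs_def by auto
    have wf: "wf_digraph G" by (rule map_graph_incidence[OF mg])
    have fin: "finite (verts G)" by (rule map_graph_incidence[OF mg])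
    show ?thesis
    proof (cases "X = {}")
      \<comment> \<open>The power is 0 here, so the bound has to be \<open>\<eta>\<close>
        itself.\<close>
      case True
      then show ?thesis using tw treewidth_remove_none[OF wf] by simp
    next
      case False
      have "finite X" using X fin finite_subset by blast
      then have k1: "card X \<ge> 1" using False by (simp add: Suc_leI card_gt_0_iff)
      define s where "s = sqrt (real (card X))"
      have s1: "s \<ge> 1" unfolding s_def using k1 by simp
      define r0 where "r0 = nat \<lceil>s\<rceil>"
      have r0: "s \<le> real r0" "real r0 \<le> 2 * s" unfolding r0_def using s1 by linarith+
      have "real (card X) = s * s" unfolding s_def by simp
      also have "\<dots> \<le> real r0 * real r0" using r0 s1 by (intro mult_mono) auto
      finally have kr: "card X \<le> r0 * r0" by (metis of_nat_le_iff of_nat_mult)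
      let ?r = "c * r0"
      have "6 * ((1 + 2 ^ 6) * ((1 + 2 * w * 2 ^ 6) * card X)) = c * card X" unfolding c_def by (simp add: algebra_simps)
      also have "\<dots> \<le> c * (r0 * r0)" using kr by (rule mult_le_mono2)
      also have "\<dots> \<le> c * (c * (r0 * r0))" using c1 by simp
      finally have r2: "6 * ((1 + 2 ^ 6) * ((1 + 2 * w * 2 ^ 6) * card X)) \<le> ?r * ?r" by (simp add: algebra_simps)
      have "real r0 \<ge> 1" using r0(1) s1 by linarith
      then have r1: "?r \<ge> 1" using c1 by simp
      have "treewidth (remove_verts G X) \<le> \<lfloor>\<eta>\<rfloor>" using tw by linarith
      then have tww: "treewidth (remove_verts G X) \<le> int w - 1" unfolding w_def using \<eta> by linarith
      have tG: "treewidth G \<le> int (((3 * (6 * ?r) + 1) * (2 * w + 6 + 1) + (3 * w + 6)) * t)"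
        by (rule map_graph_treewidth_bound[OF mg X assms _ tww r1 r2]) (simp add: w_def)
      have "real_of_int (treewidth G) \<le> real (((3 * (6 * ?r) + 1) * (2 * w + 6 + 1) + (3 * w + 6)) * t)"
        using tG by linarith
      also have "\<dots> = ((18 * (real c * real r0) + 1) * (2 * real w + 7) + (3 * real w + 6)) * real t"
        by (simp add: algebra_simps)
      also have "\<dots> \<le> ((18 * (real c * (2 * s)) + 1 * s) * (2 * real w + 7) + (3 * real w + 6) * s) * real t"
      proof -
        have a: "18 * (real c * real r0) + 1 \<le> 18 * (real c * (2 * s)) + 1 * s"
          using mult_left_mono[OF r0(2), of "real c"] s1 by simp
        have b: "3 * real w + 6 \<le> (3 * real w + 6) * s" using mult_left_mono[OF s1, of "3 * real w + 6"] by simp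
        have "(18 * (real c * real r0) + 1) * (2 * real w + 7) \<le> (18 * (real c * (2 * s)) + 1 * s) * (2 * real w + 7)"
          by (rule mult_right_mono[OF a]) simp
        from mult_right_mono[OF add_mono[OF this b]] show ?thesis by simp
      qed
      also have "\<dots> = \<beta> * s" unfolding \<beta>_def by (simp add: algebra_simps)
      also have "s = real (card X) powr (1 / 2)" unfolding s_def by (simp add: powr_half_sqrt)
      finally show ?thesis using \<eta> by simp
    qed
  qed
  ultimately show "\<exists>\<beta>>0. \<forall>G\<in>(complete_free_map_graphs t :: ('a, 'b) pre_digraph set). \<forall>X\<subseteq>verts G.
      real_of_int (treewidth (remove_verts G X)) \<le> \<eta> \<longrightarrow> real_of_int (treewidth G) \<le> \<eta> + \<beta> * real (card X) powr (1 / 2)"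
    by blast
qed auto

end
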